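(* \textsc{Length-Bounded Cut} can be solved in $O(n^3\cdot m)$ time if the input graph is a proper interval graph with $n$ vertices and $m$ edges.
   Context: \textsc{Length-Bounded Cut}: given an undirected graph $G=(V,E)$, two vertices $s,t$, and positive integers $\beta,\lambda$, decide whether there is $F\subseteq E$ with $|F|\le\beta$ such that $G-F$ contains no $s$-$t$-path of length (number of edges) at most $\lambda$. An interval graph is a graph in which each vertex $v$ can be assigned an interval $[b_v,e_v]$ such that two vertices are adjacent iff their intervals intersect; it is a proper interval graph if there is such a representation in which no interval is contained in another (equivalently, all intervals have length one). *)

theory Defs
  imports Complex_Main
begin

section \<open>Graphs, proper interval graphs, length-bounded cuts\<close>

text \<open>An undirected simple graph is a vertex set together with a set of two-element edges.\<close>

definition simple_graph :: "'a set \<Rightarrow> 'a set set \<Rightarrow> bool" where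
  "simple_graph V E \<longleftrightarrow> finite V \<and> E \<subseteq> {{u, v} | u v. u \<in> V \<and> v \<in> V \<and> u \<noteq> v}"

definition interval_representation ::
    "'a set \<Rightarrow> 'a set set \<Rightarrow> ('a \<Rightarrow> real) \<Rightarrow> ('a \<Rightarrow> real) \<Rightarrow> bool" where
  "interval_representation V E b e \<longleftrightarrow>
     (\<forall>v\<in>V. b v \<le> e v) \<and>
     (\<forall>u\<in>V. \<forall>v\<in>V. u \<noteq> v \<longrightarrow> ({u, v} \<in> E \<longleftrightarrow> {b u..e u} \<inter> {b v..e v} \<noteq> {}))"

definition proper_interval_graph :: "'a set \<Rightarrow> 'a set set \<Rightarrow> bool" where
  "proper_interval_graph V E \<longleftrightarrow> simple_graph V E \<and>
     (\<exists>b e. interval_representation V E b e \<and>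
       (\<forall>u\<in>V. \<forall>v\<in>V. u \<noteq> v \<longrightarrow> \<not> {b u..e u} \<subseteq> {b v..e v}))"

definition is_path :: "'a set \<Rightarrow> 'a set set \<Rightarrow> 'a \<Rightarrow> 'a \<Rightarrow> 'a list \<Rightarrow> bool" where
  "is_path V E s t p \<longleftrightarrow> p \<noteq> [] \<and> hd p = s \<and> last p = t \<and> distinct p \<and> set p \<subseteq> V \<and>
     (\<forall>i. Suc i < length p \<longrightarrow> {p ! i, p ! Suc i} \<in> E)"

definition path_length :: "'a list \<Rightarrow> nat" where
  "path_length p = length p - 1"

definition length_bounded_cut ::
    "'a set \<Rightarrow> 'a set set \<Rightarrow> 'a \<Rightarrow> 'a \<Rightarrow> nat \<Rightarrow> nat \<Rightarrow> bool" where
  "length_bounded_cut V E s t \<beta> l \<longleftrightarrow>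
     (\<exists>F\<subseteq>E. card F \<le> \<beta> \<and> \<not> (\<exists>p. is_path V (E - F) s t p \<and> path_length p \<le> l))"


section \<open>A word random-access machine\<close>

text \<open>
  Programs are structured random-access-machine programs over one memory of natural numbers;
  fixed cells serve as registers, and \<open>Mem\<close> gives indirect addressing. Every operation
  costs one time unit. Truth values are numbers, with zero meaning false.
\<close>

type_synonym memory = "nat \<Rightarrow> nat"

datatype exp =
    Const nat
  | Mem exp
  | Plus exp exp
  | Minus exp exp
  | Times exp exp

datatype prog =
    Skip
  | Assign exp exp
  | Seq prog prog
  | Cond exp prog prog
  | While exp prog

text \<open>\<open>Minus\<close> is truncated subtraction.\<close>

fun val :: "exp \<Rightarrow> memory \<Rightarrow> nat" where
  "val (Const c) M = c"
| "val (Mem a) M = M (val a M)"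
| "val (Plus a b) M = val a M + val b M"
| "val (Minus a b) M = val a M - val b M"
| "val (Times a b) M = val a M * val b M"

fun cost :: "exp \<Rightarrow> nat" where
  "cost (Const c) = 1"
| "cost (Mem a) = cost a + 1"
| "cost (Plus a b) = cost a + cost b + 1"
| "cost (Minus a b) = cost a + cost b + 1"
| "cost (Times a b) = cost a + cost b + 1"

text \<open>
  A machine word holds the numbers up to \<open>W\<close>. This bound applies to all intermediate
  results and all addresses; without it, unit-cost arithmetic on unboundedly long numbers
  would be unrealistically powerful.
\<close>

fun fits :: "nat \<Rightarrow> exp \<Rightarrow> memory \<Rightarrow> bool" where
  "fits W (Const c) M \<longleftrightarrow> c \<le> W"
| "fits W (Mem a) M \<longleftrightarrow> fits W a M \<and> M (val a M) \<le> W"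
| "fits W (Plus a b) M \<longleftrightarrow> fits W a M \<and> fits W b M \<and> val a M + val b M \<le> W"
| "fits W (Minus a b) M \<longleftrightarrow> fits W a M \<and> fits W b M"
| "fits W (Times a b) M \<longleftrightarrow> fits W a M \<and> fits W b M \<and> val a M * val b M \<le> W"

text \<open>
  \<open>exec W P M T M'\<close>: with word bound \<open>W\<close>, program \<open>P\<close> started in memory \<open>M\<close> terminates after
  exactly \<open>T\<close> steps in memory \<open>M'\<close>. An overflowing computation is stuck, so it has no result.
\<close>

inductive exec :: "nat \<Rightarrow> prog \<Rightarrow> memory \<Rightarrow> nat \<Rightarrow> memory \<Rightarrow> bool" for W :: nat where
  Skip: "exec W Skip M 1 M"
| Assign: "fits W a M \<Longrightarrow> fits W e M \<Longrightarrow>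
    exec W (Assign a e) M (cost a + cost e + 1) (M(val a M := val e M))"
| Seq: "exec W P M T1 M1 \<Longrightarrow> exec W Q M1 T2 M2 \<Longrightarrow> exec W (Seq P Q) M (T1 + T2) M2"
| CondTrue: "fits W e M \<Longrightarrow> val e M \<noteq> 0 \<Longrightarrow> exec W P M T M' \<Longrightarrow>
    exec W (Cond e P Q) M (cost e + 1 + T) M'"
| CondFalse: "fits W e M \<Longrightarrow> val e M = 0 \<Longrightarrow> exec W Q M T M' \<Longrightarrow>
    exec W (Cond e P Q) M (cost e + 1 + T) M'"
| WhileFalse: "fits W e M \<Longrightarrow> val e M = 0 \<Longrightarrow> exec W (While e P) M (cost e + 1) M"
| WhileTrue: "fits W e M \<Longrightarrow> val e M \<noteq> 0 \<Longrightarrow> exec W P M T1 M1 \<Longrightarrow>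
    exec W (While e P) M1 T2 M2 \<Longrightarrow> exec W (While e P) M (cost e + 1 + T1 + T2) M2"

lemma exec_deterministic:
  "exec W P M T M' \<Longrightarrow> exec W P M S N \<Longrightarrow> S = T \<and> N = M'"
proof (induction arbitrary: S N rule: exec.induct)
  case (Skip M)
  then show ?case by cases auto
next
  case (Assign a M e)
  from Assign.prems show ?case by cases auto
next
  case (Seq P M T1 M1 Q T2 M2)
  from Seq.prems show ?case by cases (auto dest!: Seq.IH)
next
  case (CondTrue e M P T M' Q)
  from CondTrue.prems show ?case by cases (use CondTrue.hyps in \<open>auto dest!: CondTrue.IH\<close>)
next
  case (CondFalse e M Q T M' P)
  from CondFalse.prems show ?case by cases (use CondFalse.hyps in \<open>auto dest!: CondFalse.IH\<close>)
next
  case (WhileFalse e M P)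
  from WhileFalse.prems show ?case by cases (use WhileFalse.hyps in auto)
next
  case (WhileTrue e M P T1 M1 T2 M2)
  from WhileTrue.prems show ?case by cases (use WhileTrue.hyps in \<open>auto dest!: WhileTrue.IH\<close>)
qed

text \<open>
  The program accepts (final content \<open>1\<close> of cell \<open>0\<close>) or rejects (final content \<open>0\<close>)
  according to \<open>answer\<close>, within \<open>T\<close> steps.
\<close>

definition decides_within :: "nat \<Rightarrow> prog \<Rightarrow> memory \<Rightarrow> bool \<Rightarrow> nat \<Rightarrow> bool" where
  "decides_within W P M answer T \<longleftrightarrow>
     (\<exists>T' M'. exec W P M T' M' \<and> T' \<le> T \<and> M' 0 = (if answer then 1 else 0))"


section \<open>Instances as machine inputs\<close>

text \<open>
  The input graph has vertex set \<open>{..<n}\<close> and is given by a list of its edges, each edge once,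
  in arbitrary order and arbitrary orientation. No interval representation is supplied.
\<close>

definition edge_set :: "(nat \<times> nat) list \<Rightarrow> nat set set" where
  "edge_set es = (\<lambda>(u, v). {u, v}) ` set es"

definition edge_list :: "nat \<Rightarrow> (nat \<times> nat) list \<Rightarrow> bool" where
  "edge_list n es \<longleftrightarrow>
     (\<forall>(u, v)\<in>set es. u < n \<and> v < n \<and> u \<noteq> v) \<and> distinct (map (\<lambda>(u, v). {u, v}) es)"

text \<open>Cells \<open>0\<close> to \<open>5\<close> hold \<open>n\<close>, \<open>m\<close>, \<open>s\<close>, \<open>t\<close>, \<open>\<beta>\<close>, \<open>l\<close>; cells \<open>6 + 2 * i\<close> and
  \<open>7 + 2 * i\<close> hold the end points of the \<open>i\<close>-th edge; all other cells are zero.\<close>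

definition encode_input ::
    "nat \<Rightarrow> (nat \<times> nat) list \<Rightarrow> nat \<Rightarrow> nat \<Rightarrow> nat \<Rightarrow> nat \<Rightarrow> memory" where
  "encode_input n es s t \<beta> l =
     (let xs = [n, length es, s, t, \<beta>, l] @ concat (map (\<lambda>(u, v). [u, v]) es)
      in (\<lambda>a. if a < length xs then xs ! a else 0))"

end

theory Submission
  imports Defs "HOL-Combinatorics.Transposition"
begin

text \<open>
  A set of at most \<open>\<beta>\<close> edges meeting all \<open>s\<close>-\<open>t\<close>-paths of length at most \<open>L\<close> exists iff the vertices
  can be labelled with \<open>0\<close> at \<open>s\<close>, \<open>L + 1\<close> at \<open>t\<close> and labels in \<open>{1..L}\<close> elsewhere such that at most
  \<open>\<beta>\<close> edges are far, that is, have labels differing by at least \<open>2\<close>. No path is longer than the number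
  \<open>m\<close> of edges, so \<open>L \<le> max 1 m\<close> suffices.

  In an ordering of a proper interval graph in which \<open>uw \<in> E\<close> implies \<open>uv, vw \<in> E\<close> for \<open>u < v < w\<close>,
  some optimal labelling is nondecreasing apart from \<open>s\<close> and \<open>t\<close>. To see this, split the ordering at a
  position crossed by an inversion. The vertices with an edge across the split form two cliques, \<open>A\<close> on
  the left and \<open>B\<close> on the right. Let \<open>H x = card {w \<in> B. d w \<le> x + 1} - card {u \<in> A. d u \<le> x - 2}\<close>
  and let \<open>k\<close> maximize \<open>H\<close> between the least label on the right and the greatest one on the left. Both
  raising the right side to at least \<open>k\<close> and lowering the left side to at most \<open>k\<close> create no more far
  edges than they remove, and one of them reduces the inversions. Splits that do not separate \<open>s\<close> from
  \<open>t\<close> come last and need extra care, because the labels of \<open>s\<close> and \<open>t\<close> must not move.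

  A nondecreasing labelling is given by its thresholds \<open>q i\<close>, the numbers of vertices with label at
  most \<open>i\<close>, and its number of far edges is a sum of terms in \<open>q (i - 1)\<close>, \<open>q i\<close>, \<open>q (i + 1)\<close>; this gives a
  dynamic program with \<open>O(n\<^sup>3 L)\<close> steps. The ordering is found by two breadth-first searches: a vertex \<open>z\<close>
  of least degree among those farthest from \<open>s\<close> is, up to twins, an end of the ordering, and sorting the
  component of \<open>z\<close> by the distance from \<open>z\<close> and then by the number of neighbours on the next level minus
  that on the previous level gives the ordering up to twins.
\<close>

section \<open>Raising and lowering labels\<close>

text \<open>One maximizer \<open>k\<close> serves both moves because of the shifts in
  \<open>H\<close>. Raising a right vertex from label x to k strains at most its edges to
  left-clique vertices with labels in (x - 2, k - 2] and relieves those to right-clique vertices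
  with labels in (x + 1, k + 1]; these windows are the increments of the two terms of
  \<open>H\<close>. Lowering a left vertex from x to k exchanges the roles of the windows. Either
  way the surplus of new far edges is at most H x - H k. The fixed labels 0 and L + 1 are untouched
  by both moves only if \<open>s\<close> is left and \<open>t\<close> right of the split, which
  forces the separate treatment of the other splits.

  The four nested loops of the dynamic program use the whole budget, so every other table may be
  computed naively, with at most three loop bounds of order n and one of order m. Overflow is
  controlled by one invariant: all memory cells stay below a linear expression in the input
  parameters, since counts are capped at n, m or 1 and costs at \<open>\<beta> + 1\<close>.\<close>

definition far :: "int \<Rightarrow> int \<Rightarrow> bool" where
  "far a b \<longleftrightarrow> 2 \<le> \<bar>a - b\<bar>"

definition far_edges :: "('v \<Rightarrow> 'v \<Rightarrow> bool) \<Rightarrow> ('v \<Rightarrow> int) \<Rightarrow> ('v::linorder \<times> 'v) set" where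
  "far_edges E d = {(u, v). u < v \<and> E u v \<and> far (d u) (d v)}"

lemma far_sym: "far a b = far b a"
  by (auto simp: far_def abs_minus_commute)

lemma finite_far_edges:
  assumes "finite V" "\<And>u v. E u v \<Longrightarrow> u \<in> V \<and> v \<in> V"
  shows "finite (far_edges E d)"
proof (rule finite_subset)
  show "far_edges E d \<subseteq> V \<times> V" using assms(2) by (auto simp: far_edges_def)
qed (use assms(1) in simp)

text \<open>\<open>max _ k\<close> is nonexpansive, so an edge inside \<open>S\<close> never becomes
  far: a newly far edge joins some \<open>z\<close> in \<open>S\<close> below \<open>k\<close> to a
  vertex outside. Charging it to \<open>z\<close> leaves one local inequality per \<open>z\<close>,
  paid for by edges inside \<open>S\<close> that are far only because \<open>z\<close> is too
  low.\<close>

lemma card_raise_le: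
  fixes d :: "'v::linorder \<Rightarrow> int"
  assumes V: "finite V" "\<And>u v. E u v \<Longrightarrow> u \<in> V \<and> v \<in> V"
    and sym: "\<And>u v. E u v \<Longrightarrow> E v u"
    and le: "\<And>z. z \<in> S \<Longrightarrow> d z < k \<Longrightarrow>
      card {u. u \<notin> S \<and> E u z \<and> \<not> far (d u) (d z) \<and> far (d u) k}
        \<le> card {w. w \<in> S \<and> E z w \<and> d z + 2 \<le> d w \<and> d w \<le> k + 1}"
  shows "card (far_edges E (\<lambda>v. if v \<in> S then max (d v) k else d v)) \<le> card (far_edges E d)"
proof -
  define d' where "d' = (\<lambda>v. if v \<in> S then max (d v) k else d v)"
  define Z where "Z = {z. z \<in> S \<and> z \<in> V \<and> d z < k}"
  define U where "U z = {u. u \<notin> S \<and> E u z \<and> \<not> far (d u) (d z) \<and> far (d u) k}" for z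
  define W where "W z = {w. w \<in> S \<and> E z w \<and> d z + 2 \<le> d w \<and> d w \<le> k + 1}" for z
  define X where "X = far_edges E d' - far_edges E d"
  define Y where "Y = far_edges E d - far_edges E d'"
  have fin: "finite (far_edges E d)" "finite (far_edges E d')"
    using finite_far_edges[OF V] by auto
  have finV: "finite Z" "\<And>z. finite (U z)" "\<And>z. finite (W z)"
    using V by (auto simp: Z_def U_def W_def intro: finite_subset[OF _ V(1)])
  have "card X \<le> card (Sigma Z U)"
  proof -
    define g where "g = (\<lambda>(z, u). (min z u, max z u) :: 'v \<times> 'v)"
    have "X \<subseteq> g ` Sigma Z U"
    proof
      fix e assume "e \<in> X"
      then obtain u v where e: "e = (u, v)" "u < v" "E u v" "far (d' u) (d' v)" "\<not> far (d u) (d v)"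
        by (auto simp: X_def far_edges_def)
      have mem: "u \<in> V" "v \<in> V" using V(2)[OF e(3)] by auto
      consider "u \<in> S" "v \<notin> S" | "u \<notin> S" "v \<in> S"
        using e(4,5) by (auto simp: d'_def far_def max_def split: if_splits)
      then show "e \<in> g ` Sigma Z U"
      proof cases
        case 1
        then have "d u < k" using e(4,5) by (auto simp: d'_def far_def max_def split: if_splits)
        then have "(u, v) \<in> Sigma Z U" using 1 e mem sym[OF e(3)]
          by (auto simp: Z_def U_def d'_def far_def max_def abs_minus_commute split: if_splits)
        moreover have "e = g (u, v)" using e(1,2) by (simp add: g_def)
        ultimately show ?thesis by blast
      next
        case 2
        then have "d v < k" using e(4,5) by (auto simp: d'_def far_def max_def split: if_splits)
        then have "(v, u) \<in> Sigma Z U" using 2 e mem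
          by (auto simp: Z_def U_def d'_def far_def max_def abs_minus_commute split: if_splits)
        moreover have "e = g (v, u)" using e(1,2) by (simp add: g_def)
        ultimately show ?thesis by blast
      qed
    qed
    then have "card X \<le> card (g ` Sigma Z U)"
      using finV by (intro card_mono) auto
    also have "\<dots> \<le> card (Sigma Z U)" using finV by (intro card_image_le) auto
    finally show ?thesis .
  qed
  also have "\<dots> = (\<Sum>z\<in>Z. card (U z))" using finV by (simp add: card_SigmaI)
  also have "\<dots> \<le> (\<Sum>z\<in>Z. card (W z))"
    by (intro sum_mono) (use le in \<open>auto simp: Z_def U_def W_def\<close>)
  also have "\<dots> = card (Sigma Z W)" using finV by (simp add: card_SigmaI)
  also have "\<dots> \<le> card Y"
  proof -
    define g where "g = (\<lambda>(z, w). (min z w, max z w) :: 'v \<times> 'v)"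
    \<comment> \<open>The sorted pair determines \<open>(z, w)\<close>, since \<open>z\<close> is
      the endpoint with the smaller label.\<close>
    have "inj_on g (Sigma Z W)"
      by (rule inj_onI) (force simp: g_def W_def min_def max_def split: if_splits)
    moreover have "g ` Sigma Z W \<subseteq> Y"
    proof (clarsimp simp: g_def)
      fix z w assume zw: "z \<in> Z" "w \<in> W z"
      then have ne: "z \<noteq> w" by (auto simp: W_def)
      have "far (d z) (d w)" "\<not> far (d' z) (d' w)" "E z w"
        using zw by (auto simp: Z_def W_def d'_def far_def max_def)
      then show "(min z w, max z w) \<in> Y"
        using ne sym[of z w] unfolding Y_def far_edges_def
        by (cases "z < w") (auto simp: min_def max_def far_sym)
    qed
    ultimately show ?thesis
      using fin by (metis Y_def card_image card_mono finite_Diff)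
  qed
  finally have "card X \<le> card Y" .
  moreover have "card (far_edges E d') = card (far_edges E d' \<inter> far_edges E d) + card X"
    unfolding X_def using fin by (subst card_Un_disjoint[symmetric]) (auto intro: arg_cong[where f = card])
  moreover have "card (far_edges E d) = card (far_edges E d' \<inter> far_edges E d) + card Y"
    unfolding Y_def using fin by (subst card_Un_disjoint[symmetric]) (auto intro: arg_cong[where f = card])
  ultimately show ?thesis by (simp add: d'_def)
qed

lemma far_edges_uminus: "far_edges E (\<lambda>v. - d v) = far_edges E d"
  by (auto simp: far_edges_def far_def)

text \<open>Raising applied to the negated labels and \<open>- k\<close>; \<open>far\<close> is
  invariant under negation.\<close>

lemma card_lower_le:
  fixes d :: "'v::linorder \<Rightarrow> int"
  assumes V: "finite V" "\<And>u v. E u v \<Longrightarrow> u \<in> V \<and> v \<in> V"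
    and sym: "\<And>u v. E u v \<Longrightarrow> E v u"
    and le: "\<And>z. z \<in> S \<Longrightarrow> k < d z \<Longrightarrow>
      card {u. u \<notin> S \<and> E u z \<and> \<not> far (d u) (d z) \<and> far (d u) k}
        \<le> card {w. w \<in> S \<and> E z w \<and> d w + 2 \<le> d z \<and> k \<le> d w + 1}"
  shows "card (far_edges E (\<lambda>v. if v \<in> S then min (d v) k else d v)) \<le> card (far_edges E d)"
proof -
  have far_neg: "far (- a) b = far a (- b)" for a b by (auto simp: far_def)
  have "card (far_edges E (\<lambda>v. if v \<in> S then max (- d v) (- k) else - d v)) \<le> card (far_edges E (\<lambda>v. - d v))"
  proof (rule card_raise_le[OF V sym])
    fix z assume z: "z \<in> S" "- d z < - k"
    have "{u. u \<notin> S \<and> E u z \<and> \<not> far (- d u) (- d z) \<and> far (- d u) (- k)} =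
        {u. u \<notin> S \<and> E u z \<and> \<not> far (d u) (d z) \<and> far (d u) k}" by (simp add: far_neg)
    moreover have "{w. w \<in> S \<and> E z w \<and> - d z + 2 \<le> - d w \<and> - d w \<le> - k + 1} =
        {w. w \<in> S \<and> E z w \<and> d w + 2 \<le> d z \<and> k \<le> d w + 1}" by auto
    ultimately show "card {u. u \<notin> S \<and> E u z \<and> \<not> far (- d u) (- d z) \<and> far (- d u) (- k)}
        \<le> card {w. w \<in> S \<and> E z w \<and> - d z + 2 \<le> - d w \<and> - d w \<le> - k + 1}"
      using le[of z] z by simp
  qed
  moreover have "(\<lambda>v. if v \<in> S then max (- d v) (- k) else - d v) = (\<lambda>v. - (if v \<in> S then min (d v) k else d v))"
    by (auto simp: min_def max_def)
  ultimately show ?thesis by (simp only: far_edges_uminus)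
qed

section \<open>Monotone optimal labellings along an umbrella ordering\<close>

locale umbrella =
  fixes n :: nat and E :: "nat \<Rightarrow> nat \<Rightarrow> bool"
  assumes E_less: "E u v \<Longrightarrow> u < n \<and> v < n"
    and E_sym: "E u v \<Longrightarrow> E v u"
    and E_irrefl: "\<not> E u u"
    and umb: "u < v \<Longrightarrow> v < w \<Longrightarrow> E u w \<Longrightarrow> E u v \<and> E v w"
begin

text \<open>\<open>right_end\<close>, \<open>left_end\<close> and \<open>balance\<close> are B, A
  and H of the overview for the split after \<open>c\<close>. \<open>X\<close> collects vertices
  right of the split that must keep their label; it is instantiated with \<open>{}\<close> or
  \<open>{s}\<close>.\<close>

definition right_end :: "nat set \<Rightarrow> nat \<Rightarrow> nat set" where
  "right_end X c = {z. c < z \<and> z \<notin> X \<and> (\<exists>u\<le>c. E u z)}"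

definition left_end :: "nat set \<Rightarrow> nat \<Rightarrow> nat set" where
  "left_end X c = {u. u \<le> c \<and> (\<exists>z>c. z \<notin> X \<and> E u z)}"

definition balance :: "nat set \<Rightarrow> nat \<Rightarrow> (nat \<Rightarrow> int) \<Rightarrow> int \<Rightarrow> int" where
  "balance X c d x = int (card {w \<in> right_end X c. d w \<le> x + 1}) - int (card {u \<in> left_end X c. d u \<le> x - 2})"

lemma finite_ends [simp]: "finite (right_end X c)" "finite (left_end X c)"
  using E_less by (auto simp: right_end_def left_end_def intro!: finite_subset[of _ "{..<n}"])

text \<open>For \<open>z < w\<close>, the vertex \<open>z\<close> lies between \<open>w\<close> and
  a neighbour of \<open>w\<close> left of the split, so the umbrella property yields the
  edge.\<close>

lemma right_end_clique: "z \<in> right_end X c \<Longrightarrow> w \<in> right_end X c \<Longrightarrow> z \<noteq> w \<Longrightarrow> E z w"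
proof -
  have "E z w" if "z \<in> right_end X c" "w \<in> right_end X c" "z < w" for z w
    using that umb by (auto simp: right_end_def) (meson le_less_trans)
  then show "z \<in> right_end X c \<Longrightarrow> w \<in> right_end X c \<Longrightarrow> z \<noteq> w \<Longrightarrow> E z w"
    by (metis E_sym linorder_neqE_nat)
qed

lemma left_end_clique: "z \<in> left_end X c \<Longrightarrow> w \<in> left_end X c \<Longrightarrow> z \<noteq> w \<Longrightarrow> E z w"
proof -
  have "E z w" if "z \<in> left_end X c" "w \<in> left_end X c" "z < w" for z w
    using that umb by (auto simp: left_end_def) (meson le_less_trans)
  then show "z \<in> left_end X c \<Longrightarrow> w \<in> left_end X c \<Longrightarrow> z \<noteq> w \<Longrightarrow> E z w"
    by (metis E_sym linorder_neqE_nat)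
qed

lemma card_window:
  fixes d :: "'a \<Rightarrow> int"
  assumes "finite A" "x \<le> y"
  shows "int (card {w \<in> A. d w \<le> y}) = int (card {w \<in> A. d w \<le> x}) + int (card {w \<in> A. x < d w \<and> d w \<le> y})"
proof -
  have "{w \<in> A. d w \<le> y} = {w \<in> A. d w \<le> x} \<union> {w \<in> A. x < d w \<and> d w \<le> y}" using assms by auto
  then have "card {w \<in> A. d w \<le> y} = card {w \<in> A. d w \<le> x} + card {w \<in> A. x < d w \<and> d w \<le> y}"
    using assms by (simp add: card_Un_disjoint disjoint_iff)
  then show ?thesis by simp
qed

text \<open>A left neighbour at \<open>k + 2\<close> or above is already far from \<open>z\<close>,
  so only labels in \<open>(d z - 2, k - 2]\<close> are strained. The neighbour \<open>u0\<close>
  puts \<open>z\<close> into the right clique, which makes the whole relieved window adjacent to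
  \<open>z\<close>.\<close>

lemma raise_bound:
  assumes z: "c < z" "z \<notin> X" "d z < k" and nbr: "u0 \<le> c" "E u0 z"
  shows "int (card {u. u \<le> c \<and> E u z \<and> \<not> far (d u) (d z) \<and> far (d u) k}) + balance X c d k - balance X c d (d z)
    \<le> int (card {w. c < w \<and> w \<notin> X \<and> E z w \<and> d z + 2 \<le> d w \<and> d w \<le> k + 1})"
proof -
  have zR: "z \<in> right_end X c" using z nbr by (auto simp: right_end_def)
  have "card {u. u \<le> c \<and> E u z \<and> \<not> far (d u) (d z) \<and> far (d u) k}
      \<le> card {u \<in> left_end X c. d z - 2 < d u \<and> d u \<le> k - 2}"
    by (rule card_mono) (use z in \<open>auto simp: left_end_def far_def\<close>)
  moreover have "card {w \<in> right_end X c. d z + 1 < d w \<and> d w \<le> k + 1}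
      \<le> card {w. c < w \<and> w \<notin> X \<and> E z w \<and> d z + 2 \<le> d w \<and> d w \<le> k + 1}"
  proof (rule card_mono)
    show "finite {w. c < w \<and> w \<notin> X \<and> E z w \<and> d z + 2 \<le> d w \<and> d w \<le> k + 1}"
      by (rule finite_subset[of _ "{..<n}"]) (auto dest: E_less)
    show "{w \<in> right_end X c. d z + 1 < d w \<and> d w \<le> k + 1} \<subseteq> {w. c < w \<and> w \<notin> X \<and> E z w \<and> d z + 2 \<le> d w \<and> d w \<le> k + 1}"
      using right_end_clique[OF zR] by (force simp: right_end_def)
  qed
  ultimately show ?thesis
    using card_window[of "right_end X c" "d z + 1" "k + 1" d] card_window[of "left_end X c" "d z - 2" "k - 2" d] z(3)
    by (simp add: balance_def)
qed

text \<open>The counterpart of \<open>raise_bound\<close> with the same \<open>balance\<close>: now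
  the right window is strained and the left one relieved, and \<open>w0\<close> puts
  \<open>p\<close> into the left clique.\<close>

lemma lower_bound:
  assumes p: "p \<le> c" "k < d p" and nbr: "c < w0" "w0 \<notin> X" "E p w0"
  shows "int (card {w. c < w \<and> w \<notin> X \<and> E w p \<and> \<not> far (d w) (d p) \<and> far (d w) k}) + balance X c d k - balance X c d (d p)
    \<le> int (card {a. a \<le> c \<and> E p a \<and> d a + 2 \<le> d p \<and> k \<le> d a + 1})"
proof -
  have pL: "p \<in> left_end X c" using p nbr by (auto simp: left_end_def)
  have "card {w. c < w \<and> w \<notin> X \<and> E w p \<and> \<not> far (d w) (d p) \<and> far (d w) k}
      \<le> card {w \<in> right_end X c. k + 1 < d w \<and> d w \<le> d p + 1}"
    by (intro card_mono finite_subset[OF Collect_restrict] finite_ends) (use p E_sym in \<open>auto simp: right_end_def far_def\<close>)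
  moreover have "card {a \<in> left_end X c. k - 2 < d a \<and> d a \<le> d p - 2}
      \<le> card {a. a \<le> c \<and> E p a \<and> d a + 2 \<le> d p \<and> k \<le> d a + 1}"
  proof (rule card_mono)
    show "finite {a. a \<le> c \<and> E p a \<and> d a + 2 \<le> d p \<and> k \<le> d a + 1}"
      by (rule finite_subset[of _ "{..<n}"]) (auto dest: E_less)
    show "{a \<in> left_end X c. k - 2 < d a \<and> d a \<le> d p - 2} \<subseteq> {a. a \<le> c \<and> E p a \<and> d a + 2 \<le> d p \<and> k \<le> d a + 1}"
      using left_end_clique[OF pL] by (force simp: left_end_def)
  qed
  ultimately show ?thesis
    using card_window[of "right_end X c" "k + 1" "d p + 1" d] card_window[of "left_end X c" "k - 2" "d p - 2" d] p(2)
    by (simp add: balance_def)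
qed

section \<open>Labellings, inversions and the three rearrangement steps\<close>

abbreviation "cut_cost d \<equiv> card (far_edges E d)"

definition labelling :: "nat \<Rightarrow> nat \<Rightarrow> int \<Rightarrow> (nat \<Rightarrow> int) \<Rightarrow> bool" where
  "labelling s t L d \<longleftrightarrow> d s = 0 \<and> d t = L + 1 \<and> (\<forall>v<n. v \<noteq> s \<longrightarrow> v \<noteq> t \<longrightarrow> 1 \<le> d v \<and> d v \<le> L)"

text \<open>Pairs meeting \<open>s\<close> or \<open>t\<close> do not count, because the labels
  there are fixed wherever the two stand in the ordering.\<close>

definition inversion :: "nat \<Rightarrow> nat \<Rightarrow> (nat \<Rightarrow> int) \<Rightarrow> nat \<Rightarrow> nat \<Rightarrow> bool" where
  "inversion s t d u v \<longleftrightarrow> u < v \<and> v < n \<and> u \<noteq> s \<and> u \<noteq> t \<and> v \<noteq> s \<and> v \<noteq> t \<and> d v < d u"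

text \<open>The potential that every rearrangement step decreases.\<close>

definition disorder :: "nat \<Rightarrow> nat \<Rightarrow> (nat \<Rightarrow> int) \<Rightarrow> nat" where
  "disorder s t d = (\<Sum>(u, v) \<in> {(u, v). u < v \<and> v < n \<and> {u, v} \<inter> {s, t} = {}}. nat (d u - d v))"

lemma disorder_less:
  assumes "inversion s t d p z" "d' p - d' z < d p - d z"
    and "\<And>u v. u < v \<Longrightarrow> v < n \<Longrightarrow> {u, v} \<inter> {s, t} = {} \<Longrightarrow> d' u - d' v \<le> max 0 (d u - d v)"
  shows "disorder s t d' < disorder s t d"
  unfolding disorder_def
proof (rule sum_strict_mono_ex1)
  show "finite {(u, v). u < v \<and> v < n \<and> {u, v} \<inter> {s, t} = {}}"
    by (rule finite_subset[of _ "{..<n} \<times> {..<n}"]) auto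
  show "\<forall>x\<in>{(u, v). u < v \<and> v < n \<and> {u, v} \<inter> {s, t} = {}}. (case x of (u, v) \<Rightarrow> nat (d' u - d' v)) \<le> (case x of (u, v) \<Rightarrow> nat (d u - d v))"
    using assms(3) by fastforce
  show "\<exists>x\<in>{(u, v). u < v \<and> v < n \<and> {u, v} \<inter> {s, t} = {}}. (case x of (u, v) \<Rightarrow> nat (d' u - d' v)) < (case x of (u, v) \<Rightarrow> nat (d u - d v))"
    using assms(1,2) by (intro bexI[of _ "(p, z)"]) (auto simp: inversion_def)
qed

lemma interval_argmax:
  fixes r J :: int and H :: "int \<Rightarrow> int"
  assumes "r \<le> J"
  shows "\<exists>k\<in>{r..J}. \<forall>j\<in>{r..J}. H j \<le> H k"
proof -
  have "Max (H ` {r..J}) \<in> H ` {r..J}" using assms by (intro Max_in) auto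
  then obtain k where "k \<in> {r..J}" "H k = Max (H ` {r..J})" by (metis imageE)
  then show ?thesis by (intro bexI[of _ k]) auto
qed

text \<open>No vertex has to be exempted: lowering the left side to \<open>k \<ge> 1\<close> keeps 0
  at \<open>s\<close>, and raising the right side to \<open>k \<le> L\<close> keeps
  \<open>L + 1\<close> at \<open>t\<close>.\<close>

lemma straighten_middle:
  assumes lab: "labelling s t L d" and c: "s \<le> c" "c < t" "t < n"
    and inv: "inversion s t d p z" "p \<le> c" "c < z"
  shows "\<exists>d'. labelling s t L d' \<and> cut_cost d' \<le> cut_cost d \<and> disorder s t d' < disorder s t d"
proof -
  define H where "H = balance {} c d"
  define r where "r = Min (d ` {c<..<n})"
  have finR: "finite (d ` {c<..<n})" "d ` {c<..<n} \<noteq> {}" using inv by (auto simp: inversion_def)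
  have r_le: "r \<le> d w" if "c < w" "w < n" for w using that finR by (auto simp: r_def)
  obtain y where y: "c < y" "y < n" "d y = r" using Min_in[OF finR] by (auto simp: r_def)
  have r1: "1 \<le> r" using lab c y r_le[of z] inv
    by (cases "y = t") (auto simp: labelling_def inversion_def)
  define J where "J = Max (d ` {..c})"
  have finL: "finite (d ` {..c})" "d ` {..c} \<noteq> {}" by auto
  have J_ge: "d u \<le> J" if "u \<le> c" for u using that by (auto simp: J_def)
  obtain x where x: "x \<le> c" "d x = J"
    using Max_in[OF finL] unfolding J_def by (metis atMost_iff imageE)
  have rJ: "r < J" using r_le[of z] J_ge[of p] inv by (auto simp: inversion_def)
  have y': "y \<noteq> s" "y \<noteq> t" using y c r_le[of z] inv lab by (auto simp: inversion_def labelling_def)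
  have x': "x \<noteq> s" "x \<noteq> t" using x c rJ r1 lab by (auto simp: labelling_def)
  have JL: "J \<le> L" using x x' lab c by (auto simp: labelling_def)
  have xy: "inversion s t d x y" using x y x' y' rJ by (auto simp: inversion_def)
  obtain k where k: "k \<in> {r..J}" "\<And>j. j \<in> {r..J} \<Longrightarrow> H j \<le> H k"
    using interval_argmax[of r J H] rJ by auto
  show ?thesis
  \<comment> \<open>For \<open>k = r\<close> raising would change nothing, since all right labels
    are at least \<open>r\<close>; lowering moves \<open>x\<close> from \<open>J\<close> down to
    \<open>r\<close>. For \<open>k > r\<close> raising moves \<open>y\<close>.\<close>
  proof (cases "k = r")
    case True
    define d' where "d' = (\<lambda>v. if v \<in> {..c} then min (d v) k else d v)"
    have "cut_cost d' \<le> cut_cost d" unfolding d'_def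
    proof (rule card_lower_le[where V = "{..<n}"])
      fix q assume q: "q \<in> {..c}" "k < d q"
      show "card {u. u \<notin> {..c} \<and> E u q \<and> \<not> far (d u) (d q) \<and> far (d u) k}
          \<le> card {w. w \<in> {..c} \<and> E q w \<and> d w + 2 \<le> d q \<and> k \<le> d w + 1}"
      proof (cases "\<exists>w>c. E q w")
        case True
        then obtain w where "c < w" "E q w" by blast
        then have "int (card {w. c < w \<and> w \<notin> {} \<and> E w q \<and> \<not> far (d w) (d q) \<and> far (d w) k}) + H k - H (d q)
          \<le> int (card {a. a \<le> c \<and> E q a \<and> d a + 2 \<le> d q \<and> k \<le> d a + 1})"
          unfolding H_def using q by (intro lower_bound[of _ _ _ _ w]) auto
        moreover have "H (d q) \<le> H k" using q k(1) J_ge[of q] by (intro k(2)) auto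
        ultimately show ?thesis by (simp add: not_le)
      next
        case False
        then have "{u. u \<notin> {..c} \<and> E u q \<and> \<not> far (d u) (d q) \<and> far (d u) k} = {}"
          using E_sym by (auto simp: not_le)
        then show ?thesis by (simp only: card.empty le0)
      qed
    qed (use E_less E_sym in auto)
    moreover have "labelling s t L d'"
      using lab k(1) r1 c JL unfolding labelling_def d'_def by auto
    moreover have "disorder s t d' < disorder s t d"
      by (rule disorder_less[OF xy]) (use x y k True rJ r_le in \<open>auto simp: d'_def min_def max_def\<close>)
    ultimately show ?thesis by blast
  next
    case False
    then have rk: "r < k" using k(1) by auto
    define d' where "d' = (\<lambda>v. if v \<in> {c<..} then max (d v) k else d v)"
    have "cut_cost d' \<le> cut_cost d" unfolding d'_def
    proof (rule card_raise_le[where V = "{..<n}"])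
      fix q assume q: "q \<in> {c<..}" "d q < k"
      show "card {u. u \<notin> {c<..} \<and> E u q \<and> \<not> far (d u) (d q) \<and> far (d u) k}
          \<le> card {w. w \<in> {c<..} \<and> E q w \<and> d q + 2 \<le> d w \<and> d w \<le> k + 1}"
      proof (cases "\<exists>u\<le>c. E u q")
        case True
        then obtain u where u: "u \<le> c" "E u q" by blast
        then have "int (card {u. u \<le> c \<and> E u q \<and> \<not> far (d u) (d q) \<and> far (d u) k}) + H k - H (d q)
          \<le> int (card {w. c < w \<and> w \<notin> {} \<and> E q w \<and> d q + 2 \<le> d w \<and> d w \<le> k + 1})"
          unfolding H_def using q by (intro raise_bound[of _ _ _ _ _ u]) auto
        moreover have "H (d q) \<le> H k" using q k(1) r_le[of q] E_less[OF u(2)] by (intro k(2)) auto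
        ultimately show ?thesis by (simp add: not_less)
      next
        case False
        then have "{u. u \<notin> {c<..} \<and> E u q \<and> \<not> far (d u) (d q) \<and> far (d u) k} = {}"
          by (auto simp: not_less)
        then show ?thesis by (simp only: card.empty le0)
      qed
    qed (use E_less E_sym in auto)
    moreover have "labelling s t L d'"
      using lab k(1) r1 c JL unfolding labelling_def d'_def by auto
    moreover have "disorder s t d' < disorder s t d"
      by (rule disorder_less[OF xy]) (use x y k rk rJ r_le in \<open>auto simp: d'_def min_def max_def\<close>)
    ultimately show ?thesis by blast
  qed
qed

text \<open>Here \<open>s\<close> lies to the right of the split at \<open>c\<close> but keeps label \<open>0\<close>, so raising a neighbour of \<open>s\<close>
  with label \<open>1\<close> makes one more edge far. A strict increase of \<open>H\<close> pays for this if the neighbour is also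
  adjacent to the left side; otherwise, as the labels between \<open>c\<close> and \<open>s\<close> are sorted, all vertices of the
  right clique have label \<open>1\<close>, and lowering the left side to \<open>1\<close> is free.\<close>

lemma straighten_left:
  assumes lab: "labelling s t L d" and st: "s < t" "t < n"
    and mid: "\<And>u v. inversion s t d u v \<Longrightarrow> v < s \<or> t < u"
    and inv: "inversion s t d p0 z0" "z0 < s"
  shows "\<exists>d'. labelling s t L d' \<and> cut_cost d' \<le> cut_cost d \<and> disorder s t d' < disorder s t d"
proof -
  define P where "P = {p. \<exists>z<s. inversion s t d p z}"
  have "finite P" "P \<noteq> {}" using inv by (auto simp: P_def inversion_def intro: finite_subset[of _ "{..<n}"])
  \<comment> \<open>The last left end of an inversion before \<open>s\<close>, so that the labels
    strictly between \<open>c\<close> and \<open>s\<close> are sorted.\<close>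
  define c where "c = Max P"
  have "c \<in> P" unfolding c_def using \<open>finite P\<close> \<open>P \<noteq> {}\<close> by (rule Max_in)
  then obtain z where z: "inversion s t d c z" "z < s" by (auto simp: P_def)
  have cz: "c < z" "c < s" using z by (auto simp: inversion_def)
  have sorted: "d u \<le> d v" if "c < u" "u \<le> v" "v < s" for u v
  proof (rule ccontr)
    assume "\<not> d u \<le> d v"
    then have "inversion s t d u v" using that st by (cases "u = v") (auto simp: inversion_def)
    then have "u \<in> P" using that by (auto simp: P_def)
    then show False using Max_ge[OF \<open>finite P\<close>, of u] that by (simp add: c_def)
  qed
  define H where "H = balance {s} c d"
  define r where "r = Min (d ` {c<..<s})"
  have finR: "finite (d ` {c<..<s})" "d ` {c<..<s} \<noteq> {}" using z cz by auto
  have r_le: "r \<le> d w" if "c < w" "w < s" for w using that finR by (auto simp: r_def)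
  obtain y where y: "c < y" "y < s" "d y = r" using Min_in[OF finR] by (auto simp: r_def)
  have r1: "1 \<le> r" using lab y st by (auto simp: labelling_def)
  define J where "J = Max (d ` {..c})"
  have finL: "finite (d ` {..c})" "d ` {..c} \<noteq> {}" by auto
  have J_ge: "d u \<le> J" if "u \<le> c" for u using that by (auto simp: J_def)
  obtain x where x: "x \<le> c" "d x = J"
    using Max_in[OF finL] unfolding J_def by (metis atMost_iff imageE)
  have rJ: "r < J" using r_le[of z] J_ge[of c] z cz by (auto simp: inversion_def)
  have JL: "J \<le> L" using x lab cz st by (auto simp: labelling_def)
  have xy: "inversion s t d x y" using x y cz st rJ by (auto simp: inversion_def)
  \<comment> \<open>A smaller label behind \<open>s\<close> would form an inversion with
    \<open>x\<close> across \<open>s\<close>, which \<open>mid\<close> excludes. Hence raising to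
    \<open>k \<le> J\<close> changes nothing behind \<open>s\<close>.\<close>
  have far_right: "J \<le> d w" if "s < w" "w < n" for w
  proof (rule ccontr)
    assume less: "\<not> J \<le> d w"
    then have "w \<noteq> t" using lab JL by (auto simp: labelling_def)
    then have "inversion s t d x w" using less x that cz st by (auto simp: inversion_def)
    then show False using mid x cz st that by fastforce
  qed
  show ?thesis
  proof (cases "(\<forall>j\<in>{r..J}. H j \<le> H r) \<or> (\<forall>w\<in>right_end {s} c. d w = r)")
    case True
    define d' where "d' = (\<lambda>v. if v \<in> {..c} then min (d v) r else d v)"
    have "cut_cost d' \<le> cut_cost d" unfolding d'_def
    proof (rule card_lower_le[where V = "{..<n}"])
      fix q assume q: "q \<in> {..c}" "r < d q"
      \<comment> \<open>\<open>s\<close> has label 0 and \<open>q\<close> a label above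
        \<open>r \<ge> 1\<close>, so an edge between them is far already and \<open>s\<close> drops
        out of the count.\<close>
      have "\<not> (\<not> far (d s) (d q) \<and> far (d s) r)" using lab q r1 by (auto simp: labelling_def far_def)
      then have eq: "{u. u \<notin> {..c} \<and> E u q \<and> \<not> far (d u) (d q) \<and> far (d u) r} =
        {w. c < w \<and> w \<notin> {s} \<and> E w q \<and> \<not> far (d w) (d q) \<and> far (d w) r}" by auto
      show "card {u. u \<notin> {..c} \<and> E u q \<and> \<not> far (d u) (d q) \<and> far (d u) r}
          \<le> card {w. w \<in> {..c} \<and> E q w \<and> d w + 2 \<le> d q \<and> r \<le> d w + 1}"
      proof (cases "\<forall>w\<in>right_end {s} c. d w = r")
        case True
        have "{w. c < w \<and> w \<notin> {s} \<and> E w q \<and> \<not> far (d w) (d q) \<and> far (d w) r} = {}"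
        proof -
          have "d w = r" if "c < w" "w \<noteq> s" "E w q" for w
            using True that q E_sym by (auto simp: right_end_def)
          then show ?thesis by (auto simp: far_def)
        qed
        then show ?thesis unfolding eq by (simp only: card.empty le0)
      next
        case False
        then have Hr: "\<forall>j\<in>{r..J}. H j \<le> H r" using True by blast
        show ?thesis
        proof (cases "\<exists>w>c. w \<notin> {s} \<and> E q w")
          case True
          then obtain w where "c < w" "w \<notin> {s}" "E q w" by blast
          then have "int (card {w. c < w \<and> w \<notin> {s} \<and> E w q \<and> \<not> far (d w) (d q) \<and> far (d w) r}) + H r - H (d q)
            \<le> int (card {a. a \<le> c \<and> E q a \<and> d a + 2 \<le> d q \<and> r \<le> d a + 1})"
            unfolding H_def using q by (intro lower_bound[of _ _ _ _ w]) auto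
          moreover have "H (d q) \<le> H r" using q J_ge[of q] Hr by auto
          ultimately show ?thesis unfolding eq by simp
        next
          case False
          then have "{w. c < w \<and> w \<notin> {s} \<and> E w q \<and> \<not> far (d w) (d q) \<and> far (d w) r} = {}"
            using E_sym by auto
          then show ?thesis unfolding eq by (simp only: card.empty le0)
        qed
      qed
    qed (use E_less E_sym in auto)
    moreover have "labelling s t L d'"
      using lab r1 cz JL rJ st unfolding labelling_def d'_def by auto
    moreover have "disorder s t d' < disorder s t d"
    proof (rule disorder_less[OF xy])
      show "d' x - d' y < d x - d y" using x y rJ by (auto simp: d'_def min_def)
    qed (auto simp: d'_def min_def max_def)
    ultimately show ?thesis by blast
  next
    case False
    obtain k where k: "k \<in> {r..J}" "\<And>j. j \<in> {r..J} \<Longrightarrow> H j \<le> H k"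
      using interval_argmax[of r J H] rJ by auto
    have Hk: "H r < H k" using False k by (meson le_less_trans not_le)
    then have rk: "r < k" using k(1) by (cases "k = r") auto
    define S where "S = {c<..} - {s}"
    define d' where "d' = (\<lambda>v. if v \<in> S then max (d v) k else d v)"
    have "cut_cost d' \<le> cut_cost d" unfolding d'_def
    proof (rule card_raise_le[where V = "{..<n}"])
      fix q assume q: "q \<in> S" "d q < k"
      define A where "A = {u. u \<le> c \<and> E u q \<and> \<not> far (d u) (d q) \<and> far (d u) k}"
      define B where "B = {w. w \<in> S \<and> E q w \<and> d q + 2 \<le> d w \<and> d w \<le> k + 1}"
      have finA: "finite A" by (rule finite_subset[of _ "{..<n}"]) (auto simp: A_def dest: E_less)
      \<comment> \<open>Apart from the left side the only unmoved vertex is \<open>s\<close>, and it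
        can become far from \<open>q\<close> only if \<open>q\<close> has label at most 1.\<close>
      have U: "{u. u \<notin> S \<and> E u q \<and> \<not> far (d u) (d q) \<and> far (d u) k}
          \<subseteq> A \<union> (if E s q \<and> d q \<le> 1 then {s} else {})"
        using lab by (auto simp: A_def S_def far_def labelling_def)
      have card_U: "card {u. u \<notin> S \<and> E u q \<and> \<not> far (d u) (d q) \<and> far (d u) k}
          \<le> card A + (if E s q \<and> d q \<le> 1 then 1 else 0)"
      proof -
        have "card {u. u \<notin> S \<and> E u q \<and> \<not> far (d u) (d q) \<and> far (d u) k}
           \<le> card (A \<union> (if E s q \<and> d q \<le> 1 then {s} else {}))"
          using finA by (intro card_mono U) auto
        also have "\<dots> \<le> card A + card (if E s q \<and> d q \<le> 1 then {s} else {})" by (rule card_Un_le)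
        finally show ?thesis by (auto split: if_splits)
      qed
      have "card {u. u \<notin> S \<and> E u q \<and> \<not> far (d u) (d q) \<and> far (d u) k} \<le> card B"
      proof (cases "q < n")
        case qn: True
        have qs: "q < s" using far_right[of q] q k(1) qn by (cases q s rule: linorder_cases) (auto simp: S_def)
        have rq: "r \<le> d q" using r_le[of q] q qs by (auto simp: S_def)
        show ?thesis
        proof (cases "\<exists>u\<le>c. E u q")
          case True
          then obtain u where u: "u \<le> c" "E u q" by blast
          then have "int (card A) + H k - H (d q) \<le> int (card B)"
            using raise_bound[of c q "{s}" d k u] q by (simp add: A_def B_def H_def S_def conj_assoc)
          moreover have "H (d q) \<le> H k" using q k(1) rq by (intro k(2)) auto
          \<comment> \<open>So the extra edge to \<open>s\<close> arises only at label
            \<open>r\<close>, where \<open>H r < H k\<close> supplies the missing unit.\<close>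
          moreover have "d q = r" if "d q \<le> 1" using that rq r1 by simp
          ultimately show ?thesis using card_U Hk by (auto split: if_splits)
        next
          case F: False
          have "\<not> (E s q \<and> d q \<le> 1)"
          proof
            assume a: "E s q \<and> d q \<le> 1"
            then have dq: "d q = r" using rq r1 by simp
            have "d w = r" if w: "w \<in> right_end {s} c" for w
            proof -
              obtain u where u: "u \<le> c" "E u w" "c < w" using w by (auto simp: right_end_def)
              have "w < q"
              proof (rule ccontr)
                assume "\<not> w < q"
                then have "w = q \<or> (u < q \<and> q < w)" using u q by (auto simp: S_def)
                then have "E u q" using u umb by blast
                then show False using F u by blast
              qed
              then show ?thesis using sorted[of w q] r_le[of w] u qs dq by force
            qed
            then show False using False by blast
          qed
          moreover have "A = {}" using F by (auto simp: A_def)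
          ultimately show ?thesis using card_U by (auto split: if_splits)
        qed
      next
        case False
        then have "{u. u \<notin> S \<and> E u q \<and> \<not> far (d u) (d q) \<and> far (d u) k} = {}" using E_less by auto
        then show ?thesis by (simp only: card.empty le0)
      qed
      then show "card {u. u \<notin> S \<and> E u q \<and> \<not> far (d u) (d q) \<and> far (d u) k}
          \<le> card {w. w \<in> S \<and> E q w \<and> d q + 2 \<le> d w \<and> d w \<le> k + 1}" by (simp add: B_def)
    qed (use E_less E_sym in auto)
    moreover have "labelling s t L d'"
      using lab k(1) r1 cz st JL unfolding labelling_def d'_def S_def by auto
    moreover have "disorder s t d' < disorder s t d"
    proof (rule disorder_less[OF xy])
      show "d' x - d' y < d x - d y" using x y rk by (auto simp: d'_def S_def)
    qed (auto simp: d'_def S_def max_def)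
    ultimately show ?thesis by blast
  qed
qed

text \<open>Reversing both positions and labels swaps the roles of \<open>s\<close> and
  \<open>t\<close> and preserves far edges and disorder; thus the step right of \<open>t\<close>
  follows from the one left of \<open>s\<close>.\<close>

definition mirror :: "nat \<Rightarrow> nat \<Rightarrow> bool" where
  "mirror u v \<longleftrightarrow> u < n \<and> v < n \<and> E (n - 1 - u) (n - 1 - v)"

definition mirror_label :: "int \<Rightarrow> (nat \<Rightarrow> int) \<Rightarrow> nat \<Rightarrow> int" where
  "mirror_label L d v = L + 1 - d (n - 1 - v)"

lemma umbrella_mirror: "umbrella n mirror"
proof
  fix u v w assume a: "u < v" "v < w" "mirror u w"
  then have "n - 1 - w < n - 1 - v" "n - 1 - v < n - 1 - u" "E (n - 1 - w) (n - 1 - u)"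
    by (auto simp: mirror_def intro: E_sym)
  then show "mirror u v \<and> mirror v w" using a umb by (auto simp: mirror_def intro: E_sym)
qed (use E_sym E_irrefl in \<open>auto simp: mirror_def\<close>)

lemma cut_cost_mirror: "card (far_edges mirror (mirror_label L d)) = cut_cost d"
proof (rule bij_betw_same_card)
  show "bij_betw (\<lambda>(u, v). (n - 1 - v, n - 1 - u)) (far_edges mirror (mirror_label L d)) (far_edges E d)"
    by (rule bij_betw_byWitness[where f' = "\<lambda>(u, v). (n - 1 - v, n - 1 - u)"])
      (use E_less E_sym in \<open>force simp: far_edges_def mirror_def mirror_label_def far_def\<close>)+
qed

lemma mirror_label_invol: "v < n \<Longrightarrow> mirror_label L (mirror_label L d) v = d v"
  by (simp add: mirror_label_def)

lemma labelling_mirror: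
  assumes "labelling s t L d" "s < n" "t < n"
  shows "labelling (n - 1 - t) (n - 1 - s) L (mirror_label L d)"
proof -
  have "1 \<le> d (n - Suc v) \<and> d (n - Suc v) \<le> L" if "v < n" "v \<noteq> n - Suc t" "v \<noteq> n - Suc s" for v
  proof -
    have "n - Suc v \<noteq> s" "n - Suc v \<noteq> t" using that assms by auto
    then show ?thesis using assms that by (auto simp: labelling_def)
  qed
  then show ?thesis using assms by (auto simp: labelling_def mirror_label_def)
qed

lemma disorder_mirror:
  assumes "s < n" "t < n"
  shows "disorder (n - 1 - t) (n - 1 - s) (mirror_label L d) = disorder s t d"
  unfolding disorder_def mirror_label_def
  by (rule sum.reindex_bij_witness[where i = "\<lambda>(u, v). (n - 1 - v, n - 1 - u)" and j = "\<lambda>(u, v). (n - 1 - v, n - 1 - u)"])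
    (use assms in auto)

lemma inversion_mirror:
  assumes "s < n" "t < n" "inversion s t d u v"
  shows "inversion (n - 1 - t) (n - 1 - s) (mirror_label L d) (n - 1 - v) (n - 1 - u)"
  using assms by (auto simp: inversion_def mirror_label_def)

lemma straighten_right:
  assumes lab: "labelling s t L d" and st: "s < t" "t < n"
    and mid: "\<And>u v. inversion s t d u v \<Longrightarrow> v < s \<or> t < u"
    and inv: "inversion s t d p0 z0" "t < p0"
  shows "\<exists>d'. labelling s t L d' \<and> cut_cost d' \<le> cut_cost d \<and> disorder s t d' < disorder s t d"
proof -
  interpret M: umbrella n mirror by (rule umbrella_mirror)
  let ?s = "n - 1 - t" and ?t = "n - 1 - s"
  have sn: "s < n" using st by simp
  have "\<exists>d'. M.labelling ?s ?t L d' \<and> M.cut_cost d' \<le> M.cut_cost (mirror_label L d) \<and> M.disorder ?s ?t d' < M.disorder ?s ?t (mirror_label L d)"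
  proof (rule M.straighten_left)
    show "labelling ?s ?t L (mirror_label L d)" using labelling_mirror[OF lab sn st(2)] .
    show "inversion ?s ?t (mirror_label L d) (n - 1 - z0) (n - 1 - p0)" using inversion_mirror[OF sn st(2) inv(1)] .
    show "n - 1 - p0 < ?s" using inv st by (auto simp: inversion_def)
    fix u v assume a: "inversion ?s ?t (mirror_label L d) u v"
    have uv: "u < n" "v < n" using a by (auto simp: inversion_def)
    have "inversion s t d (n - 1 - v) (n - 1 - u)"
      using a sn st by (auto simp: inversion_def mirror_label_def)
    then have "n - 1 - u < s \<or> t < n - 1 - v" by (rule mid)
    then show "v < ?s \<or> ?t < u" using uv sn st by auto
  qed (use st in auto)
  then obtain d' where d': "labelling ?s ?t L d'" "M.cut_cost d' \<le> M.cut_cost (mirror_label L d)"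
    "disorder ?s ?t d' < disorder ?s ?t (mirror_label L d)" by blast
  have back_eq: "n - 1 - ?s = t" "n - 1 - ?t = s" using st by auto
  define e where "e = mirror_label L d'"
  have e': "mirror_label L e v = d' v" if "v < n" for v using that by (simp add: e_def mirror_label_invol)
  have "?s < n" "?t < n" using st by auto
  from M.labelling_mirror[OF d'(1) this] have "labelling s t L e" by (simp only: back_eq e_def)
  moreover have "cut_cost e \<le> cut_cost d"
  proof -
    have "far_edges mirror (mirror_label L e) = far_edges mirror d'"
      using e' by (auto simp: far_edges_def mirror_def)
    then show ?thesis using d'(2) cut_cost_mirror[of L d] cut_cost_mirror[of L e] by simp
  qed
  moreover have "disorder s t e < disorder s t d"
  proof -
    have "disorder ?s ?t (mirror_label L e) = disorder ?s ?t d'"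
      unfolding disorder_def by (rule sum.cong) (use e' in auto)
    then show ?thesis using d'(3) disorder_mirror[OF sn st(2), of L d] disorder_mirror[OF sn st(2), of L e] by simp
  qed
  ultimately show ?thesis by blast
qed

text \<open>Induction on \<open>disorder\<close>. Inversions reaching between \<open>s\<close> and
  \<open>t\<close> are removed first, because the two outer steps assume that every inversion lies
  entirely left of \<open>s\<close> or entirely right of \<open>t\<close>.\<close>

theorem monotone_labelling:
  assumes "labelling s t L d" "s < t" "t < n"
  shows "\<exists>d'. labelling s t L d' \<and> cut_cost d' \<le> cut_cost d \<and> (\<forall>u v. \<not> inversion s t d' u v)"
  using assms(1)
proof (induction "disorder s t d" arbitrary: d rule: less_induct)
  case less
  show ?case
  proof (cases "\<exists>u v. inversion s t d u v")
    case True
    have "\<exists>d'. labelling s t L d' \<and> cut_cost d' \<le> cut_cost d \<and> disorder s t d' < disorder s t d"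
    proof (cases "\<exists>u v. inversion s t d u v \<and> \<not> (v < s \<or> t < u)")
      case True
      then obtain u v where uv: "inversion s t d u v" "\<not> (v < s \<or> t < u)" by blast
      \<comment> \<open>The split after \<open>max u s\<close> separates \<open>u\<close> from
        \<open>v\<close> and also \<open>s\<close> from \<open>t\<close>.\<close>
      show ?thesis by (rule straighten_middle[OF less.prems, of "max u s" u v]) (use uv assms in \<open>auto simp: inversion_def\<close>)
    next
      case False
      then show ?thesis using True straighten_left[OF less.prems assms(2,3)] straighten_right[OF less.prems assms(2,3)] by metis
    qed
    then show ?thesis using less.hyps by (meson le_trans)
  next
    case False
    then show ?thesis using less.prems by blast
  qed
qed

end

section \<open>Cuts and labellings\<close>

definition far_edge_set :: "'a set set \<Rightarrow> ('a \<Rightarrow> int) \<Rightarrow> 'a set set" where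
  "far_edge_set E d = {e \<in> E. \<exists>u v. e = {u, v} \<and> far (d u) (d v)}"

definition st_labelling :: "'a set \<Rightarrow> 'a \<Rightarrow> 'a \<Rightarrow> int \<Rightarrow> ('a \<Rightarrow> int) \<Rightarrow> bool" where
  "st_labelling V s t L d \<longleftrightarrow> d s = 0 \<and> d t = L + 1 \<and> (\<forall>v\<in>V. v \<noteq> s \<longrightarrow> v \<noteq> t \<longrightarrow> 1 \<le> d v \<and> d v \<le> L)"

lemma doubleton_far: "far (d u) (d v) \<Longrightarrow> {u, v} \<in> E \<Longrightarrow> {u, v} \<in> far_edge_set E d"
  by (auto simp: far_edge_set_def)

lemma path_label_growth:
  assumes p: "is_path V (E - far_edge_set E d) s t p" and i: "i < length p"
  shows "d (p ! i) \<le> d s + int i"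
  using i
proof (induction i)
  case 0
  then show ?case using p by (simp add: is_path_def hd_conv_nth)
next
  case (Suc i)
  have "{p ! i, p ! Suc i} \<in> E - far_edge_set E d" using p Suc.prems unfolding is_path_def by blast
  then have "\<not> far (d (p ! i)) (d (p ! Suc i))" by (meson DiffE doubleton_far)
  then show ?case using Suc by (simp add: far_def)
qed

text \<open>A path repeats no vertex and hence no edge. This is what allows the length bound to be
  capped by the number of edges.\<close>

lemma path_length_le_card:
  assumes "finite E" "is_path V E s t p"
  shows "path_length p \<le> card E"
proof -
  define g where "g i = {p ! i, p ! Suc i}" for i
  have dist: "distinct p" and edge: "\<And>i. Suc i < length p \<Longrightarrow> g i \<in> E"
    using assms(2) by (auto simp: is_path_def g_def)
  have "inj_on g {..<length p - 1}"
  proof (rule inj_onI)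
    fix i j assume ij: "i \<in> {..<length p - 1}" "j \<in> {..<length p - 1}" "g i = g j"
    then have "(p ! i = p ! j \<and> p ! Suc i = p ! Suc j) \<or> (p ! i = p ! Suc j \<and> p ! Suc i = p ! j)"
      by (auto simp: g_def doubleton_eq_iff)
    moreover have "p ! a = p ! b \<longleftrightarrow> a = b" if "a \<le> length p - 1" "b \<le> length p - 1" for a b
      using nth_eq_iff_index_eq[OF dist, of a b] that ij(1) by simp
    ultimately show "i = j" using ij(1,2) by (elim disjE conjE) simp_all
  qed
  moreover have "g ` {..<length p - 1} \<subseteq> E" using edge by auto
  ultimately have "card {..<length p - 1} \<le> card E"
    using assms(1) by (metis card_image card_mono)
  then show ?thesis by (simp add: path_length_def)
qed

text \<open>Paths are simple, so if \<open>v\<close> already occurs, the prefix ending at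
  \<open>v\<close> replaces the extension.\<close>

lemma path_extend:
  assumes p: "is_path V E s u p" and e: "{u, v} \<in> E" "v \<in> V"
  shows "\<exists>q. is_path V E s v q \<and> path_length q \<le> path_length p + 1"
proof (cases "v \<in> set p")
  case True
  then obtain i where i: "i < length p" "p ! i = v" by (auto simp: in_set_conv_nth)
  have "is_path V E s v (take (Suc i) p)"
  proof -
    have "last (take (Suc i) p) = v" using i by (simp add: take_Suc_conv_app_nth)
    moreover have "hd (take (Suc i) p) = s" "take (Suc i) p \<noteq> []" using p i by (auto simp: is_path_def)
    ultimately show ?thesis using p set_take_subset[of "Suc i" p] by (auto simp: is_path_def)
  qed
  moreover have "path_length (take (Suc i) p) \<le> path_length p + 1" by (auto simp: path_length_def)
  ultimately show ?thesis by blast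
next
  case False
  have ne: "p \<noteq> []" and last: "last p = u" using p by (auto simp: is_path_def)
  have "is_path V E s v (p @ [v])"
    unfolding is_path_def
  proof (intro conjI allI impI)
    fix i assume i: "Suc i < length (p @ [v])"
    show "{(p @ [v]) ! i, (p @ [v]) ! Suc i} \<in> E"
    proof (cases "Suc i < length p")
      case True
      then show ?thesis using p by (auto simp: is_path_def nth_append)
    next
      case F: False
      then have "Suc i = length p" using i by simp
      then have "(p @ [v]) ! i = u" "(p @ [v]) ! Suc i = v"
        using last ne by (simp_all add: nth_append last_conv_nth flip: \<open>Suc i = length p\<close>)
      then show ?thesis using e by simp
    qed
  qed (use p e False ne in \<open>auto simp: is_path_def\<close>)
  then show ?thesis using ne by (intro exI[of _ "p @ [v]"]) (auto simp: path_length_def)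
qed

text \<open>The labels are distances from \<open>s\<close> after removing \<open>F\<close>,
  truncated at \<open>L\<close>, with \<open>t\<close> lifted to \<open>L + 1\<close>; a surviving
  edge changes such a distance by at most 1.\<close>

lemma cut_imp_labelling:
  assumes G: "simple_graph V E" and st: "s \<in> V" "t \<in> V" "s \<noteq> t" and L: "1 \<le> L"
    and F: "\<not> (\<exists>p. is_path V (E - F) s t p \<and> path_length p \<le> L)"
  shows "\<exists>d. st_labelling V s t (int L) d \<and> far_edge_set E d \<subseteq> F"
proof -
  define rch where "rch k v \<longleftrightarrow> (\<exists>p. is_path V (E - F) s v p \<and> path_length p \<le> k)" for k v
  define e where "e v = (LEAST k. k = L \<or> rch k v)" for v
  have e_prop: "e v = L \<or> rch (e v) v" and e_le: "k = L \<or> rch k v \<Longrightarrow> e v \<le> k" for v k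
    unfolding e_def by (rule LeastI[of _ L], simp) (rule Least_le)
  have eL: "e v \<le> L" for v by (rule e_le) simp
  have rch_Suc: "rch (Suc k) v" if rch_u: "rch k u" and uv: "{u, v} \<in> E - F" "v \<in> V" for k u v
  proof -
    obtain p where p: "is_path V (E - F) s u p" "path_length p \<le> k" using rch_u unfolding rch_def by blast
    from path_extend[OF p(1) uv] obtain q where "is_path V (E - F) s v q" "path_length q \<le> path_length p + 1"
      by (elim exE conjE)
    then show ?thesis using p(2) unfolding rch_def by (intro exI[of _ q]) simp
  qed
  have step: "e v \<le> Suc (e u)" if "{u, v} \<in> E - F" "v \<in> V" for u v
  proof (cases "e u = L")
    case True
    then show ?thesis using eL[of v] by simp
  next
    case False
    then have "rch (e u) u" using e_prop[of u] by simp
    from rch_Suc[OF this that] show ?thesis by (intro e_le disjI2)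
  qed
  have rch_s: "rch 0 s" unfolding rch_def
    by (rule exI[of _ "[s]"]) (use st in \<open>auto simp: is_path_def path_length_def\<close>)
  have e_s: "e s = 0" using e_le[of 0 s] rch_s by simp
  have not_rch: "\<not> rch 0 v" if "v \<noteq> s" for v
  proof
    assume "rch 0 v"
    then obtain p where "is_path V (E - F) s v p" "length p \<le> 1"
      by (auto simp: rch_def path_length_def)
    then show False using that by (cases p) (auto simp: is_path_def)
  qed
  have e_pos: "1 \<le> e v" if "v \<noteq> s" for v
    using e_prop[of v] not_rch[OF that] L by (cases "e v") auto
  have t: "\<not> rch k t" if "k \<le> L" for k using F that unfolding rch_def by (meson le_trans)
  have e_t: "e t = L" using e_prop[of t] eL[of t] t by blast
  \<comment> \<open>This makes the lift of \<open>t\<close> harmless: a neighbour along a surviving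
    edge has label \<open>L\<close>, as otherwise \<open>t\<close> would be reached within
    \<open>L\<close> steps.\<close>
  have near_t: "e u = L" if "{u, t} \<in> E - F" for u
  proof (rule ccontr)
    assume "e u \<noteq> L"
    then have "rch (e u) u" "e u < L" using e_prop[of u] eL[of u] by auto
    then show False using rch_Suc[OF _ that st(2)] t[of "Suc (e u)"] by auto
  qed
  define d where "d v = (if v = t then int L + 1 else int (e v))" for v
  have "st_labelling V s t (int L) d"
    using st e_s eL e_pos by (force simp: st_labelling_def d_def)
  moreover have "far_edge_set E d \<subseteq> F"
  proof
    fix x assume "x \<in> far_edge_set E d"
    then obtain u v where uv: "x = {u, v}" "x \<in> E" "far (d u) (d v)" by (auto simp: far_edge_set_def)
    have V: "u \<in> V" "v \<in> V" "u \<noteq> v" using G uv by (auto simp: simple_graph_def doubleton_eq_iff)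
    show "x \<in> F"
    proof (rule ccontr)
      assume "x \<notin> F"
      then have uv1: "{u, v} \<in> E - F" and uv2: "{v, u} \<in> E - F" using uv by (auto simp: insert_commute)
      consider "u = t" | "v = t" | "u \<noteq> t" "v \<noteq> t" by blast
      then have "\<bar>d u - d v\<bar> \<le> 1"
      proof cases
        case 1
        then show ?thesis using near_t[of v] uv2 V(3) by (simp add: d_def)
      next
        case 2
        then show ?thesis using near_t[of u] uv1 V(3) by (simp add: d_def)
      next
        case 3
        then show ?thesis using step[OF uv1 V(2)] step[OF uv2 V(1)] by (simp add: d_def)
      qed
      then show False using uv(3) by (simp add: far_def)
    qed
  qed
  ultimately show ?thesis by blast
qed

lemma simple_graph_finite: "simple_graph V E \<Longrightarrow> finite E"
  by (rule finite_subset[of _ "Pow V"]) (auto simp: simple_graph_def)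

text \<open>Along edges that are not far the label grows by at most 1, so an
  \<open>s\<close>-\<open>t\<close>-path has at least \<open>L + 1\<close> edges, whereas a short
  path has at most \<open>min l (card E) \<le> L\<close>.\<close>

lemma labelling_imp_cut:
  assumes G: "simple_graph V E"
    and L: "min l (card E) \<le> L"
    and d: "st_labelling V s t (int L) d"
  shows "\<not> (\<exists>p. is_path V (E - far_edge_set E d) s t p \<and> path_length p \<le> l)"
proof
  assume "\<exists>p. is_path V (E - far_edge_set E d) s t p \<and> path_length p \<le> l"
  then obtain p where p: "is_path V (E - far_edge_set E d) s t p" and le: "path_length p \<le> l" by (elim exE conjE)
  have "p \<noteq> []" "p ! (length p - 1) = t" using p by (auto simp: is_path_def last_conv_nth)
  then have "int L + 1 \<le> int (path_length p)"
    using path_label_growth[OF p, of "length p - 1"] d by (simp add: st_labelling_def path_length_def)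
  moreover have "path_length p \<le> card E"
    using path_length_le_card[OF _ p] simple_graph_finite[OF G] card_mono[OF _ Diff_subset[of E "far_edge_set E d"]]
    by (meson finite_Diff le_trans)
  ultimately show False using le L by linarith
qed

text \<open>Capping \<open>l\<close> by the number of edges bounds the number of levels; the outer
  \<open>max 1\<close> keeps the range \<open>{1..L}\<close> nonempty in a graph without
  edges.\<close>

theorem cut_iff_labelling:
  assumes G: "simple_graph V E" and st: "s \<in> V" "t \<in> V" "s \<noteq> t" and l: "0 < l"
    and L: "L = max 1 (min l (card E))"
  shows "length_bounded_cut V E s t \<beta> l \<longleftrightarrow> (\<exists>d. st_labelling V s t (int L) d \<and> card (far_edge_set E d) \<le> \<beta>)"
    (is "_ \<longleftrightarrow> ?R")
proof (rule iffI)
  have "L \<le> l" "1 \<le> L" using l L by auto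
  assume "length_bounded_cut V E s t \<beta> l"
  then obtain F where F: "F \<subseteq> E" "card F \<le> \<beta>" "\<not> (\<exists>p. is_path V (E - F) s t p \<and> path_length p \<le> l)"
    unfolding length_bounded_cut_def by (elim exE conjE) (rule that; assumption)
  have "\<not> (\<exists>p. is_path V (E - F) s t p \<and> path_length p \<le> L)"
    using F(3) \<open>L \<le> l\<close> by (meson le_trans)
  from cut_imp_labelling[OF G st \<open>1 \<le> L\<close> this]
  obtain d where d: "st_labelling V s t (int L) d" "far_edge_set E d \<subseteq> F" by (elim exE conjE)
  have "card (far_edge_set E d) \<le> card F"
    by (rule card_mono[OF finite_subset[OF F(1) simple_graph_finite[OF G]] d(2)])
  then show ?R using d(1) F(2) by (meson le_trans)
next
  assume ?R
  then obtain d where d: "st_labelling V s t (int L) d" "card (far_edge_set E d) \<le> \<beta>" by (elim exE conjE)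
  have "min l (card E) \<le> L" using L by simp
  from labelling_imp_cut[OF G this d(1)] d(2)
  show "length_bounded_cut V E s t \<beta> l" unfolding length_bounded_cut_def
    by (intro exI[of _ "far_edge_set E d"] conjI) (simp_all only: far_edge_set_def Collect_restrict not_False_eq_True)
qed

lemma no_cut_same:
  assumes "s \<in> V"
  shows "\<not> length_bounded_cut V E s s \<beta> l"
proof -
  have "is_path V E' s s [s] \<and> path_length [s] \<le> l" for E' using assms by (simp add: is_path_def path_length_def)
  then show ?thesis unfolding length_bounded_cut_def by blast
qed

section \<open>Umbrella orderings from breadth-first search\<close>

locale sgraph =
  fixes n :: nat and A :: "nat \<Rightarrow> nat \<Rightarrow> bool"
  assumes A_less: "A u v \<Longrightarrow> u < n \<and> v < n"
    and A_sym: "A u v \<Longrightarrow> A v u"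
    and A_irrefl: "\<not> A u u"
begin

lemma A_comm: "A u v \<longleftrightarrow> A v u"
  by (rule iffI; erule A_sym)

section \<open>Reachability in rounds and breadth-first distances\<close>

fun reach :: "nat \<Rightarrow> nat \<Rightarrow> nat \<Rightarrow> bool" where
  "reach z 0 v \<longleftrightarrow> v = z"
| "reach z (Suc k) v \<longleftrightarrow> reach z k v \<or> (\<exists>u. A u v \<and> reach z k u)"

definition comp :: "nat \<Rightarrow> nat set" where
  "comp z = {v. A\<^sup>*\<^sup>* z v}"

text \<open>Counting the rounds that miss \<open>v\<close> is a sum a table stage can compute. The
  value is the usual distance within the component and \<open>n\<close> outside it.\<close>

definition dist :: "nat \<Rightarrow> nat \<Rightarrow> nat" where
  "dist z v = card {k. k < n \<and> \<not> reach z k v}"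

lemma reach_mono: "i \<le> j \<Longrightarrow> reach z i v \<Longrightarrow> reach z j v"
  by (induction j rule: dec_induct) auto

lemma reach_imp_comp: "reach z k v \<Longrightarrow> v \<in> comp z"
  by (induction k arbitrary: v) (auto simp: comp_def intro: rtranclp.rtrancl_into_rtrancl)

lemma comp_imp_reach_ex: "v \<in> comp z \<Longrightarrow> \<exists>k. reach z k v"
proof -
  assume "v \<in> comp z"
  then have "A\<^sup>*\<^sup>* z v" by (simp add: comp_def)
  then show ?thesis
  proof induction
    case base
    have "reach z 0 z" by simp
    then show ?case by blast
  next
    case (step x y)
    then obtain k where "reach z k x" by blast
    then have "reach z (Suc k) y" using step by auto
    then show ?case by blast
  qed
qed

lemma comp_less: "z < n \<Longrightarrow> v \<in> comp z \<Longrightarrow> v < n"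
  unfolding comp_def mem_Collect_eq by (erule rtranclp.cases) (auto dest: A_less)

lemma comp_self [simp]: "z \<in> comp z" by (simp add: comp_def)

lemma comp_step: "u \<in> comp z \<Longrightarrow> A u v \<Longrightarrow> v \<in> comp z"
  by (auto simp: comp_def intro: rtranclp.rtrancl_into_rtrancl)

lemma comp_eq: "z \<in> comp s \<Longrightarrow> comp z = comp s"
proof -
  assume z: "z \<in> comp s"
  have "symp A" using A_sym by (rule sympI)
  then have "A\<^sup>*\<^sup>* z s" using z by (simp add: comp_def) (meson symp_rtranclp sympD)
  then show ?thesis using z by (auto simp: comp_def intro: rtranclp_trans)
qed

lemma reach_stable:
  assumes "\<And>v. reach z (Suc k) v \<Longrightarrow> reach z k v"
  shows "reach z (k + j) v \<Longrightarrow> reach z k v"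
proof (induction j arbitrary: v)
  case (Suc j)
  then have "reach z (k + j) v \<or> (\<exists>u. A u v \<and> reach z (k + j) u)" by simp
  then have "reach z (Suc k) v" using Suc.IH by auto
  then show ?case by (rule assms)
qed simp

text \<open>While every round adds a vertex, round \<open>k\<close> has reached more than
  \<open>k\<close> vertices; so the reached set is stable before round \<open>n\<close>.\<close>

lemma reach_bound:
  assumes "z < n" "reach z k v"
  shows "reach z (n - 1) v"
proof -
  define S where "S k = {v. reach z k v}" for k
  have S_sub: "S k \<subseteq> {..<n}" for k using reach_imp_comp comp_less[OF assms(1)] by (auto simp: S_def)
  have S_fin: "finite (S k)" for k using S_sub finite_subset by blast
  have S_mono: "S k \<subseteq> S (Suc k)" for k by (auto simp: S_def)
  have "\<exists>k<n. S (Suc k) = S k"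
  proof (rule ccontr)
    assume neg: "\<not> ?thesis"
    have "k < card (S k)" if "k \<le> n" for k using that
    proof (induction k)
      case 0
      then show ?case by (simp add: S_def)
    next
      case (Suc k)
      have "S (Suc k) \<noteq> S k" using neg Suc.prems by (meson Suc_le_lessD)
      then have "S k \<subset> S (Suc k)" using S_mono[of k] by blast
      then have "card (S k) < card (S (Suc k))" by (rule psubset_card_mono[OF S_fin])
      then show ?case using Suc.IH Suc.prems by simp
    qed
    moreover have "card (S n) \<le> n" using card_mono[OF _ S_sub[of n]] by simp
    ultimately show False by fastforce
  qed
  then obtain i where i: "i < n" "S (Suc i) = S i" by blast
  have stable: "reach z (i + j) v \<Longrightarrow> reach z i v" for j
    by (rule reach_stable) (use i in \<open>auto simp: S_def\<close>)
  have "reach z i v"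
    using assms(2) reach_mono[of k i] stable[of "k - i"] by (cases "k \<le> i") auto
  then show ?thesis using i reach_mono[of i "n - 1"] by simp
qed

lemma comp_iff_reach: "z < n \<Longrightarrow> v \<in> comp z \<longleftrightarrow> reach z (n - 1) v"
  using reach_bound reach_imp_comp comp_imp_reach_ex by blast

lemma dist_le_iff:
  assumes "k < n"
  shows "dist z v \<le> k \<longleftrightarrow> reach z k v"
proof (cases "reach z k v")
  case True
  have "i < k" if "\<not> reach z i v" for i using that True reach_mono[of k i] by (cases "i < k") auto
  then have "dist z v \<le> card {..<k}" unfolding dist_def by (intro card_mono) auto
  then show ?thesis using True by simp
next
  case False
  have "{..k} \<subseteq> {k. k < n \<and> \<not> reach z k v}" using False assms reach_mono[of _ k] by auto
  then have "card {..k} \<le> dist z v" unfolding dist_def by (intro card_mono) auto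
  then show ?thesis using False by simp
qed

lemma comp_iff_dist: "z < n \<Longrightarrow> v \<in> comp z \<longleftrightarrow> dist z v < n"
  using comp_iff_reach[of z v] dist_le_iff[of "n - 1" z v] by auto

lemma dist_self: "z < n \<Longrightarrow> dist z v = 0 \<longleftrightarrow> v = z"
  using dist_le_iff[of 0 z v] by auto

lemma dist_edge:
  assumes "z < n" "u \<in> comp z" "A u v"
  shows "dist z v \<le> dist z u + 1"
proof (cases "dist z u + 1 < n")
  case True
  then show ?thesis using assms dist_le_iff[of "dist z u" z u] dist_le_iff[of "dist z u + 1" z v] by auto
next
  case False
  then show ?thesis using comp_iff_dist[OF assms(1)] comp_step[OF assms(2,3)] by force
qed

lemma dist_parent:
  assumes "z < n" "v \<in> comp z" "v \<noteq> z"
  shows "\<exists>x. A x v \<and> x \<in> comp z \<and> dist z x + 1 = dist z v"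
proof -
  have d: "dist z v < n" "0 < dist z v" using assms comp_iff_dist dist_self by (auto simp: gr0_conv_Suc[symmetric])
  then obtain k where k: "dist z v = Suc k" by (cases "dist z v") auto
  have "reach z (Suc k) v" "\<not> reach z k v"
    using dist_le_iff[of "Suc k" z v] dist_le_iff[of k z v] d k by auto
  then obtain x where x: "A x v" "reach z k x" by auto
  then have "x \<in> comp z" using reach_imp_comp by blast
  moreover have "dist z x \<le> k" using dist_le_iff[of k z x] d k x by simp
  moreover have "dist z v \<le> dist z x + 1" using dist_edge[OF assms(1) calculation(1) x(1)] .
  ultimately show ?thesis using x k by (intro exI[of _ x]) auto
qed

text \<open>Real keys instead of a permutation: left interval endpoints are such keys, reversal is
  negation, and exchanging two vertices is composition with a transposition.\<close>

definition umb_key :: "(nat \<Rightarrow> real) \<Rightarrow> bool" where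
  "umb_key b \<longleftrightarrow> inj_on b {..<n} \<and>
    (\<forall>u v w. v < n \<longrightarrow> b u < b v \<longrightarrow> b v < b w \<longrightarrow> A u w \<longrightarrow> A u v \<and> A v w)"

lemma umb_keyD: "umb_key b \<Longrightarrow> v < n \<Longrightarrow> b u < b v \<Longrightarrow> b v < b w \<Longrightarrow> A u w \<Longrightarrow> A u v \<and> A v w"
  by (auto simp: umb_key_def)

lemma umb_key_total: "umb_key b \<Longrightarrow> u < n \<Longrightarrow> v < n \<Longrightarrow> b u < b v \<or> u = v \<or> b v < b u"
  unfolding umb_key_def inj_on_def by (metis lessThan_iff linorder_less_linear)

lemma umb_key_uminus: "umb_key b \<Longrightarrow> umb_key (\<lambda>v. - b v)"
proof -
  assume b: "umb_key b"
  have "inj_on (\<lambda>v. - b v) {..<n}" using b unfolding umb_key_def inj_on_def by simp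
  moreover have "A u v \<and> A v w" if "v < n" "- b u < - b v" "- b v < - b w" "A u w" for u v w
    using umb_keyD[OF b that(1), of w u] that(2-4) A_comm by simp
  ultimately show ?thesis unfolding umb_key_def by blast
qed

definition twins :: "nat \<Rightarrow> nat \<Rightarrow> bool" where
  "twins u v \<longleftrightarrow> A u v \<and> (\<forall>w. w \<noteq> u \<longrightarrow> w \<noteq> v \<longrightarrow> A w u = A w v)"

text \<open>Exchanging twins is an automorphism of the graph.\<close>

lemma umb_key_transpose:
  assumes b: "umb_key b" and tw: "twins x y"
  shows "umb_key (b \<circ> transpose x y)"
proof -
  let ?p = "transpose x y"
  have "A x y" using tw by (simp add: twins_def)
  note xy = A_less[OF this, THEN conjunct1] A_less[OF this, THEN conjunct2] this A_sym[OF this]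
  have tw1: "A w x = A w y" if "w \<noteq> x" "w \<noteq> y" for w using tw that by (simp add: twins_def)
  have tw2: "A x w = A y w" if "w \<noteq> x" "w \<noteq> y" for w
    using tw1[OF that] by (simp only: A_comm[of x w] A_comm[of y w])
  have p: "?p x = y" "?p y = x" "w \<noteq> x \<Longrightarrow> w \<noteq> y \<Longrightarrow> ?p w = w" for w by simp_all
  have aut: "A (?p u) (?p v) \<longleftrightarrow> A u v" for u v
  proof -
    consider "u = x \<or> u = y" "v = x \<or> v = y" | "u = x \<or> u = y" "v \<noteq> x" "v \<noteq> y"
      | "u \<noteq> x" "u \<noteq> y" "v = x \<or> v = y" | "u \<noteq> x" "u \<noteq> y" "v \<noteq> x" "v \<noteq> y" by blast
    then show ?thesis
    proof cases
      case 1
      then show ?thesis using xy(3,4) A_irrefl[of x] A_irrefl[of y] by (elim disjE) (simp_all only: p not_False_eq_True)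
    next
      case 2
      then show ?thesis using tw2[OF 2(2,3)] by (elim disjE) (simp_all only: p not_False_eq_True)
    next
      case 3
      then show ?thesis using tw1[OF 3(1,2)] by (elim disjE) (simp_all only: p not_False_eq_True)
    next
      case 4
      then show ?thesis by (simp only: p not_False_eq_True)
    qed
  qed
  have lt: "?p v < n" if "v < n" for v using that xy by (simp add: transpose_def)
  have "inj_on (b \<circ> ?p) {..<n}"
  proof (rule comp_inj_on)
    show "inj_on ?p {..<n}" by (rule inj_on_subset[OF inj_transpose subset_UNIV])
    have "?p ` {..<n} \<subseteq> {..<n}" using lt by auto
    moreover have "inj_on b {..<n}" using b by (simp add: umb_key_def)
    ultimately show "inj_on b (?p ` {..<n})" by (rule inj_on_subset[rotated])
  qed
  moreover have "A u v \<and> A v w" if "v < n" "(b \<circ> ?p) u < (b \<circ> ?p) v" "(b \<circ> ?p) v < (b \<circ> ?p) w" "A u w" for u v w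
    using umb_keyD[OF b lt[OF that(1)], of "?p u" "?p w"] that(2-4) by (simp add: aut)
  ultimately show ?thesis unfolding umb_key_def by blast
qed

text \<open>The last edge into \<open>v\<close> starts at \<open>u\<close>, starts beyond
  \<open>u\<close> (then the induction hypothesis applies to its start), or spans \<open>u\<close>
  and so yields an edge into \<open>u\<close>.\<close>

lemma reach_key:
  assumes b: "umb_key b"
  shows "reach z k v \<Longrightarrow> b z \<le> b u \<Longrightarrow> b u < b v \<Longrightarrow> u < n \<Longrightarrow> reach z k u"
proof (induction k arbitrary: v)
  case (Suc k)
  show ?case
  proof (cases "reach z k v")
    case False
    then obtain x where x: "A x v" "reach z k x" using Suc.prems by auto
    have xn: "x < n" using A_less x by blast
    consider "b x < b u" | "x = u" | "b u < b x" using umb_key_total[OF b xn Suc.prems(4)] by blast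
    then show ?thesis
    proof cases
      case 1
      then have "A x u" using umb_keyD[OF b Suc.prems(4)] Suc.prems(3) x by blast
      then show ?thesis using x by auto
    qed (use x Suc in auto)
  qed (use Suc in auto)
qed simp

lemma dist_key:
  assumes "umb_key b" "b z \<le> b u" "b u < b v" "u < n"
  shows "dist z u \<le> dist z v"
  unfolding dist_def by (rule card_mono) (use reach_key[OF assms(1) _ assms(2-4)] in auto)

section \<open>A farthest vertex of least degree as an end of the ordering\<close>

definition degree :: "nat \<Rightarrow> nat" where
  "degree v = card {w. A w v}"

lemma finite_nbrs: "finite {w. A w v}"
  by (rule finite_subset[of _ "{..<n}"]) (auto dest: A_less)

text \<open>The search parent of the true end \<open>r\<close> is on an earlier level and hence left
  of \<open>z\<close>, so \<open>z\<close> is adjacent to \<open>r\<close>; every other neighbour of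
  \<open>r\<close> is then a neighbour of \<open>z\<close>. The least degree of \<open>z\<close>
  turns this inclusion into equality.\<close>

lemma right_extreme_twin:
  assumes b: "umb_key b" and s: "s < n" and z: "z \<in> comp s" "b s < b z"
    and max: "\<And>u. u \<in> comp s \<Longrightarrow> dist s u < dist s z \<or> (dist s u = dist s z \<and> degree z \<le> degree u)"
    and r: "r \<in> comp s" "\<And>u. u \<in> comp s \<Longrightarrow> b u \<le> b r" "r \<noteq> z"
  shows "twins z r"
proof -
  have n: "z < n" "r < n" using comp_less[OF s] z r by auto
  have zr: "b z < b r" using r(2)[OF z(1)] umb_key_total[OF b n] r(3) by auto
  have dr: "dist s r = dist s z" using dist_key[OF b _ zr n(1), of s] z max[OF r(1)] by simp
  have rs: "r \<noteq> s" using zr z by auto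
  obtain x where x: "A x r" "x \<in> comp s" "dist s x + 1 = dist s r" using dist_parent[OF s r(1) rs] by blast
  have xn: "x < n" using A_less x by blast
  have xz: "b x < b z"
  proof (rule ccontr)
    assume "\<not> b x < b z"
    then have "x = z \<or> b z < b x" using umb_key_total[OF b xn n(1)] by auto
    then have "dist s z \<le> dist s x" using dist_key[OF b _ _ n(1), of s x] z by auto
    then show False using x dr by simp
  qed
  have zr_adj: "A z r" using umb_keyD[OF b n(1) xz zr x(1)] by simp
  have sub: "{w. A w r} - {z} \<subseteq> {w. A w z} - {r}"
  proof
    fix w assume w: "w \<in> {w. A w r} - {z}"
    have wn: "w < n" using w A_less by auto
    have wc: "w \<in> comp s" using comp_step[OF r(1)] w A_comm by auto
    have wr: "w \<noteq> r" using w A_irrefl by auto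
    have "b w < b r" using r(2)[OF wc] umb_key_total[OF b wn n(2)] wr by auto
    moreover have "b w < b z \<or> b z < b w" using umb_key_total[OF b wn n(1)] w by auto
    ultimately have "A w z"
      using umb_keyD[OF b n(1), of w r] umb_keyD[OF b wn, of z r] zr zr_adj w A_comm by blast
    then show "w \<in> {w. A w z} - {r}" using wr by auto
  qed
  have "degree z \<le> degree r" using max[OF r(1)] dr by simp
  then have "card ({w. A w z} - {r}) \<le> card ({w. A w r} - {z})"
    using zr_adj A_comm finite_nbrs by (simp add: degree_def card_Diff_singleton)
  then have "{w. A w r} - {z} = {w. A w z} - {r}"
    by (intro card_seteq sub) (use finite_nbrs in auto)
  then show ?thesis using zr_adj unfolding twins_def by blast
qed

text \<open>Reversal reduces to \<open>z\<close> right of \<open>s\<close>, where \<open>z\<close>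
  is exchanged with its twin at the end. If \<open>z = s\<close>, the component is a single
  vertex.\<close>

lemma extreme_end:
  assumes b: "umb_key b" and s: "s < n" and z: "z \<in> comp s"
    and max: "\<And>u. u \<in> comp s \<Longrightarrow> dist s u < dist s z \<or> (dist s u = dist s z \<and> degree z \<le> degree u)"
  shows "\<exists>b'. umb_key b' \<and> (\<forall>u\<in>comp s. b' z \<le> b' u)"
proof -
  have zn: "z < n" using comp_less[OF s z] .
  have right: "\<exists>b'. umb_key b' \<and> (\<forall>u\<in>comp s. b' z \<le> b' u)" if b: "umb_key b" and sz: "b s < b z" for b
  proof -
    have fin: "finite (comp s)" by (rule finite_subset[of _ "{..<n}"]) (use comp_less[OF s] in auto)
    have "Max (b ` comp s) \<in> b ` comp s" by (rule Max_in) (use fin z in auto)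
    then obtain r where r: "r \<in> comp s" "b r = Max (b ` comp s)" by auto
    have r_max: "b u \<le> b r" if "u \<in> comp s" for u using fin that r by simp
    show ?thesis
    proof (cases "r = z")
      case True
      then show ?thesis using umb_key_uminus[OF b] r_max by (intro exI[of _ "\<lambda>v. - b v"]) auto
    next
      case False
      have tw: "twins z r" by (rule right_extreme_twin[OF b s z sz max r(1) r_max False])
      let ?b = "\<lambda>v. - (b \<circ> transpose z r) v"
      have "umb_key ?b" by (intro umb_key_uminus umb_key_transpose b tw)
      moreover have "?b z \<le> ?b u" if "u \<in> comp s" for u
        using r_max[OF that] r_max[OF z] by (simp add: transpose_def)
      ultimately show ?thesis by blast
    qed
  qed
  consider "b s < b z" | "z = s" | "b z < b s" using umb_key_total[OF b s zn] by blast
  then show ?thesis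
  proof cases
    case 1
    then show ?thesis by (rule right[OF b])
  next
    case 2
    then have "dist s u = 0" if "u \<in> comp s" for u using max[OF that] dist_self[OF s, of s] by auto
    then have "u = s" if "u \<in> comp s" for u using that dist_self[OF s] by blast
    then show ?thesis using b 2 by auto
  next
    case 3
    then show ?thesis using right[OF umb_key_uminus[OF b]] by simp
  qed
qed

section \<open>Ordering a component by level and neighbour counts\<close>

definition nexts :: "nat \<Rightarrow> nat \<Rightarrow> nat" where
  "nexts z v = card {w. A w v \<and> dist z w = dist z v + 1}"

definition prevs :: "nat \<Rightarrow> nat \<Rightarrow> nat" where
  "prevs z v = card {w. A w v \<and> dist z w + 1 = dist z v}"

text \<open>The differences \<open>nexts - prevs\<close> are compared crosswise, because subtraction
  on naturals truncates. Comparing vertex numbers last makes the order strict and total.\<close>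

definition bef :: "nat \<Rightarrow> nat \<Rightarrow> nat \<Rightarrow> bool" where
  "bef z u v \<longleftrightarrow> dist z u < dist z v \<or> (dist z u = dist z v \<and>
     (nexts z u + prevs z v < nexts z v + prevs z u \<or>
      (nexts z u + prevs z v = nexts z v + prevs z u \<and> u < v)))"

text \<open>With \<open>z\<close> leftmost, the levels are consecutive blocks of the ordering and
  each is a clique. Moving right within a level can only gain next and lose previous neighbours, so
  a disagreement between \<open>bef\<close> and \<open>b\<close> forces both neighbour sets to
  coincide.\<close>

lemma bef_or_twins:
  assumes b: "umb_key b" and z: "z < n" and min: "\<And>u. u \<in> comp z \<Longrightarrow> b z \<le> b u"
    and uv: "u \<in> comp z" "v \<in> comp z" "bef z v u" "b u < b v"
  shows "twins u v"
proof -
  have n: "u < n" "v < n" using comp_less[OF z] uv by auto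
  have mono: "dist z x \<le> dist z y" if "x \<in> comp z" "b x < b y" for x y
    using dist_key[OF b min[OF that(1)] that(2)] comp_less[OF z that(1)] .
  have lt: "b x < b y" if "dist z x < dist z y" "x \<in> comp z" "y \<in> comp z" for x y
    using that mono[of y x] umb_key_total[OF b comp_less[OF z] comp_less[OF z], of x y] by auto
  have same: "dist z u = dist z v" using mono[OF uv(1,4)] uv(3) by (auto simp: bef_def)
  have clique: "A x y" if xy: "x \<in> comp z" "y \<in> comp z" "dist z x = dist z y" "b x < b y" for x y
  proof -
    have "y \<noteq> z" using min[OF xy(1)] xy(4) by auto
    then obtain p where p: "A p y" "p \<in> comp z" "dist z p + 1 = dist z y" using dist_parent[OF z xy(2)] by blast
    then have "b p < b x" using lt[of p x] xy by simp
    then show ?thesis using umb_keyD[OF b comp_less[OF z xy(1)] _ xy(4) p(1)] by simp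
  qed
  have clique': "A x y" if "x \<in> comp z" "y \<in> comp z" "dist z x = dist z y" "x \<noteq> y" for x y
    using clique[of x y] clique[of y x] that umb_key_total[OF b comp_less[OF z] comp_less[OF z], of x y] A_comm by auto
  have nbr: "w \<in> comp z" if "A w u \<or> A w v" for w using that comp_step[OF uv(1)] comp_step[OF uv(2)] A_comm by blast
  let ?N = "\<lambda>v. {w. A w v \<and> dist z w = dist z v + 1}" and ?P = "\<lambda>v. {w. A w v \<and> dist z w + 1 = dist z v}"
  have N: "?N u \<subseteq> ?N v"
  proof
    fix w assume w: "w \<in> ?N u"
    then have "b v < b w" using lt[OF _ uv(2) nbr] same by auto
    then show "w \<in> ?N v" using umb_keyD[OF b n(2) uv(4)] w A_comm same by auto
  qed
  have P: "?P v \<subseteq> ?P u"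
  proof
    fix w assume w: "w \<in> ?P v"
    then have "b w < b u" using lt[OF _ nbr uv(1)] same by auto
    then show "w \<in> ?P u" using umb_keyD[OF b n(1) _ uv(4)] w same by auto
  qed
  have fin: "finite (?N v)" "finite (?P u)" using finite_nbrs by auto
  have "nexts z v + prevs z u \<le> nexts z u + prevs z v" using uv(3) same by (auto simp: bef_def)
  moreover have "nexts z u \<le> nexts z v" "prevs z v \<le> prevs z u"
    unfolding nexts_def prevs_def using fin N P by (auto intro: card_mono)
  ultimately have "card (?N v) \<le> card (?N u)" "card (?P u) \<le> card (?P v)" by (auto simp: nexts_def prevs_def)
  then have eq: "?N u = ?N v" "?P v = ?P u" using card_seteq[OF fin(1) N] card_seteq[OF fin(2) P] by blast+
  have "A w u = A w v" if w: "w \<noteq> u" "w \<noteq> v" for w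
  proof (cases "w \<in> comp z")
    case True
    consider "dist z w = dist z u" | "dist z w = dist z u + 1" | "dist z w + 1 = dist z u"
      | "dist z w > dist z u + 1 \<or> dist z u > dist z w + 1" by linarith
    then show ?thesis
    proof cases
      case 1
      then show ?thesis using clique'[OF True uv(1)] clique'[OF True uv(2)] same w by simp
    next
      case 2
      then have "A w u \<longleftrightarrow> w \<in> ?N u" "A w v \<longleftrightarrow> w \<in> ?N v" using same by auto
      then show ?thesis using eq by blast
    next
      case 3
      then have "A w u \<longleftrightarrow> w \<in> ?P u" "A w v \<longleftrightarrow> w \<in> ?P v" using same by auto
      then show ?thesis using eq by blast
    next
      case 4
      then have "\<not> A w x" if "x \<in> comp z" "dist z x = dist z u" for x
        using dist_edge[OF z True, of x] dist_edge[OF z that(1), of w] that A_comm by fastforce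
      then show ?thesis using uv same by metis
    qed
  next
    case False
    then show ?thesis using nbr by blast
  qed
  then show ?thesis using clique[OF uv(1,2) same uv(4)] unfolding twins_def by blast
qed

text \<open>If both comparisons agree with \<open>b\<close>, its umbrella property applies.
  Otherwise one of them joins twins, and twinship transfers the edge \<open>A u w\<close>.\<close>

theorem bef_umbrella:
  assumes b: "umb_key b" and z: "z < n" and min: "\<And>u. u \<in> comp z \<Longrightarrow> b z \<le> b u"
    and uvw: "bef z u v" "bef z v w" "A u w" "u \<in> comp z" "v < n"
  shows "A u v \<and> A v w"
proof -
  have w: "w \<in> comp z" using comp_step uvw by blast
  have "dist z v \<le> dist z w" using uvw by (auto simp: bef_def)
  then have v: "v \<in> comp z" using w comp_iff_dist[OF z] by auto
  have ne: "u \<noteq> v" "v \<noteq> w" "u \<noteq> w" using uvw A_irrefl by (auto simp: bef_def)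
  have uv: "b u < b v \<or> twins v u" using bef_or_twins[OF b z min v uvw(4,1)] umb_key_total[OF b comp_less[OF z uvw(4)] comp_less[OF z v]] ne by blast
  have vw: "b v < b w \<or> twins w v" using bef_or_twins[OF b z min w v uvw(2)] umb_key_total[OF b comp_less[OF z v] comp_less[OF z w]] ne by blast
  consider "twins v u" | "twins w v" | "b u < b v" "b v < b w" using uv vw by blast
  then show ?thesis
  proof cases
    case 1
    then show ?thesis using uvw(3) ne A_comm unfolding twins_def by metis
  next
    case 2
    then show ?thesis using uvw(3) ne A_comm unfolding twins_def by metis
  next
    case 3
    then show ?thesis using umb_keyD[OF b uvw(5)] uvw(3) by blast
  qed
qed

definition rank :: "nat \<Rightarrow> nat \<Rightarrow> nat" where
  "rank z v = card {u. u < n \<and> bef z u v}"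

lemma bef_irrefl: "\<not> bef z u u" by (simp add: bef_def)
lemma bef_trans: "bef z u v \<Longrightarrow> bef z v w \<Longrightarrow> bef z u w" unfolding bef_def by linarith
lemma bef_total: "u \<noteq> v \<Longrightarrow> bef z u v \<or> bef z v u" unfolding bef_def by linarith

lemma rank_less_iff:
  assumes "u < n" "v < n"
  shows "rank z u < rank z v \<longleftrightarrow> bef z u v"
proof -
  have *: "rank z u < rank z v" if "bef z u v" "u < n" for u v
    unfolding rank_def
  proof (rule psubset_card_mono)
    show "{x. x < n \<and> bef z x u} \<subset> {x. x < n \<and> bef z x v}"
      using that bef_trans bef_irrefl by blast
  qed simp
  then show ?thesis using assms bef_total[of u v z] by (metis less_asym less_irrefl)
qed

lemma rank_less: "v < n \<Longrightarrow> rank z v < n"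
proof -
  assume v: "v < n"
  have "{u. u < n \<and> bef z u v} \<subset> {..<n}" using v bef_irrefl by blast
  then have "rank z v < card {..<n}" unfolding rank_def by (rule psubset_card_mono[rotated]) simp
  then show ?thesis by simp
qed

lemma rank_inj: "inj_on (rank z) {..<n}"
  by (rule inj_onI) (metis bef_total lessThan_iff less_irrefl rank_less_iff)

end

text \<open>The keys are the left endpoints. Without containment the right endpoints increase in the
  same order, so an interval starting between two intersecting ones meets both.\<close>

lemma proper_interval_key:
  assumes "proper_interval_graph {..<n} E"
  shows "\<exists>b :: nat \<Rightarrow> real. inj_on b {..<n} \<and>
    (\<forall>u v w. u < n \<longrightarrow> v < n \<longrightarrow> w < n \<longrightarrow> b u < b v \<longrightarrow> b v < b w \<longrightarrow> {u, w} \<in> E \<longrightarrow> {u, v} \<in> E \<and> {v, w} \<in> E)"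
proof -
  obtain b e where rep: "interval_representation {..<n} E b e"
    and proper: "\<forall>u\<in>{..<n}. \<forall>v\<in>{..<n}. u \<noteq> v \<longrightarrow> \<not> {b u..e u} \<subseteq> {b v..e v}"
    using assms unfolding proper_interval_graph_def by blast
  have le: "b v \<le> e v" if "v < n" for v using rep that by (auto simp: interval_representation_def)
  have adj: "{u, v} \<in> E \<longleftrightarrow> b v \<le> e u" if "u < n" "v < n" "b u < b v" for u v
  proof -
    have "u \<noteq> v" using that by auto
    then have "{u, v} \<in> E \<longleftrightarrow> {b u..e u} \<inter> {b v..e v} \<noteq> {}"
      using rep that unfolding interval_representation_def by blast
    also have "\<dots> \<longleftrightarrow> b v \<le> e u" using le[OF that(2)] that(3) by (auto simp: not_le Int_atLeastAtMost)
    finally show ?thesis .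
  qed
  have inc: "b u < b v \<longrightarrow> e u < e v" "b u \<noteq> b v" if "u < n" "v < n" "u \<noteq> v" for u v
  proof -
    have "\<not> {b u..e u} \<subseteq> {b v..e v}" "\<not> {b v..e v} \<subseteq> {b u..e u}" using proper that by auto
    then show "b u < b v \<longrightarrow> e u < e v" "b u \<noteq> b v" by auto
  qed
  show ?thesis
  proof (intro exI[of _ b] conjI allI impI)
    show "inj_on b {..<n}" using inc(2) by (auto simp: inj_on_def)
    fix u v w assume a: "u < n" "v < n" "w < n" "b u < b v" "b v < b w" "{u, w} \<in> E"
    have "b w \<le> e u" using a adj[of u w] by simp
    moreover have "e u < e v" using inc(1)[of u v] a by auto
    ultimately show "{u, v} \<in> E" "{v, w} \<in> E" using a adj[of u v] adj[of v w] by auto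
  qed
qed

section \<open>Dynamic programming over thresholds\<close>

fun min_upto :: "nat \<Rightarrow> (nat \<Rightarrow> nat) \<Rightarrow> nat \<Rightarrow> nat" where
  "min_upto B f 0 = B"
| "min_upto B f (Suc k) = min (min_upto B f k) (f k)"

lemma min_upto_le_iff: "w < B \<Longrightarrow> min_upto B f k \<le> w \<longleftrightarrow> (\<exists>x<k. f x \<le> w)"
  by (induction k) (auto simp: min_le_iff_disj less_Suc_eq)

lemma min_upto_le: "min_upto B f k \<le> B"
  by (induction k) auto

text \<open>A state consists of the thresholds number \<open>i\<close> and \<open>i + 1\<close>.
  With \<open>D\<close> a spanning count, \<open>D b c - D x c\<close> is the number of far edges
  whose lower label is exactly the level \<open>i\<close> being closed. \<open>B\<close> acts as
  infinity.\<close>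

fun dp :: "(nat \<Rightarrow> nat \<Rightarrow> nat) \<Rightarrow> nat \<Rightarrow> nat \<Rightarrow> nat \<Rightarrow> nat \<Rightarrow> nat \<Rightarrow> nat" where
  "dp D B n 0 b c = (if b = 0 \<and> c = 1 then 0 else B)"
| "dp D B n (Suc i) b c = min_upto B (\<lambda>x. if x \<le> b \<and> b \<le> c then dp D B n i x b + (D b c - D x c) else B) n"

definition step_cost :: "(nat \<Rightarrow> nat \<Rightarrow> nat) \<Rightarrow> nat \<Rightarrow> (nat \<Rightarrow> nat) \<Rightarrow> nat" where
  "step_cost D i a = (\<Sum>j<i. D (a (j + 1)) (a (j + 2)) - D (a j) (a (j + 2)))"

text \<open>\<open>a j\<close> stands for the number of positions with label less than
  \<open>j\<close>, so \<open>a (j + 1)\<close> is \<open>q j\<close> of the overview. Thus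
  \<open>a 1 = 1\<close> says that only the first position has label 0.\<close>

definition threshold_seq :: "nat \<Rightarrow> nat \<Rightarrow> (nat \<Rightarrow> nat) \<Rightarrow> bool" where
  "threshold_seq n i a \<longleftrightarrow> a 0 = 0 \<and> a 1 = 1 \<and> (\<forall>j\<le>i. a j \<le> a (Suc j)) \<and> (\<forall>j\<le>i. a j < n)"

text \<open>The tested budget stays below \<open>B\<close>, so an entry that has absorbed a
  forbidden choice never passes the test.\<close>

lemma dp_le_iff:
  assumes "w < B" "0 < n"
  shows "dp D B n i b c \<le> w \<and> b < n \<longleftrightarrow> (\<exists>a. threshold_seq n i a \<and> a i = b \<and> a (Suc i) = c \<and> step_cost D i a \<le> w)"
  using assms(1)
proof (induction i arbitrary: b c w)
  case 0
  show ?case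
  proof
    assume "dp D B n 0 b c \<le> w \<and> b < n"
    then have "b = 0 \<and> c = 1" using 0 by (auto split: if_splits)
    then show "\<exists>a. threshold_seq n 0 a \<and> a 0 = b \<and> a (Suc 0) = c \<and> step_cost D 0 a \<le> w"
      using assms(2) by (intro exI[of _ "\<lambda>j. j"]) (auto simp: threshold_seq_def step_cost_def)
  next
    assume "\<exists>a. threshold_seq n 0 a \<and> a 0 = b \<and> a (Suc 0) = c \<and> step_cost D 0 a \<le> w"
    then show "dp D B n 0 b c \<le> w \<and> b < n" using assms(2) by (auto simp: threshold_seq_def)
  qed
next
  case (Suc i)
  show ?case
  proof
    assume L: "dp D B n (Suc i) b c \<le> w \<and> b < n"
    then obtain x where x: "x < n" "(if x \<le> b \<and> b \<le> c then dp D B n i x b + (D b c - D x c) else B) \<le> w"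
      unfolding dp.simps min_upto_le_iff[OF Suc.prems] by blast
    then have x': "x \<le> b" "b \<le> c" "dp D B n i x b + (D b c - D x c) \<le> w"
      using Suc.prems by (simp_all split: if_splits)
    have "dp D B n i x b \<le> w - (D b c - D x c) \<and> x < n" "w - (D b c - D x c) < B" using x' x Suc.prems by auto
    then obtain a where a: "threshold_seq n i a" "a i = x" "a (Suc i) = b" "step_cost D i a \<le> w - (D b c - D x c)"
      using Suc.IH by blast
    define a' where "a' = a(Suc (Suc i) := c)"
    have same: "a' j = a j" if "j \<le> Suc i" for j using that by (simp add: a'_def)
    have "step_cost D (Suc i) a' = step_cost D i a + (D b c - D x c)"
      using a(2-3) unfolding step_cost_def by (simp add: same) (simp add: a'_def)
    moreover have "threshold_seq n (Suc i) a'"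
      using a x' L unfolding threshold_seq_def by (auto simp: same le_Suc_eq) (auto simp: a'_def)
    ultimately show "\<exists>a. threshold_seq n (Suc i) a \<and> a (Suc i) = b \<and> a (Suc (Suc i)) = c \<and> step_cost D (Suc i) a \<le> w"
      using a(3,4) x'(3) by (intro exI[of _ a']) (simp add: a'_def)
  next
    assume "\<exists>a. threshold_seq n (Suc i) a \<and> a (Suc i) = b \<and> a (Suc (Suc i)) = c \<and> step_cost D (Suc i) a \<le> w"
    then obtain a where a: "threshold_seq n (Suc i) a" "a (Suc i) = b" "a (Suc (Suc i)) = c" "step_cost D (Suc i) a \<le> w"
      by blast
    have sc: "step_cost D i a + (D b c - D (a i) c) \<le> w"
      using a(4) unfolding step_cost_def by (simp add: a(2,3))
    have "threshold_seq n i a" using a(1) by (auto simp: threshold_seq_def)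
    then have "dp D B n i (a i) b \<le> step_cost D i a \<and> a i < n"
      using Suc.IH[of "step_cost D i a" "a i" b] a(2) sc Suc.prems by (simp del: dp.simps) blast
    moreover have "a i \<le> b" "b \<le> c" "b < n" using a by (auto simp: threshold_seq_def)
    ultimately have "a i < n \<and> (if a i \<le> b \<and> b \<le> c then dp D B n i (a i) b + (D b c - D (a i) c) else B) \<le> w" "b < n"
      using sc by simp_all
    then show "dp D B n (Suc i) b c \<le> w \<and> b < n"
      unfolding dp.simps min_upto_le_iff[OF Suc.prems] by blast
  qed
qed

definition span_count :: "'e set \<Rightarrow> ('e \<Rightarrow> nat) \<Rightarrow> ('e \<Rightarrow> nat) \<Rightarrow> nat \<Rightarrow> nat \<Rightarrow> nat" where
  "span_count X lo hi b c = card {e \<in> X. lo e < b \<and> c \<le> hi e}"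

text \<open>\<open>g\<close> and \<open>a\<close> are adjoint by \<open>ga\<close>. Hence the
  \<open>i\<close>-th summand counts the edges with lower label exactly \<open>i\<close> and upper
  label at least \<open>i + 2\<close>, and every far edge is counted once.\<close>

lemma step_cost_eq:
  fixes g :: "nat \<Rightarrow> nat"
  assumes X: "finite X" "\<And>e. e \<in> X \<Longrightarrow> lo e < n \<and> hi e < n"
    and g: "\<And>x. x < n \<Longrightarrow> g x \<le> L + 1"
    and ga: "\<And>x j. x < n \<Longrightarrow> j \<le> L + 1 \<Longrightarrow> j \<le> g x \<longleftrightarrow> a j \<le> x"
    and mono: "\<And>j. j \<le> L \<Longrightarrow> a j \<le> a (Suc j)"
  shows "step_cost (span_count X lo hi) L a = card {e \<in> X. g (lo e) + 2 \<le> g (hi e)}"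
proof -
  define C where "C i = {e \<in> X. a i \<le> lo e \<and> lo e < a (i + 1) \<and> a (i + 2) \<le> hi e}" for i
  have "span_count X lo hi (a (i + 1)) (a (i + 2)) - span_count X lo hi (a i) (a (i + 2)) = card (C i)" if "i < L" for i
  proof -
    have "a i \<le> a (i + 1)" using mono[of i] that by simp
    then have "C i = {e \<in> X. lo e < a (i + 1) \<and> a (i + 2) \<le> hi e} - {e \<in> X. lo e < a i \<and> a (i + 2) \<le> hi e}"
      "{e \<in> X. lo e < a i \<and> a (i + 2) \<le> hi e} \<subseteq> {e \<in> X. lo e < a (i + 1) \<and> a (i + 2) \<le> hi e}"
      by (auto simp: C_def)
    then show ?thesis using X(1) by (simp add: span_count_def card_Diff_subset)
  qed
  then have "step_cost (span_count X lo hi) L a = (\<Sum>i<L. card (C i))" by (simp add: step_cost_def)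
  also have "\<dots> = card (\<Union>i<L. C i)"
  proof (rule card_UN_disjoint[symmetric])
    have mono': "a i \<le> a j" if "i \<le> j" "j \<le> L" for i j
      using that by (induction j rule: dec_induct) (auto intro: le_trans[OF _ mono])
    show "\<forall>i\<in>{..<L}. \<forall>j\<in>{..<L}. i \<noteq> j \<longrightarrow> C i \<inter> C j = {}"
    proof (intro ballI impI)
      fix i j assume ij: "i \<in> {..<L}" "j \<in> {..<L}" "i \<noteq> j"
      have "a (i + 1) \<le> a j \<or> a (j + 1) \<le> a i" using ij mono'[of "i + 1" j] mono'[of "j + 1" i] by fastforce
      then show "C i \<inter> C j = {}" by (auto simp: C_def)
    qed
  qed (use X(1) in \<open>auto simp: C_def\<close>)
  also have "(\<Union>i<L. C i) = {e \<in> X. g (lo e) + 2 \<le> g (hi e)}"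
  proof (rule set_eqI)
    fix e
    show "e \<in> (\<Union>i<L. C i) \<longleftrightarrow> e \<in> {e \<in> X. g (lo e) + 2 \<le> g (hi e)}"
    proof
      assume "e \<in> (\<Union>i<L. C i)"
      then obtain i where i: "i < L" "e \<in> C i" by blast
      then have e: "lo e < n" "hi e < n" using X(2) by (auto simp: C_def)
      have "\<not> i + 1 \<le> g (lo e)" "i + 2 \<le> g (hi e)"
        using i e ga[of "lo e" "i + 1"] ga[of "hi e" "i + 2"] by (auto simp: C_def)
      then show "e \<in> {e \<in> X. g (lo e) + 2 \<le> g (hi e)}" using i by (auto simp: C_def)
    next
      assume "e \<in> {e \<in> X. g (lo e) + 2 \<le> g (hi e)}"
      then have e: "e \<in> X" "lo e < n" "hi e < n" "g (lo e) + 2 \<le> g (hi e)" using X(2) by auto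
      then have "g (lo e) < L" using g[of "hi e"] by simp
      moreover have "e \<in> C (g (lo e))" unfolding C_def
        using e calculation ga[of "lo e" "g (lo e)"] ga[of "lo e" "g (lo e) + 1"] ga[of "hi e" "g (lo e) + 2"] by auto
      ultimately show "e \<in> (\<Union>i<L. C i)" by blast
    qed
  qed
  finally show ?thesis .
qed

definition level_fun :: "nat \<Rightarrow> nat \<Rightarrow> (nat \<Rightarrow> nat) \<Rightarrow> bool" where
  "level_fun n L g \<longleftrightarrow> g 0 = 0 \<and> g (n - 1) = L + 1 \<and> (\<forall>x. 0 < x \<and> x < n - 1 \<longrightarrow> 1 \<le> g x \<and> g x \<le> L) \<and>
     (\<forall>x y. x \<le> y \<and> y < n \<longrightarrow> g x \<le> g y)"

text \<open>Thresholds and monotone levels determine each other by counting: \<open>g x\<close>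
  counts the thresholds \<open>a j\<close> with \<open>1 \<le> j \<le> L + 1\<close> that are at
  most \<open>x\<close>, and \<open>a j\<close> counts the positions with level below
  \<open>j\<close>.\<close>

theorem dp_correct:
  assumes X: "finite X" "\<And>e. e \<in> X \<Longrightarrow> lo e < n \<and> hi e < n" and n: "2 \<le> n" and w: "w < B"
  shows "(\<exists>b<n. dp (span_count X lo hi) B n L b (n - 1) \<le> w)
    \<longleftrightarrow> (\<exists>g. level_fun n L g \<and> card {e \<in> X. g (lo e) + 2 \<le> g (hi e)} \<le> w)"
proof -
  let ?D = "span_count X lo hi"
  have "(\<exists>b<n. dp ?D B n L b (n - 1) \<le> w) \<longleftrightarrow> (\<exists>a. threshold_seq n L a \<and> a (Suc L) = n - 1 \<and> step_cost ?D L a \<le> w)"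
  proof -
    have "dp ?D B n L b (n - 1) \<le> w \<and> b < n \<longleftrightarrow>
        (\<exists>a. threshold_seq n L a \<and> a L = b \<and> a (Suc L) = n - 1 \<and> step_cost ?D L a \<le> w)" for b
      using n by (intro dp_le_iff[OF w]) simp
    then show ?thesis by blast
  qed
  also have "\<dots> \<longleftrightarrow> (\<exists>g. level_fun n L g \<and> card {e \<in> X. g (lo e) + 2 \<le> g (hi e)} \<le> w)"
  proof
    assume "\<exists>a. threshold_seq n L a \<and> a (Suc L) = n - 1 \<and> step_cost ?D L a \<le> w"
    then obtain a where a: "threshold_seq n L a" "a (Suc L) = n - 1" "step_cost ?D L a \<le> w" by blast
    have a_step: "a j \<le> a (Suc j)" if "j \<le> L" for j using a that by (auto simp: threshold_seq_def)
    have a_mono: "a i \<le> a j" if "i \<le> j" "j \<le> L + 1" for i j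
      using that by (induction j rule: dec_induct) (auto intro: le_trans a_step)
    define g where "g x = card {j \<in> {1..L + 1}. a j \<le> x}" for x
    have ga: "j \<le> g x \<longleftrightarrow> a j \<le> x" if "j \<le> L + 1" for j x
    proof (cases "a j \<le> x")
      case True
      have "{1..j} \<subseteq> {i \<in> {1..L + 1}. a i \<le> x}"
      proof
        fix i assume "i \<in> {1..j}"
        then show "i \<in> {i \<in> {1..L + 1}. a i \<le> x}" using a_mono[of i j] True that by simp
      qed
      then have "card {1..j} \<le> g x" unfolding g_def by (intro card_mono) auto
      then show ?thesis using True by simp
    next
      case False
      then have j: "0 < j" using a(1) unfolding threshold_seq_def by (cases j) simp_all
      have "i < j" if "i \<in> {1..L + 1}" "a i \<le> x" for i
        using that a_mono[of j i] False by (meson atLeastAtMost_iff le_trans not_le)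
      then have "{i \<in> {1..L + 1}. a i \<le> x} \<subseteq> {1..<j}" by auto
      then have "g x \<le> card {1..<j}" unfolding g_def by (intro card_mono) auto
      then show ?thesis using False j by simp
    qed
    have gL: "g x \<le> L + 1" for x
    proof -
      have "g x \<le> card {1..L + 1}" unfolding g_def by (rule card_mono) auto
      then show ?thesis by simp
    qed
    have "card {e \<in> X. g (lo e) + 2 \<le> g (hi e)} \<le> w"
      using step_cost_eq[OF X, where a = a and g = g and L = L] gL ga a_step a(3) by simp
    moreover have "level_fun n L g" unfolding level_fun_def
    proof (intro conjI allI impI)
      have "a 0 = 0" "a 1 = 1" using a by (auto simp: threshold_seq_def)
      then show "g 0 = 0" using ga[of 1 0] by simp
      show "g (n - 1) = L + 1" using ga[of "L + 1" "n - 1"] gL[of "n - 1"] a by simp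
      fix x y
      show "1 \<le> g x" if "0 < x \<and> x < n - 1" using ga[of 1 x] \<open>a 1 = 1\<close> that by simp
      show "g x \<le> L" if "0 < x \<and> x < n - 1" using ga[of "L + 1" x] gL[of x] a(2) that by simp
      show "g x \<le> g y" if "x \<le> y \<and> y < n" unfolding g_def by (rule card_mono) (use that in auto)
    qed
    ultimately show "\<exists>g. level_fun n L g \<and> card {e \<in> X. g (lo e) + 2 \<le> g (hi e)} \<le> w" by blast
  next
    assume "\<exists>g. level_fun n L g \<and> card {e \<in> X. g (lo e) + 2 \<le> g (hi e)} \<le> w"
    then obtain g where g: "level_fun n L g" "card {e \<in> X. g (lo e) + 2 \<le> g (hi e)} \<le> w" by blast
    have g0: "g 0 = 0" and gn: "g (n - 1) = L + 1" and gmono: "\<And>x y. x \<le> y \<Longrightarrow> y < n \<Longrightarrow> g x \<le> g y"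
      using g(1) by (auto simp: level_fun_def)
    have g_mid: "1 \<le> g x" "g x \<le> L" if "0 < x" "x < n - 1" for x using g(1) that by (auto simp: level_fun_def)
    define a where "a j = card {x. x < n \<and> g x < j}" for j
    have ga: "j \<le> g x \<longleftrightarrow> a j \<le> x" if "x < n" for x j
    proof (cases "j \<le> g x")
      case True
      have "{y. y < n \<and> g y < j} \<subseteq> {..<x}"
      proof
        fix y assume "y \<in> {y. y < n \<and> g y < j}"
        then show "y \<in> {..<x}" using gmono[of x y] True by (cases "x \<le> y") auto
      qed
      then have "a j \<le> card {..<x}" unfolding a_def by (intro card_mono) auto
      then show ?thesis using True by simp
    next
      case False
      have "{..x} \<subseteq> {y. y < n \<and> g y < j}"
      proof
        fix y assume "y \<in> {..x}"
        then show "y \<in> {y. y < n \<and> g y < j}" using gmono[of y x] that False by simp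
      qed
      then have "card {..x} \<le> a j" unfolding a_def by (intro card_mono) auto
      then show ?thesis using False by simp
    qed
    have gL: "g x \<le> L + 1" if "x < n" for x using gmono[of x "n - 1"] that gn n by simp
    have a_step: "a j \<le> a (Suc j)" for j unfolding a_def by (rule card_mono) auto
    have a_less: "a j < n" if "j \<le> L + 1" for j using ga[of "n - 1" j] gn that n by simp
    have "{x. x < n \<and> g x < 1} = {0}"
    proof -
      have "x = 0" if "x < n" "g x = 0" for x
      proof (rule ccontr)
        assume "x \<noteq> 0"
        then have "x = n - 1 \<or> 0 < x \<and> x < n - 1" using that by linarith
        then show False using that g_mid(1)[of x] gn by auto
      qed
      then show ?thesis using g0 n by auto
    qed
    then have a1: "a 1 = 1" by (simp add: a_def)
    have aL: "a (Suc L) = n - 1"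
    proof (rule antisym)
      show "a (Suc L) \<le> n - 1" using ga[of "n - 1" "Suc L"] gn n by simp
      show "n - 1 \<le> a (Suc L)"
      proof (rule ccontr)
        assume "\<not> n - 1 \<le> a (Suc L)"
        then have l: "a (Suc L) < n - 1" by simp
        then have "Suc L \<le> g (a (Suc L))" using ga[of "a (Suc L)" "Suc L"] by simp
        moreover have "0 < a (Suc L)" using g0 calculation by (cases "a (Suc L)") auto
        ultimately show False using g_mid(2)[of "a (Suc L)"] l by simp
      qed
    qed
    have "threshold_seq n L a" unfolding threshold_seq_def using a1 a_step a_less by (auto simp: a_def)
    moreover have "step_cost ?D L a = card {e \<in> X. g (lo e) + 2 \<le> g (hi e)}"
      by (rule step_cost_eq[OF X]) (use gL ga a_step in auto)
    ultimately show "\<exists>a. threshold_seq n L a \<and> a (Suc L) = n - 1 \<and> step_cost ?D L a \<le> w"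
      using aL g(2) by auto
  qed
  finally show ?thesis .
qed

section \<open>Correctness of the dynamic program\<close>

lemma far_edge_set_reflect: "far_edge_set E (\<lambda>v. c - d v) = far_edge_set E d"
  by (simp add: far_edge_set_def far_def abs_minus_commute)

lemma st_labelling_reflect: "st_labelling V s t L d \<Longrightarrow> st_labelling V t s L (\<lambda>v. L + 1 - d v)"
  by (force simp: st_labelling_def)

context sgraph begin

text \<open>Moving the two vertices with extreme labels to the ends makes the labelling monotone
  everywhere, so that thresholds describe it. This may spoil the umbrella property, but far edges
  are counted from the labels alone.\<close>

definition position :: "(nat \<Rightarrow> nat) \<Rightarrow> nat \<Rightarrow> nat \<Rightarrow> nat \<Rightarrow> nat" where
  "position rk a b v = (if v = a then 0 else if v = b then n - 1
     else 1 + card {u. u < n \<and> u \<noteq> a \<and> u \<noteq> b \<and> rk u < rk v})"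

lemma position_mid:
  assumes ab: "a < n" "b < n" "a \<noteq> b" and v: "v < n" "v \<noteq> a" "v \<noteq> b"
  shows "0 < position rk a b v \<and> position rk a b v < n - 1"
proof -
  have "{u. u < n \<and> u \<noteq> a \<and> u \<noteq> b \<and> rk u < rk v} \<subseteq> {..<n} - {a, b, v}" by auto
  then have "card {u. u < n \<and> u \<noteq> a \<and> u \<noteq> b \<and> rk u < rk v} \<le> card ({..<n} - {a, b, v})"
    by (rule card_mono[rotated]) simp
  also have "\<dots> = n - 3" using ab v by (subst card_Diff_subset) auto
  finally have "card {u. u < n \<and> u \<noteq> a \<and> u \<noteq> b \<and> rk u < rk v} \<le> n - 3" .
  moreover have "3 \<le> n"
  proof -
    have "{a, b, v} \<subseteq> {..<n}" using ab v by auto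
    from card_mono[OF _ this] show ?thesis using ab v by simp
  qed
  ultimately show ?thesis using v by (simp add: position_def)
qed

lemma position_less: "a < n \<Longrightarrow> b < n \<Longrightarrow> a \<noteq> b \<Longrightarrow> v < n \<Longrightarrow> position rk a b v < n"
  using position_mid[of a b v rk] by (cases "v = a"; cases "v = b") (simp_all add: position_def)

lemma position_mono:
  assumes v: "u < n" "u \<noteq> a" "u \<noteq> b" "v < n" "v \<noteq> a" "v \<noteq> b" and less: "rk u < rk v"
  shows "position rk a b u < position rk a b v"
proof -
  have "{w. w < n \<and> w \<noteq> a \<and> w \<noteq> b \<and> rk w < rk u} \<subset> {w. w < n \<and> w \<noteq> a \<and> w \<noteq> b \<and> rk w < rk v}"
  proof (rule psubsetI)
    show "{w. w < n \<and> w \<noteq> a \<and> w \<noteq> b \<and> rk w < rk u} \<subseteq> {w. w < n \<and> w \<noteq> a \<and> w \<noteq> b \<and> rk w < rk v}"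
      using less by auto
    have "u \<in> {w. w < n \<and> w \<noteq> a \<and> w \<noteq> b \<and> rk w < rk v}" using v less by simp
    then show "{w. w < n \<and> w \<noteq> a \<and> w \<noteq> b \<and> rk w < rk u} \<noteq> {w. w < n \<and> w \<noteq> a \<and> w \<noteq> b \<and> rk w < rk v}"
      by auto
  qed
  then have "card {w. w < n \<and> w \<noteq> a \<and> w \<noteq> b \<and> rk w < rk u} < card {w. w < n \<and> w \<noteq> a \<and> w \<noteq> b \<and> rk w < rk v}"
    by (rule psubset_card_mono[rotated]) simp
  then show ?thesis using v by (simp add: position_def)
qed

lemma position_inj:
  assumes ab: "a < n" "b < n" "a \<noteq> b" and rk: "inj_on rk {..<n}"
  shows "inj_on (position rk a b) {..<n}"
proof (rule inj_onI)
  fix u v assume uv: "u \<in> {..<n}" "v \<in> {..<n}" "position rk a b u = position rk a b v"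
  have pa: "position rk a b a = 0" "position rk a b b = n - 1" using ab by (simp_all add: position_def)
  have n: "0 < n - 1" using ab by linarith
  show "u = v"
  proof (rule ccontr)
    assume ne: "u \<noteq> v"
    consider "u = a" | "v = a" | "u = b" | "v = b" | "u \<noteq> a" "u \<noteq> b" "v \<noteq> a" "v \<noteq> b" by blast
    then show False
    proof cases
      case 1
      then show False using position_mid[OF ab, of v rk] uv ne pa n by (cases "v = b") auto
    next
      case 2
      then show False using position_mid[OF ab, of u rk] uv ne pa n by (cases "u = b") auto
    next
      case 3
      then show False using position_mid[OF ab, of v rk] uv ne pa n by (cases "v = a") auto
    next
      case 4
      then show False using position_mid[OF ab, of u rk] uv ne pa n by (cases "u = a") auto
    next
      case 5
      have "rk u \<noteq> rk v" using rk uv ne by (meson inj_onD)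
      then show False using position_mono[of u a b v rk] position_mono[of v a b u rk] 5 uv by (cases "rk u < rk v") auto
    qed
  qed
qed

definition comp_edges :: "nat \<Rightarrow> nat set set" where
  "comp_edges z = {{u, v} | u v. A u v \<and> u \<in> comp z}"

lemma comp_edges_pair: "{u, v} \<in> comp_edges z \<longleftrightarrow> A u v \<and> u \<in> comp z"
proof
  assume "{u, v} \<in> comp_edges z"
  then obtain u' v' where *: "{u, v} = {u', v'}" "A u' v'" "u' \<in> comp z" by (auto simp: comp_edges_def)
  then have "u = u' \<and> v = v' \<or> u = v' \<and> v = u'" by (simp add: doubleton_eq_iff)
  then show "A u v \<and> u \<in> comp z" using *(2,3) comp_step[OF *(3,2)] A_comm by blast
qed (auto simp: comp_edges_def)

lemma finite_comp_edges: "finite (comp_edges z)"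
proof (rule finite_subset)
  show "comp_edges z \<subseteq> Pow {..<n}" using A_less by (auto simp: comp_edges_def)
qed simp

text \<open>Vertices outside the component receive the constant label \<open>L\<close>, so far edges
  occur only inside. There monotonicity lets the two end positions of an edge be compared in sorted
  order.\<close>

lemma labelling_of_levels:
  assumes E: "\<And>e. e \<in> E \<Longrightarrow> \<exists>u v. e = {u, v} \<and> A u v" and L: "1 \<le> L"
    and ab: "a < n" "b < n" "a \<noteq> b" "a \<in> comp z" "b \<in> comp z"
    and pos: "pos = position rk a b"
    and g: "level_fun n L g"
  shows "\<exists>d. st_labelling {..<n} a b (int L) d \<and>
    far_edge_set E d \<subseteq> {e \<in> comp_edges z. g (Min (pos ` e)) + 2 \<le> g (Max (pos ` e))}"
proof -
  define d where "d v = (if v \<in> comp z then int (g (pos v)) else int L)" for v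
  have gx: "g 0 = 0" "g (n - 1) = L + 1" and mid: "\<And>x. 0 < x \<Longrightarrow> x < n - 1 \<Longrightarrow> 1 \<le> g x \<and> g x \<le> L"
    and mono: "\<And>x y. x \<le> y \<Longrightarrow> y < n \<Longrightarrow> g x \<le> g y"
    using g unfolding level_fun_def by blast+
  have "st_labelling {..<n} a b (int L) d"
    unfolding st_labelling_def
  proof (intro conjI ballI impI)
    show "d a = 0" "d b = int L + 1" using ab gx by (simp_all add: d_def pos position_def)
    fix v assume v: "v \<in> {..<n}" "v \<noteq> a" "v \<noteq> b"
    have "1 \<le> g (pos v) \<and> g (pos v) \<le> L" unfolding pos by (rule mid; use position_mid[OF ab(1-3), of v rk] v in simp)
    then show "1 \<le> d v" "d v \<le> int L" using L by (simp_all add: d_def)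
  qed
  moreover have "far_edge_set E d \<subseteq> {e \<in> comp_edges z. g (Min (pos ` e)) + 2 \<le> g (Max (pos ` e))}"
  proof
    fix e assume "e \<in> far_edge_set E d"
    then obtain u v where e: "e \<in> E" "e = {u, v}" "far (d u) (d v)" by (auto simp: far_edge_set_def)
    obtain u' v' where "e = {u', v'}" "A u' v'" using E[OF e(1)] by blast
    then have uv: "A u v" using e(2) A_comm by (auto simp: doubleton_eq_iff)
    have n: "u < n" "v < n" using A_less[OF uv] by auto
    have "u \<in> comp z"
    proof (rule ccontr)
      assume "u \<notin> comp z"
      moreover have "v \<notin> comp z" using calculation comp_step[of v z u] uv A_comm[of u v] by blast
      ultimately show False using e(3) by (simp add: d_def far_def)
    qed
    then have c: "u \<in> comp z" "v \<in> comp z" using comp_step uv by blast+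
    have p: "pos u < n" "pos v < n" unfolding pos using position_less[OF ab(1-3)] n by blast+
    have "g (min (pos u) (pos v)) + 2 \<le> g (max (pos u) (pos v))"
      using e(3) c mono[of "pos u" "pos v"] mono[of "pos v" "pos u"] p
      by (cases "pos u \<le> pos v") (auto simp: d_def far_def min_def max_def)
    then show "e \<in> {e \<in> comp_edges z. g (Min (pos ` e)) + 2 \<le> g (Max (pos ` e))}"
      using c(1) uv by (simp add: e(2) comp_edges_pair)
  qed
  ultimately show ?thesis by blast
qed

text \<open>The labelling is carried to the positions \<open>rank z\<close>, freed of inversions
  there, and carried on to \<open>pos\<close>, where \<open>a\<close> and \<open>b\<close> at the
  ends complete the monotonicity.\<close>

lemma levels_of_labelling:
  assumes E: "\<And>u v. A u v \<Longrightarrow> {u, v} \<in> E" "finite E"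
    and key: "umb_key bk" "z < n" "\<And>u. u \<in> comp z \<Longrightarrow> bk z \<le> bk u"
    and ab: "a < n" "b < n" "rank z a < rank z b"
    and pos: "pos = position (rank z) a b"
    and d: "st_labelling {..<n} a b (int L) d"
  shows "\<exists>g. level_fun n L g \<and>
    card {e \<in> comp_edges z. g (Min (pos ` e)) + 2 \<le> g (Max (pos ` e))} \<le> card (far_edge_set E d)"
proof -
  define rk where "rk = rank z"
  have ne: "a \<noteq> b" using ab by auto
  have rk_inj: "inj_on rk {..<n}" unfolding rk_def by (rule rank_inj)
  have rk_less: "rk v < n" if "v < n" for v using rank_less that by (simp add: rk_def)
  have rk_bij: "bij_betw rk {..<n} {..<n}"
  proof -
    have "rk ` {..<n} = {..<n}"
      by (rule card_seteq) (use rk_less rk_inj in \<open>auto simp: card_image\<close>)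
    then show ?thesis using rk_inj by (simp add: bij_betw_def)
  qed
  define ri where "ri = inv_into {..<n} rk"
  have ri: "ri x < n" "rk (ri x) = x" if "x < n" for x
    using that rk_bij bij_betw_inv_into_right[OF rk_bij, of x] bij_betwE[OF bij_betw_inv_into[OF rk_bij]]
    by (auto simp: ri_def)
  have ri_rk: "ri (rk v) = v" if "v < n" for v
    using bij_betw_inv_into_left[OF rk_bij] that by (simp add: ri_def)
  \<comment> \<open>Only edges of the component are kept, because the umbrella property of
    \<open>bef\<close> is available only there; the other positions become isolated
    vertices.\<close>
  define Q where "Q x y \<longleftrightarrow> x < n \<and> y < n \<and> A (ri x) (ri y) \<and> ri x \<in> comp z" for x y
  have rank_iff: "bef z u v \<longleftrightarrow> rk u < rk v" if "u < n" "v < n" for u v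
    using rank_less_iff[OF that] by (simp add: rk_def)
  interpret U: umbrella n Q
  proof
    show "x < n \<and> y < n" if "Q x y" for x y using that by (simp add: Q_def)
    show "Q y x" if "Q x y" for x y
      using that comp_step[of "ri x" z "ri y"] A_comm[of "ri x" "ri y"] by (simp add: Q_def)
    show "\<not> Q x x" for x using A_irrefl by (simp add: Q_def)
    fix x y w assume *: "x < y" "y < w" "Q x w"
    have n: "x < n" "y < n" "w < n" using * by (simp_all add: Q_def)
    have "bef z (ri x) (ri y)" "bef z (ri y) (ri w)" using rank_iff ri n *(1,2) by simp_all
    then have "A (ri x) (ri y) \<and> A (ri y) (ri w)"
      using bef_umbrella[OF key, of "ri x" "ri y" "ri w"] *(3) ri(1)[OF n(2)] by (simp add: Q_def)
    then show "Q x y \<and> Q y w" using *(3) n comp_step[of "ri x" z "ri y"] by (simp add: Q_def)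
  qed
  have Q_rk: "Q (rk u) (rk v) \<longleftrightarrow> A u v \<and> u \<in> comp z" if "u < n" "v < n" for u v
    using that rk_less by (simp add: Q_def ri_rk)
  have "U.labelling (rk a) (rk b) (int L) (d \<circ> ri)"
    unfolding U.labelling_def
  proof (intro conjI allI impI)
    show "(d \<circ> ri) (rk a) = 0" "(d \<circ> ri) (rk b) = int L + 1"
      using d ab by (simp_all add: ri_rk st_labelling_def)
    fix x assume x: "x < n" "x \<noteq> rk a" "x \<noteq> rk b"
    then have "ri x \<noteq> a" "ri x \<noteq> b" using ri(2) by auto
    then show "1 \<le> (d \<circ> ri) x" "(d \<circ> ri) x \<le> int L" using d ri(1)[OF x(1)] by (simp_all add: st_labelling_def)
  qed
  from U.monotone_labelling[OF this] obtain d' where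
    d': "U.labelling (rk a) (rk b) (int L) d'" "U.cut_cost d' \<le> U.cut_cost (d \<circ> ri)" "\<And>u v. \<not> U.inversion (rk a) (rk b) d' u v"
    using ab rk_less by (auto simp: rk_def)
  have cost: "U.cut_cost (d \<circ> ri) \<le> card (far_edge_set E d)"
  proof (rule card_inj_on_le)
    show "inj_on (\<lambda>(x, y). {ri x, ri y}) (far_edges Q (d \<circ> ri))"
    proof (rule inj_onI, clarify)
      fix x y x' y' assume *: "(x, y) \<in> far_edges Q (d \<circ> ri)" "(x', y') \<in> far_edges Q (d \<circ> ri)" "{ri x, ri y} = {ri x', ri y'}"
      then have n: "x < n" "y < n" "x' < n" "y' < n" "x < y" "x' < y'" by (simp_all add: far_edges_def Q_def)
      from *(3) have "rk (ri x) = rk (ri x') \<and> rk (ri y) = rk (ri y') \<or> rk (ri x) = rk (ri y') \<and> rk (ri y) = rk (ri x')"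
        by (auto simp: doubleton_eq_iff)
      then show "x = x' \<and> y = y'" using n by (simp add: ri(2)) linarith
    qed
    show "(\<lambda>(x, y). {ri x, ri y}) ` far_edges Q (d \<circ> ri) \<subseteq> far_edge_set E d"
    proof clarify
      fix x y assume "(x, y) \<in> far_edges Q (d \<circ> ri)"
      then show "{ri x, ri y} \<in> far_edge_set E d"
        by (intro doubleton_far E(1)) (simp_all add: far_edges_def Q_def)
    qed
    show "finite (far_edge_set E d)" using E(2) by (simp add: far_edge_set_def)
  qed
  have pos_less: "pos v < n" if "v < n" for v unfolding pos by (rule position_less[OF ab(1,2) ne that])
  have pos_bij: "bij_betw pos {..<n} {..<n}"
  proof -
    have inj: "inj_on pos {..<n}" unfolding pos by (rule position_inj[OF ab(1,2) ne rank_inj])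
    have "pos ` {..<n} = {..<n}"
      by (rule card_seteq) (use pos_less inj in \<open>auto simp: card_image\<close>)
    then show ?thesis using inj by (simp add: bij_betw_def)
  qed
  define pi where "pi = inv_into {..<n} pos"
  have pi: "pi x < n" "pos (pi x) = x" if "x < n" for x
    using that pos_bij bij_betw_inv_into_right[OF pos_bij, of x] bij_betwE[OF bij_betw_inv_into[OF pos_bij]]
    by (auto simp: pi_def)
  have pi_pos: "pi (pos v) = v" if "v < n" for v
    using bij_betw_inv_into_left[OF pos_bij] that by (simp add: pi_def)
  define g where "g x = nat (d' (rk (pi x)))" for x
  have g_pos: "g (pos v) = nat (d' (rk v))" if "v < n" for v using that by (simp add: g_def pi_pos)
  have da: "d' (rk a) = 0" "d' (rk b) = int L + 1" using d'(1) by (simp_all add: U.labelling_def)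
  have dmid: "1 \<le> d' (rk v) \<and> d' (rk v) \<le> int L" if "v < n" "v \<noteq> a" "v \<noteq> b" for v
  proof -
    have "rk v \<noteq> rk a" "rk v \<noteq> rk b" using rk_inj that ab by (auto dest: inj_onD)
    then show ?thesis using d'(1) rk_less[OF that(1)] by (simp add: U.labelling_def)
  qed
  have d_nonneg: "0 \<le> d' (rk v)" "d' (rk v) \<le> int L + 1" if "v < n" for v
    using dmid[of v] da that by (cases "v = a"; cases "v = b"; simp)+
  have pos_ab: "pos a = 0" "pos b = n - 1" using ne by (simp_all add: pos position_def)
  have n1: "0 < n - 1" using ab ne by linarith
  \<comment> \<open>\<open>a\<close> comes first with label 0 and \<open>b\<close> last with
    \<open>L + 1\<close>; the other vertices keep their order under \<open>rk\<close>, where a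
    descent would be an inversion of \<open>d'\<close>.\<close>
  have gmono: "g (pos u) \<le> g (pos v)" if uv: "u < n" "v < n" "pos u < pos v" for u v
  proof -
    have ne_uv: "u \<noteq> v" "v \<noteq> a" "u \<noteq> b" using uv pos_ab pos_less[OF uv(2)] by auto
    consider "u = a" | "v = b" | "u \<noteq> a" "v \<noteq> b" by blast
    then have "d' (rk u) \<le> d' (rk v)"
    proof cases
      case 1
      then show ?thesis using da d_nonneg uv by simp
    next
      case 2
      then show ?thesis using da d_nonneg uv by simp
    next
      case 3
      have "rk u < rk v"
      proof (rule ccontr)
        assume "\<not> rk u < rk v"
        then have "rk v < rk u" using rk_inj uv ne_uv by (metis inj_onD lessThan_iff linorder_neqE_nat)
        then have "pos v < pos u" unfolding pos using 3 ne_uv uv by (intro position_mono) (simp_all add: rk_def)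
        then show False using uv by simp
      qed
      moreover have "rk u \<noteq> rk a" "rk u \<noteq> rk b" "rk v \<noteq> rk a" "rk v \<noteq> rk b"
        using rk_inj 3 ne_uv uv ab by (auto dest: inj_onD)
      ultimately show ?thesis using d'(3)[of "rk u" "rk v"] rk_less[OF uv(2)] unfolding U.inversion_def by linarith
    qed
    then show ?thesis using uv by (simp add: g_pos)
  qed
  have "level_fun n L g"
    unfolding level_fun_def
  proof (intro conjI allI impI)
    show "g 0 = 0" using g_pos[OF ab(1)] da pos_ab by simp
    show "g (n - 1) = L + 1" using g_pos[OF ab(2)] da pos_ab by (simp add: nat_add_distrib)
    fix x y
    { assume x: "0 < x \<and> x < n - 1"
      then have xn: "x < n" by linarith
      have "pi x \<noteq> a" "pi x \<noteq> b" using pi(2)[OF xn] pos_ab x by auto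
      then have "1 \<le> d' (rk (pi x)) \<and> d' (rk (pi x)) \<le> int L" using dmid pi(1)[OF xn] by simp
      then show "1 \<le> g x" "g x \<le> L" unfolding g_def by linarith+ }
    assume "x \<le> y \<and> y < n"
    then show "g x \<le> g y" using gmono[of "pi x" "pi y"] pi[of x] pi[of y] by (cases "x = y") auto
  qed
  moreover have "card {e \<in> comp_edges z. g (Min (pos ` e)) + 2 \<le> g (Max (pos ` e))} \<le> U.cut_cost d'"
  proof (rule card_inj_on_le)
    let ?X = "{e \<in> comp_edges z. g (Min (pos ` e)) + 2 \<le> g (Max (pos ` e))}"
    let ?h = "\<lambda>e. (Min (rk ` e), Max (rk ` e))"
    have X: "\<exists>u v. e = {u, v} \<and> A u v \<and> u \<in> comp z \<and> rk u < rk v \<and> u < n \<and> v < n" if eX: "e \<in> ?X" for e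
    proof -
      obtain u v where e: "e = {u, v}" "A u v" "u \<in> comp z" using eX unfolding comp_edges_def by blast
      have n: "u < n" "v < n" using A_less[OF e(2)] by auto
      have "u \<noteq> v" using e(2) A_irrefl by auto
      then have "rk u < rk v \<or> rk v < rk u" using rk_inj n by (metis inj_onD lessThan_iff linorder_neqE_nat)
      then show ?thesis
      proof
        assume "rk v < rk u"
        moreover have "v \<in> comp z" "A v u" using comp_step[OF e(3,2)] e(2) A_comm by auto
        ultimately show ?thesis using e(1) n by (intro exI[of _ v] exI[of _ u]) auto
      qed (use e n in blast)
    qed
    show "inj_on ?h ?X"
    proof (rule inj_onI)
      fix e e' assume ee: "e \<in> ?X" "e' \<in> ?X" "?h e = ?h e'"
      obtain u v where e: "e = {u, v}" "rk u < rk v" "u < n" "v < n" using X[OF ee(1)] by blast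
      obtain u' v' where e': "e' = {u', v'}" "rk u' < rk v'" "u' < n" "v' < n" using X[OF ee(2)] by blast
      have "rk u = rk u'" "rk v = rk v'" using ee(3) e(2) e'(2) by (simp_all add: e(1) e'(1) min_def max_def)
      then have "u = u'" "v = v'" using rk_inj e e' by (auto dest: inj_onD)
      then show "e = e'" using e(1) e'(1) by simp
    qed
    show "?h ` ?X \<subseteq> far_edges Q d'"
    proof
      fix y assume "y \<in> ?h ` ?X"
      then obtain e where e: "e \<in> ?X" "y = ?h e" by blast
      obtain u v where uv: "e = {u, v}" "A u v" "u \<in> comp z" "rk u < rk v" "u < n" "v < n" using X[OF e(1)] by blast
      have y: "y = (rk u, rk v)" using uv(4) by (simp add: e(2) uv(1) min_def max_def)
      have gd: "g (min (pos u) (pos v)) + 2 \<le> g (max (pos u) (pos v))" using e(1) by (simp add: uv(1))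
      have "far (d' (rk u)) (d' (rk v))"
        using gd g_pos[OF uv(5)] g_pos[OF uv(6)] d_nonneg[OF uv(5)] d_nonneg[OF uv(6)]
        by (cases "pos u \<le> pos v") (simp_all add: far_def min_def max_def)
      then show "y \<in> far_edges Q d'" using uv by (simp add: y far_edges_def Q_rk)
    qed
    show "finite (far_edges Q d')" by (rule finite_far_edges[of "{..<n}"]) (simp_all add: U.E_less)
  qed
  ultimately show ?thesis using d'(2) cost by (meson le_trans)
qed

text \<open>All costs above the budget are represented by \<open>\<beta> + 1\<close>, which suffices
  for comparing with \<open>\<beta>\<close> and keeps the table entries small.\<close>

theorem cut_iff_dp:
  assumes E: "simple_graph {..<n} E" "\<And>u v. A u v \<longleftrightarrow> {u, v} \<in> E" "proper_interval_graph {..<n} E"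
    and st: "s < n" "t < n" "s \<noteq> t" and l: "0 < l" and L: "L = max 1 (min l (card E))"
    and z: "z \<in> comp s" "\<And>u. u \<in> comp s \<Longrightarrow> dist s u < dist s z \<or> (dist s u = dist s z \<and> degree z \<le> degree u)"
    and t: "t \<in> comp z"
    and pos: "pos = (if rank z s < rank z t then position (rank z) s t else position (rank z) t s)"
  shows "length_bounded_cut {..<n} E s t \<beta> l \<longleftrightarrow>
    (\<exists>x<n. dp (span_count (comp_edges z) (\<lambda>e. Min (pos ` e)) (\<lambda>e. Max (pos ` e))) (\<beta> + 1) n L x (n - 1) \<le> \<beta>)"
proof -
  have zn: "z < n" using comp_less[OF st(1) z(1)] .
  have cz: "comp z = comp s" by (rule comp_eq[OF z(1)])
  have sz: "s \<in> comp z" using cz by simp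
  have finE: "finite E" by (rule simple_graph_finite[OF E(1)])
  have L1: "1 \<le> L" using L by simp
  obtain b0 where b0: "umb_key b0"
  proof -
    obtain b :: "nat \<Rightarrow> real" where b: "inj_on b {..<n}"
      "\<And>u v w. u < n \<Longrightarrow> v < n \<Longrightarrow> w < n \<Longrightarrow> b u < b v \<Longrightarrow> b v < b w \<Longrightarrow> {u, w} \<in> E \<Longrightarrow> {u, v} \<in> E \<and> {v, w} \<in> E"
      using proper_interval_key[OF E(3)] by metis
    have "umb_key b" unfolding umb_key_def
    proof (intro conjI allI impI b(1))
      fix u v w assume *: "v < n" "b u < b v" "b v < b w" "A u w"
      have "{u, v} \<in> E \<and> {v, w} \<in> E" using b(2)[of u v w] * A_less[OF *(4)] E(2)[of u w] by simp
      then show "A u v" "A v w" using E(2) by simp_all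
    qed
    then show ?thesis by (rule that)
  qed
  from extreme_end[OF b0 st(1) z] obtain bk where key: "umb_key bk" "\<And>u. u \<in> comp z \<Longrightarrow> bk z \<le> bk u"
    using cz by auto
  have edge_ex: "\<exists>u v. e = {u, v} \<and> A u v" if "e \<in> E" for e
    using that E(1,2) unfolding simple_graph_def by blast
  have st_rank: "rank z s < rank z t \<or> rank z t < rank z s"
    using rank_inj[of z] st by (metis inj_onD lessThan_iff linorder_neqE_nat)
  define lo where "lo e = Min (pos ` e)" for e
  define hi where "hi e = Max (pos ` e)" for e
  have main: "(\<exists>d. st_labelling {..<n} a b (int L) d \<and> card (far_edge_set E d) \<le> \<beta>) \<longleftrightarrow>
      (\<exists>g. level_fun n L g \<and> card {e \<in> comp_edges z. g (lo e) + 2 \<le> g (hi e)} \<le> \<beta>)"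
    if ab: "a < n" "b < n" "rank z a < rank z b" "a \<in> comp z" "b \<in> comp z" and p: "pos = position (rank z) a b" for a b
  proof
    assume "\<exists>d. st_labelling {..<n} a b (int L) d \<and> card (far_edge_set E d) \<le> \<beta>"
    then obtain d where d: "st_labelling {..<n} a b (int L) d" "card (far_edge_set E d) \<le> \<beta>" by blast
    have "{u, v} \<in> E" if "A u v" for u v using that E(2) by simp
    from levels_of_labelling[OF this finE key(1) zn key(2) ab(1-3) p d(1)]
    show "\<exists>g. level_fun n L g \<and> card {e \<in> comp_edges z. g (lo e) + 2 \<le> g (hi e)} \<le> \<beta>"
      using d(2) unfolding lo_def hi_def by (meson le_trans)
  next
    assume "\<exists>g. level_fun n L g \<and> card {e \<in> comp_edges z. g (lo e) + 2 \<le> g (hi e)} \<le> \<beta>"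
    then obtain g where g: "level_fun n L g" "card {e \<in> comp_edges z. g (lo e) + 2 \<le> g (hi e)} \<le> \<beta>" by blast
    have ne: "a \<noteq> b" using ab(3) by auto
    from labelling_of_levels[OF edge_ex L1 ab(1,2) ne ab(4,5) p g(1)]
    obtain d where d: "st_labelling {..<n} a b (int L) d"
      "far_edge_set E d \<subseteq> {e \<in> comp_edges z. g (Min (pos ` e)) + 2 \<le> g (Max (pos ` e))}" by blast
    have "card (far_edge_set E d) \<le> card {e \<in> comp_edges z. g (Min (pos ` e)) + 2 \<le> g (Max (pos ` e))}"
      by (rule card_mono[OF _ d(2)]) (simp add: finite_comp_edges)
    then show "\<exists>d. st_labelling {..<n} a b (int L) d \<and> card (far_edge_set E d) \<le> \<beta>"
      using d(1) g(2) unfolding lo_def hi_def by (meson le_trans)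
  qed
  have "length_bounded_cut {..<n} E s t \<beta> l \<longleftrightarrow>
      (\<exists>d. st_labelling {..<n} s t (int L) d \<and> card (far_edge_set E d) \<le> \<beta>)"
    using st by (intro cut_iff_labelling[OF E(1) _ _ st(3) l L]) simp_all
  also have "\<dots> \<longleftrightarrow> (\<exists>g. level_fun n L g \<and> card {e \<in> comp_edges z. g (lo e) + 2 \<le> g (hi e)} \<le> \<beta>)"
  proof (cases "rank z s < rank z t")
    case True
    then show ?thesis using pos st sz t by (intro main) simp_all
  next
    case False
    then have ts: "rank z t < rank z s" using st_rank by simp
    \<comment> \<open>\<open>main\<close> requires the vertex with label 0 to come first; if
      \<open>t\<close> does, the labels are reflected by \<open>L + 1 - d\<close>.\<close>
    have "(\<exists>d. st_labelling {..<n} s t (int L) d \<and> card (far_edge_set E d) \<le> \<beta>) \<longleftrightarrow>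
        (\<exists>d. st_labelling {..<n} t s (int L) d \<and> card (far_edge_set E d) \<le> \<beta>)"
      using st_labelling_reflect far_edge_set_reflect by metis
    also have "\<dots> \<longleftrightarrow> (\<exists>g. level_fun n L g \<and> card {e \<in> comp_edges z. g (lo e) + 2 \<le> g (hi e)} \<le> \<beta>)"
      using ts False pos st sz t by (intro main) simp_all
    finally show ?thesis .
  qed
  also have "\<dots> \<longleftrightarrow> (\<exists>x<n. dp (span_count (comp_edges z) lo hi) (\<beta> + 1) n L x (n - 1) \<le> \<beta>)"
  proof (rule dp_correct[symmetric])
    show "2 \<le> n" using st by linarith
    fix e assume "e \<in> comp_edges z"
    then obtain u v where e: "e = {u, v}" "A u v" unfolding comp_edges_def by blast
    have "pos u < n" "pos v < n"
      using pos position_less[of s t _ "rank z"] position_less[of t s _ "rank z"] st A_less[OF e(2)] by simp_all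
    then show "lo e < n \<and> hi e < n" by (simp add: lo_def hi_def e(1))
  qed (simp_all add: finite_comp_edges)
  finally show ?thesis unfolding lo_def hi_def .
qed

text \<open>Label 1 on the rest of the component of \<open>s\<close> and \<open>L\<close> outside,
  apart from \<open>t\<close>, leaves no far edge at all.\<close>

lemma cut_if_unreachable:
  assumes E: "simple_graph {..<n} E" "\<And>u v. A u v \<longleftrightarrow> {u, v} \<in> E"
    and st: "s < n" "t < n" and l: "0 < l" and t: "t \<notin> comp s"
  shows "length_bounded_cut {..<n} E s t \<beta> l"
proof -
  have ne: "s \<noteq> t" using t by auto
  define L where "L = max 1 (min l (card E))"
  have L1: "1 \<le> L" by (simp add: L_def)
  define d where "d v = (if v = s then 0 else if v = t then int L + 1 else if v \<in> comp s then 1 else int L)" for v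
  have "st_labelling {..<n} s t (int L) d" using L1 ne by (simp add: st_labelling_def d_def)
  moreover have "far_edge_set E d = {}"
  proof (rule ccontr)
    assume "far_edge_set E d \<noteq> {}"
    then obtain u v where uv: "{u, v} \<in> E" "far (d u) (d v)" by (auto simp: far_edge_set_def)
    then have A: "A u v" "A v u" using E(2) A_comm by blast+
    have "u \<in> comp s \<longleftrightarrow> v \<in> comp s" using comp_step A by blast
    then show False using uv(2) t ne by (cases "u \<in> comp s") (auto simp: d_def far_def split: if_splits)
  qed
  ultimately have "\<exists>d. st_labelling {..<n} s t (int L) d \<and> card (far_edge_set E d) \<le> \<beta>"
    by (intro exI[of _ d]) simp
  then show ?thesis using cut_iff_labelling[OF E(1) _ _ ne l L_def] st by simp
qed

end

section \<open>Compiling table computations to the random-access machine\<close>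

definition runs :: "nat \<Rightarrow> prog \<Rightarrow> memory \<Rightarrow> nat \<Rightarrow> (memory \<Rightarrow> bool) \<Rightarrow> bool" where
  "runs W P M t Q \<longleftrightarrow> (\<exists>T' M'. exec W P M T' M' \<and> T' \<le> t \<and> Q M')"

lemma runs_mono: "runs W P M t Q \<Longrightarrow> t \<le> t' \<Longrightarrow> (\<And>M'. Q M' \<Longrightarrow> Q' M') \<Longrightarrow> runs W P M t' Q'"
  unfolding runs_def by (meson le_trans)

lemma runs_seq:
  assumes "runs W P M t1 Q1" "\<And>M'. Q1 M' \<Longrightarrow> runs W P' M' t2 Q"
  shows "runs W (Seq P P') M (t1 + t2) Q"
proof -
  obtain T1 M1 where 1: "exec W P M T1 M1" "T1 \<le> t1" "Q1 M1" using assms(1) by (auto simp: runs_def)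
  obtain T2 M2 where 2: "exec W P' M1 T2 M2" "T2 \<le> t2" "Q M2" using assms(2)[OF 1(3)] by (auto simp: runs_def)
  have "exec W (Seq P P') M (T1 + T2) M2" by (rule exec.Seq[OF 1(1) 2(1)])
  then show ?thesis using 1(2) 2(2,3) unfolding runs_def by (intro exI[of _ "T1 + T2"] exI[of _ M2]) simp
qed

lemma runs_assign:
  assumes "fits W a M" "fits W e M" "Q (M(val a M := val e M))"
  shows "runs W (Assign a e) M (cost a + cost e + 1) Q"
  unfolding runs_def using exec.Assign[OF assms(1,2)] assms(3) by blast

lemma runs_while:
  assumes step: "\<And>i M. i < B \<Longrightarrow> J i M \<Longrightarrow> runs W P M t (J (Suc i))"
    and test: "\<And>i M. i \<le> B \<Longrightarrow> J i M \<Longrightarrow> fits W e M \<and> (val e M \<noteq> 0 \<longleftrightarrow> i < B)"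
    and init: "J i M" "i \<le> B"
  shows "runs W (While e P) M ((cost e + 1 + t) * (B - i) + (cost e + 1)) (J B)"
  using init
proof (induction "B - i" arbitrary: i M)
  case 0
  then have "i = B" by simp
  then have "exec W (While e P) M (cost e + 1) M" using test[of B M] 0 by (intro exec.WhileFalse) auto
  then show ?case using 0 \<open>i = B\<close> unfolding runs_def by (intro exI[of _ "cost e + 1"] exI[of _ M]) simp
next
  case (Suc d)
  then have i: "i < B" by simp
  obtain T1 M1 where 1: "exec W P M T1 M1" "T1 \<le> t" "J (Suc i) M1"
    using step[OF i Suc.prems(1)] by (auto simp: runs_def)
  have "runs W (While e P) M1 ((cost e + 1 + t) * (B - Suc i) + (cost e + 1)) (J B)"
    using Suc 1(3) i by (intro Suc.hyps(1)) auto
  then obtain T2 M2 where 2: "exec W (While e P) M1 T2 M2" "T2 \<le> (cost e + 1 + t) * (B - Suc i) + (cost e + 1)" "J B M2"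
    by (auto simp: runs_def)
  have "exec W (While e P) M (cost e + 1 + T1 + T2) M2"
    using test[of i M] Suc.prems i by (intro exec.WhileTrue[OF _ _ 1(1) 2(1)]) auto
  moreover have "B - i = Suc (B - Suc i)" using i by simp
  then have "cost e + 1 + T1 + T2 \<le> (cost e + 1 + t) * (B - i) + (cost e + 1)"
    using 1(2) 2(2) by simp
  ultimately show ?case using 2(3) unfolding runs_def by blast
qed

text \<open>If all cells hold at most \<open>K \<ge> 2\<close>, then \<open>K ^ expo e\<close>
  bounds every intermediate value of \<open>e\<close>. Overflow thus reduces to bounding cells, with
  an exponent that depends on the program only.\<close>

fun expo :: "exp \<Rightarrow> nat" where
  "expo (Const c) = c"
| "expo (Mem a) = expo a + 1"
| "expo (Plus a b) = expo a + expo b + 1"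
| "expo (Minus a b) = expo a + expo b"
| "expo (Times a b) = expo a + expo b"

fun prog_expo :: "prog \<Rightarrow> nat" where
  "prog_expo Skip = 0"
| "prog_expo (Assign a e) = expo a + expo e"
| "prog_expo (Seq P Q) = prog_expo P + prog_expo Q"
| "prog_expo (Cond e P Q) = expo e + prog_expo P + prog_expo Q"
| "prog_expo (While e P) = expo e + prog_expo P"

lemma val_le:
  assumes K: "2 \<le> K" and M: "\<And>a. M a \<le> K"
  shows "val e M \<le> K ^ expo e"
proof (induction e)
  case (Const c)
  have "c < 2 ^ c" by simp
  also have "(2::nat) ^ c \<le> K ^ c" using K by (rule power_mono) simp
  finally show ?case by simp
next
  case (Mem e)
  have "val (Mem e) M \<le> K" using M by simp
  also have "K \<le> K ^ expo (Mem e)" by (rule self_le_power) (use K in auto)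
  finally show ?case .
next
  case (Plus a b)
  have "K ^ expo a \<le> K ^ (expo a + expo b)" "K ^ expo b \<le> K ^ (expo a + expo b)"
    using K by (auto intro: power_increasing)
  moreover have "2 * K ^ (expo a + expo b) \<le> K * K ^ (expo a + expo b)" by (rule mult_le_mono1[OF K])
  ultimately have "val a M + val b M \<le> K * K ^ (expo a + expo b)" using Plus by linarith
  then show ?case by simp
next
  case (Minus a b)
  have "K ^ expo a \<le> K ^ (expo a + expo b)" using K by (auto intro: power_increasing)
  then show ?case using Minus by simp
next
  case (Times a b)
  then show ?case by (simp add: power_add mult_le_mono)
qed

lemma fits_if_bounded:
  assumes K: "2 \<le> K" and M: "\<And>a. M a \<le> K"
  shows "K ^ expo e \<le> W \<Longrightarrow> fits W e M"
proof (induction e)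
  case (Const c)
  then show ?case using val_le[OF K M, of "Const c"] by simp
next
  case (Mem e)
  have "K ^ expo e \<le> K ^ expo (Mem e)" using K by (intro power_increasing) auto
  then have "fits W e M" using Mem by (meson le_trans)
  moreover have "val (Mem e) M \<le> W" using val_le[OF K M] Mem.prems by (rule le_trans)
  ultimately show ?case by simp
next
  case (Plus a b)
  have "K ^ expo a \<le> K ^ expo (Plus a b)" "K ^ expo b \<le> K ^ expo (Plus a b)"
    by (rule power_increasing; use K in simp)+
  moreover have "val (Plus a b) M \<le> W" using val_le[OF K M] Plus.prems by (rule le_trans)
  ultimately show ?case using Plus by (metis fits.simps(3) le_trans val.simps(3))
next
  case (Minus a b)
  have "K ^ expo a \<le> K ^ expo (Minus a b)" "K ^ expo b \<le> K ^ expo (Minus a b)"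
    by (rule power_increasing; use K in simp)+
  then show ?case using Minus by simp
next
  case (Times a b)
  have "K ^ expo a \<le> K ^ expo (Times a b)" "K ^ expo b \<le> K ^ expo (Times a b)"
    by (rule power_increasing; use K in simp)+
  moreover have "val (Times a b) M \<le> W" using val_le[OF K M] Times.prems by (rule le_trans)
  ultimately show ?case using Times by (metis fits.simps(5) le_trans val.simps(5))
qed

text \<open>Array cells are addressed through an injective quadratic pairing; array \<open>0\<close> holds the registers
  (three outer loop counters, the inner loop counter, the accumulator).\<close>

definition pairing :: "nat \<Rightarrow> nat \<Rightarrow> nat" where
  "pairing x y = (x + y) * (x + y) + x"

text \<open>The summand \<open>x\<close> is at most \<open>x + y\<close> and so smaller than the gap
  to the next square; the value determines \<open>x + y\<close> and then \<open>x\<close>.\<close>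

lemma pairing_inject [simp]: "pairing x y = pairing x' y' \<longleftrightarrow> x = x' \<and> y = y'"
proof
  assume eq: "pairing x y = pairing x' y'"
  have less: "pairing a b < pairing a' b'" if "a + b < a' + b'" for a b a' b'
  proof -
    have "Suc (a + b) * Suc (a + b) \<le> (a' + b') * (a' + b')" using that by (intro mult_le_mono) auto
    then show ?thesis unfolding pairing_def by simp
  qed
  have "x + y = x' + y'" using less[of x y x' y'] less[of x' y' x y] eq by (metis less_irrefl linorder_neqE_nat)
  then show "x = x' \<and> y = y'" using eq by (auto simp: pairing_def)
qed simp

text \<open>Arrays start behind the \<open>2 * m + 6\<close> input cells, so the input stays
  readable. The compiled address takes \<open>m\<close> from cell 1, which keeps the program
  independent of the instance.\<close>

definition addr :: "nat \<Rightarrow> nat \<Rightarrow> nat \<Rightarrow> nat \<Rightarrow> nat \<Rightarrow> nat" where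
  "addr m j a b c = 2 * m + 6 + pairing (pairing (pairing j a) b) c"

lemma addr_inject [simp]: "addr m j a b c = addr m j' a' b' c' \<longleftrightarrow> j = j' \<and> a = a' \<and> b = b' \<and> c = c'"
  by (auto simp: addr_def)

lemma addr_ge: "x < 2 * m + 6 \<Longrightarrow> x \<noteq> addr m j a b c" "x < 2 * m + 6 \<Longrightarrow> addr m j a b c \<noteq> x"
  by (auto simp: addr_def)

definition pairing_exp :: "exp \<Rightarrow> exp \<Rightarrow> exp" where
  "pairing_exp x y = Plus (Times (Plus x y) (Plus x y)) x"

definition addr_exp :: "nat \<Rightarrow> exp \<Rightarrow> exp \<Rightarrow> exp \<Rightarrow> exp" where
  "addr_exp j a b c = Plus (Plus (Times (Const 2) (Mem (Const 1))) (Const 6))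
     (pairing_exp (pairing_exp (pairing_exp (Const j) a) b) c)"

lemma val_addr_exp: "val (addr_exp j a b c) M = addr (M 1) j (val a M) (val b M) (val c M)"
  by (simp add: addr_exp_def addr_def pairing_exp_def pairing_def)

section \<open>Table expressions and their compilation\<close>

type_synonym arrays = "nat \<Rightarrow> nat \<Rightarrow> nat \<Rightarrow> nat \<Rightarrow> nat"

text \<open>\<open>EU\<close> and \<open>EV\<close> are the end points of the edge selected by the
  inner loop counter, register 3. \<open>Mn\<close> has no machine counterpart and is compiled to
  \<open>a - (a - b)\<close> with truncated subtraction.\<close>

datatype ex =
    Cn nat | Cell nat | EU | EV | Reg nat | Arr nat ex ex ex
  | Ad ex ex | Sb ex ex | Ml ex ex | Mn ex ex

fun ev :: "memory \<Rightarrow> (nat \<Rightarrow> nat) \<Rightarrow> arrays \<Rightarrow> ex \<Rightarrow> nat" where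
  "ev I \<rho> \<tau> (Cn c) = c"
| "ev I \<rho> \<tau> (Cell c) = I c"
| "ev I \<rho> \<tau> EU = I (6 + 2 * \<rho> 3)"
| "ev I \<rho> \<tau> EV = I (7 + 2 * \<rho> 3)"
| "ev I \<rho> \<tau> (Reg r) = \<rho> r"
| "ev I \<rho> \<tau> (Arr j a b c) = \<tau> j (ev I \<rho> \<tau> a) (ev I \<rho> \<tau> b) (ev I \<rho> \<tau> c)"
| "ev I \<rho> \<tau> (Ad a b) = ev I \<rho> \<tau> a + ev I \<rho> \<tau> b"
| "ev I \<rho> \<tau> (Sb a b) = ev I \<rho> \<tau> a - ev I \<rho> \<tau> b"
| "ev I \<rho> \<tau> (Ml a b) = ev I \<rho> \<tau> a * ev I \<rho> \<tau> b"
| "ev I \<rho> \<tau> (Mn a b) = min (ev I \<rho> \<tau> a) (ev I \<rho> \<tau> b)"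

definition reg_exp :: "nat \<Rightarrow> exp" where
  "reg_exp r = addr_exp 0 (Const r) (Const 0) (Const 0)"

fun cx :: "ex \<Rightarrow> exp" where
  "cx (Cn c) = Const c"
| "cx (Cell c) = Mem (Const c)"
| "cx EU = Mem (Plus (Const 6) (Times (Const 2) (Mem (reg_exp 3))))"
| "cx EV = Mem (Plus (Const 7) (Times (Const 2) (Mem (reg_exp 3))))"
| "cx (Reg r) = Mem (reg_exp r)"
| "cx (Arr j a b c) = Mem (addr_exp (Suc j) (cx a) (cx b) (cx c))"
| "cx (Ad a b) = Plus (cx a) (cx b)"
| "cx (Sb a b) = Minus (cx a) (cx b)"
| "cx (Ml a b) = Times (cx a) (cx b)"
| "cx (Mn a b) = Minus (cx a) (Minus (cx a) (cx b))"

fun well :: "ex \<Rightarrow> bool" where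
  "well (Cell c) = (c < 6)"
| "well (Reg r) = (r < 5)"
| "well (Arr j a b c) = (well a \<and> well b \<and> well c)"
| "well (Ad a b) = (well a \<and> well b)"
| "well (Sb a b) = (well a \<and> well b)"
| "well (Ml a b) = (well a \<and> well b)"
| "well (Mn a b) = (well a \<and> well b)"
| "well _ = True"

fun edges :: "ex \<Rightarrow> bool" where
  "edges EU = True"
| "edges EV = True"
| "edges (Arr j a b c) = (edges a \<or> edges b \<or> edges c)"
| "edges (Ad a b) = (edges a \<or> edges b)"
| "edges (Sb a b) = (edges a \<or> edges b)"
| "edges (Ml a b) = (edges a \<or> edges b)"
| "edges (Mn a b) = (edges a \<or> edges b)"
| "edges _ = False"

fun is01 :: "ex \<Rightarrow> bool" where
  "is01 (Cn c) = (c \<le> 1)"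
| "is01 (Sb a b) = is01 a"
| "is01 (Ml a b) = (is01 a \<and> is01 b)"
| "is01 (Mn a b) = (is01 a \<or> is01 b)"
| "is01 _ = False"

text \<open>A syntactic certificate that the value can be stored without exceeding the cell bound
  \<open>K\<close>. A sum is accepted by itself only as a header cell plus a constant up to 2, which
  is why accumulators carry an explicit cap.\<close>

fun small :: "ex \<Rightarrow> bool" where
  "small (Cn c) = (c \<le> 2)"
| "small (Ad (Cell c) (Cn d)) = (d \<le> 2)"
| "small (Ad _ _) = False"
| "small (Sb a b) = small a"
| "small (Ml a b) = (is01 a \<and> small b \<or> small a \<and> is01 b)"
| "small (Mn a b) = (small a \<or> small b)"
| "small _ = True"

lemma is01_le: "is01 e \<Longrightarrow> ev I \<rho> \<tau> e \<le> 1"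
proof (induction e)
  case (Ml a b)
  then have "ev I \<rho> \<tau> a \<le> 1" "ev I \<rho> \<tau> b \<le> 1" by auto
  then show ?case using mult_le_mono[of "ev I \<rho> \<tau> a" 1 "ev I \<rho> \<tau> b" 1] by simp
qed (auto simp: min_le_iff_disj)

text \<open>Besides linking memory and model, it bounds every cell by \<open>K\<close>; this yields
  all overflow conditions. The conjunct \<open>I c + 2 \<le> K\<close> leaves room for loop bounds
  such as \<open>m + 2\<close> and start values such as \<open>\<beta> + 1\<close>.\<close>

definition rel :: "memory \<Rightarrow> nat \<Rightarrow> (nat \<Rightarrow> nat) \<Rightarrow> arrays \<Rightarrow> memory \<Rightarrow> bool" where
  "rel I K \<rho> \<tau> M \<longleftrightarrow> (\<forall>a < 2 * I 1 + 6. M a = I a) \<and> (\<forall>r. M (addr (I 1) 0 r 0 0) = \<rho> r) \<and>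
     (\<forall>j a b c. M (addr (I 1) (Suc j) a b c) = \<tau> j a b c) \<and> (\<forall>a. M a \<le> K) \<and> 2 \<le> K \<and> (\<forall>c<6. I c + 2 \<le> K)"

lemma rel_header: "rel I K \<rho> \<tau> M \<Longrightarrow> a < 2 * I 1 + 6 \<Longrightarrow> M a = I a"
  by (simp add: rel_def)

lemma rel_one: "rel I K \<rho> \<tau> M \<Longrightarrow> M (Suc 0) = I (Suc 0)"
  using rel_header[of I K \<rho> \<tau> M 1] by simp

lemma rel_reg: "rel I K \<rho> \<tau> M \<Longrightarrow> M (addr (I (Suc 0)) 0 r 0 0) = \<rho> r"
  by (simp add: rel_def)

lemma rel_arr: "rel I K \<rho> \<tau> M \<Longrightarrow> M (addr (I (Suc 0)) (Suc j) a b c) = \<tau> j a b c"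
  by (simp add: rel_def)

lemma val_reg_exp: "rel I K \<rho> \<tau> M \<Longrightarrow> val (reg_exp r) M = addr (I 1) 0 r 0 0"
  by (simp add: reg_exp_def val_addr_exp rel_one)

lemma val_cx:
  assumes R: "rel I K \<rho> \<tau> M"
  shows "well e \<Longrightarrow> (edges e \<Longrightarrow> \<rho> 3 < I 1) \<Longrightarrow> val (cx e) M = ev I \<rho> \<tau> e"
proof (induction e)
  case (Cell c)
  then show ?case using rel_header[OF R, of c] by simp
next
  case EU
  then show ?case using rel_header[OF R, of "6 + 2 * \<rho> 3"] by (simp add: val_reg_exp[OF R] rel_reg[OF R])
next
  case EV
  then show ?case using rel_header[OF R, of "7 + 2 * \<rho> 3"] by (simp add: val_reg_exp[OF R] rel_reg[OF R])
next
  case (Reg r)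
  then show ?case by (simp add: val_reg_exp[OF R] rel_reg[OF R])
next
  case (Arr j a b c)
  then show ?case by (simp add: val_addr_exp rel_one[OF R] rel_arr[OF R])
qed (auto simp: min_def)

lemma rel_bounds:
  assumes R: "rel I K \<rho> \<tau> M"
  shows "a < 2 * I 1 + 6 \<Longrightarrow> I a \<le> K" "\<rho> r \<le> K" "\<tau> j i1 i2 i3 \<le> K"
proof -
  have M: "M x \<le> K" for x using R by (simp add: rel_def)
  show "a < 2 * I 1 + 6 \<Longrightarrow> I a \<le> K" using M[of a] rel_header[OF R, of a] by simp
  show "\<rho> r \<le> K" using M[of "addr (I (Suc 0)) 0 r 0 0"] by (simp add: rel_reg[OF R])
  show "\<tau> j i1 i2 i3 \<le> K" using M[of "addr (I (Suc 0)) (Suc j) i1 i2 i3"] by (simp add: rel_arr[OF R])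
qed

lemma small_le:
  assumes R: "rel I K \<rho> \<tau> M"
  shows "small e \<Longrightarrow> well e \<Longrightarrow> (edges e \<Longrightarrow> \<rho> 3 < I 1) \<Longrightarrow> ev I \<rho> \<tau> e \<le> K"
proof (induction e rule: small.induct)
  case (1 c)
  then show ?case using R by (auto simp: rel_def)
next
  case (2 c d)
  then have "I c + 2 \<le> K" using R by (auto simp: rel_def)
  then show ?case using 2 by auto
next
  case (5 a b)
  have mult: "x * y \<le> k" if "x \<le> 1" "y \<le> k" for x y k :: nat
    using mult_le_mono[OF that] by simp
  have mult': "x * y \<le> k" if "x \<le> k" "y \<le> 1" for x y k :: nat
    using mult_le_mono[OF that] by simp
  from 5 show ?case by (auto simp del: One_nat_def intro: mult mult' is01_le)
qed (use rel_bounds[OF R] in \<open>auto simp: min_le_iff_disj intro: le_trans[OF diff_le_self]\<close>)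

text \<open>Loop bounds and start values depend only on the unchanging input, so they are fixed
  while a loop runs and their degrees in \<open>n\<close> and \<open>m\<close> can be read
  off.\<close>

datatype cex = CC nat | CL nat nat

fun cexv :: "memory \<Rightarrow> cex \<Rightarrow> nat" where
  "cexv I (CC c) = c"
| "cexv I (CL c d) = I c + d"

fun cex_ex :: "cex \<Rightarrow> ex" where
  "cex_ex (CC c) = Cn c"
| "cex_ex (CL c d) = Ad (Cell c) (Cn d)"

fun cex_ok :: "cex \<Rightarrow> bool" where
  "cex_ok (CC c) = (c \<le> 2)"
| "cex_ok (CL c d) = (c < 6 \<and> d \<le> 2)"

lemma cex_props: "cex_ok b \<Longrightarrow> small (cex_ex b) \<and> well (cex_ex b) \<and> \<not> edges (cex_ex b)"
  by (cases b) auto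

lemma ev_cex: "ev I \<rho> \<tau> (cex_ex b) = cexv I b"
  by (cases b) auto

lemma val_cex: "rel I K \<rho> \<tau> M \<Longrightarrow> cex_ok b \<Longrightarrow> val (cx (cex_ex b)) M = cexv I b"
  using val_cx[of I K \<rho> \<tau> M "cex_ex b"] cex_props[of b] by (simp add: ev_cex)

lemma cex_le: "rel I K \<rho> \<tau> M \<Longrightarrow> cex_ok b \<Longrightarrow> cexv I b \<le> K"
  using small_le[of I K \<rho> \<tau> M "cex_ex b"] cex_props[of b] by (simp add: ev_cex)

definition upd :: "arrays \<Rightarrow> nat \<Rightarrow> nat \<Rightarrow> nat \<Rightarrow> nat \<Rightarrow> nat \<Rightarrow> arrays" where
  "upd \<tau> j a b c x = (\<lambda>j' a' b' c'. if j' = j \<and> a' = a \<and> b' = b \<and> c' = c then x else \<tau> j' a' b' c')"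

lemma rel_set_reg:
  assumes "rel I K \<rho> \<tau> M" "x \<le> K"
  shows "rel I K (\<rho>(r := x)) \<tau> (M(addr (I 1) 0 r 0 0 := x))"
  using assms by (auto simp: rel_def addr_ge)

lemma rel_set_arr:
  assumes "rel I K \<rho> \<tau> M" "x \<le> K"
  shows "rel I K \<rho> (upd \<tau> j a b c x) (M(addr (I 1) (Suc j) a b c := x))"
  using assms by (auto simp: rel_def addr_ge upd_def)

definition for_prog :: "nat \<Rightarrow> cex \<Rightarrow> prog \<Rightarrow> prog" where
  "for_prog r b P = Seq (Assign (reg_exp r) (Const 0))
     (While (Minus (cx (cex_ex b)) (Mem (reg_exp r)))
       (Seq P (Assign (reg_exp r) (Plus (Mem (reg_exp r)) (Const 1)))))"

definition for_cost :: "nat \<Rightarrow> cex \<Rightarrow> nat" where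
  "for_cost r b = (cost (reg_exp r) + cost (Const 0) + 1) + (cost (Minus (cx (cex_ex b)) (Mem (reg_exp r))) + 1)
     + (cost (reg_exp r) + cost (Plus (Mem (reg_exp r)) (Const 1)) + 1)"

lemma rel_fits:
  assumes "rel I K \<rho> \<tau> M" "K ^ N \<le> W" "expo e \<le> N"
  shows "fits W e M"
proof -
  have K: "2 \<le> K" "\<And>a. M a \<le> K" using assms(1) by (auto simp: rel_def)
  have "K ^ expo e \<le> K ^ N" using K(1) assms(3) by (intro power_increasing) auto
  then show ?thesis using assms(2) by (intro fits_if_bounded[OF K]) simp
qed

text \<open>The body may use other registers but must return with the counter unchanged. The factor
  \<open>cexv I b + 1\<close> also pays for the initialization and the final test.\<close>

lemma runs_for:
  assumes W: "K ^ N \<le> W" "prog_expo (for_prog r b P) \<le> N" and b: "cex_ok b"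
    and R: "rel I K \<rho> \<tau> M" and init: "Inv 0 (\<rho>(r := 0)) \<tau>"
    and step: "\<And>i \<rho> \<tau> M. i < cexv I b \<Longrightarrow> rel I K \<rho> \<tau> M \<Longrightarrow> \<rho> r = i \<Longrightarrow> Inv i \<rho> \<tau> \<Longrightarrow>
      runs W P M t (\<lambda>M'. \<exists>\<rho>' \<tau>'. rel I K \<rho>' \<tau>' M' \<and> \<rho>' r = i \<and> Inv (Suc i) (\<rho>'(r := Suc i)) \<tau>')"
  shows "runs W (for_prog r b P) M ((for_cost r b + t) * (cexv I b + 1))
    (\<lambda>M'. \<exists>\<rho>' \<tau>'. rel I K \<rho>' \<tau>' M' \<and> Inv (cexv I b) \<rho>' \<tau>')"
proof -
  define B where "B = cexv I b"
  define J where "J i M' \<longleftrightarrow> (\<exists>\<rho>' \<tau>'. rel I K \<rho>' \<tau>' M' \<and> \<rho>' r = i \<and> Inv i \<rho>' \<tau>')" for i M'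
  let ?e = "Minus (cx (cex_ex b)) (Mem (reg_exp r))"
  let ?inc = "Assign (reg_exp r) (Plus (Mem (reg_exp r)) (Const 1))"
  let ?c = "cost (reg_exp r) + cost (Plus (Mem (reg_exp r)) (Const 1)) + 1"
  have expo: "expo (reg_exp r) \<le> N" "expo (Const 0) \<le> N" "expo ?e \<le> N" "expo (Plus (Mem (reg_exp r)) (Const 1)) \<le> N"
    using W(2) by (auto simp: for_prog_def)
  have first: "runs W (Assign (reg_exp r) (Const 0)) M (cost (reg_exp r) + cost (Const 0) + 1) (J 0)"
  proof (rule runs_assign)
    show "fits W (reg_exp r) M" "fits W (Const 0) M" using rel_fits[OF R W(1)] expo by auto
    show "J 0 (M(val (reg_exp r) M := val (Const 0) M))"
      unfolding J_def using rel_set_reg[OF R, of 0 r] init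
      by (intro exI[of _ "\<rho>(r := 0)"] exI[of _ \<tau>]) (simp add: val_reg_exp[OF R])
  qed
  have loop: "runs W (While ?e (Seq P ?inc)) M' ((cost ?e + 1 + (t + ?c)) * (B - 0) + (cost ?e + 1)) (J B)" if "J 0 M'" for M'
  proof (rule runs_while)
    fix i M1 assume i: "i < B" and "J i M1"
    then obtain \<rho>1 \<tau>1 where 1: "rel I K \<rho>1 \<tau>1 M1" "\<rho>1 r = i" "Inv i \<rho>1 \<tau>1" by (auto simp: J_def)
    show "runs W (Seq P ?inc) M1 (t + ?c) (J (Suc i))"
    proof (rule runs_seq)
      show "runs W P M1 t (\<lambda>M'. \<exists>\<rho>' \<tau>'. rel I K \<rho>' \<tau>' M' \<and> \<rho>' r = i \<and> Inv (Suc i) (\<rho>'(r := Suc i)) \<tau>')"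
        using step[OF _ 1(1,2,3)] i by (simp add: B_def)
      fix M2 assume "\<exists>\<rho>' \<tau>'. rel I K \<rho>' \<tau>' M2 \<and> \<rho>' r = i \<and> Inv (Suc i) (\<rho>'(r := Suc i)) \<tau>'"
      then obtain \<rho>2 \<tau>2 where 2: "rel I K \<rho>2 \<tau>2 M2" "\<rho>2 r = i" "Inv (Suc i) (\<rho>2(r := Suc i)) \<tau>2" by blast
      have "Suc i \<le> K" using i cex_le[OF R b] by (simp add: B_def)
      then have "rel I K (\<rho>2(r := Suc i)) \<tau>2 (M2(addr (I 1) 0 r 0 0 := Suc i))" by (rule rel_set_reg[OF 2(1)])
      then have "J (Suc i) (M2(addr (I 1) 0 r 0 0 := Suc i))" using 2(3) unfolding J_def by (meson fun_upd_same)
      moreover have "val (Plus (Mem (reg_exp r)) (Const 1)) M2 = Suc i"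
        using 2(2) by (simp add: val_reg_exp[OF 2(1)] rel_reg[OF 2(1)])
      ultimately show "runs W ?inc M2 ?c (J (Suc i))"
        using rel_fits[OF 2(1) W(1)] expo by (intro runs_assign) (simp_all only: val_reg_exp[OF 2(1)])
    qed
  next
    fix i M1 assume i: "i \<le> B" and "J i M1"
    then obtain \<rho>1 \<tau>1 where 1: "rel I K \<rho>1 \<tau>1 M1" "\<rho>1 r = i" by (auto simp: J_def)
    have "val ?e M1 = B - i" using 1(2) by (simp add: val_reg_exp[OF 1(1)] rel_reg[OF 1(1)] val_cex[OF 1(1) b] B_def)
    then have "val ?e M1 \<noteq> 0 \<longleftrightarrow> i < B" by (simp only: neq0_conv zero_less_diff)
    then show "fits W ?e M1 \<and> (val ?e M1 \<noteq> 0 \<longleftrightarrow> i < B)" using rel_fits[OF 1(1) W(1) expo(3)] by blast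
  qed (use that in auto)
  have "runs W (for_prog r b P) M ((cost (reg_exp r) + cost (Const 0) + 1) + ((cost ?e + 1 + (t + ?c)) * (B - 0) + (cost ?e + 1))) (J B)"
    unfolding for_prog_def by (rule runs_seq[OF first loop])
  then show ?thesis
  proof (rule runs_mono)
    show "(cost (reg_exp r) + cost (Const 0) + 1) + ((cost ?e + 1 + (t + ?c)) * (B - 0) + (cost ?e + 1)) \<le> (for_cost r b + t) * (cexv I b + 1)"
      unfolding for_cost_def B_def[symmetric] by (simp add: algebra_simps)
    show "\<exists>\<rho>' \<tau>'. rel I K \<rho>' \<tau>' M' \<and> Inv (cexv I b) \<rho>' \<tau>'" if "J B M'" for M'
      using that by (auto simp: J_def B_def)
  qed
qed

text \<open>A stage \<open>Stage T b1 b2 b3 b4 v e\<close> computes, for all indices below \<open>b1\<close>, \<open>b2\<close>, \<open>b3\<close>, the entry of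
  array \<open>T\<close> by iterating \<open>e\<close> for \<open>b4\<close> rounds on an accumulator with initial value \<open>v\<close>.\<close>

datatype stage = Stage nat cex cex cex cex cex ex

section \<open>Semantics, compilation and cost of a stage\<close>

definition regs :: "nat \<Rightarrow> nat \<Rightarrow> nat \<Rightarrow> nat \<Rightarrow> nat \<Rightarrow> nat \<Rightarrow> nat" where
  "regs i1 i2 i3 w a = (\<lambda>r. 0)(0 := i1, 1 := i2, 2 := i3, 3 := w, 4 := a)"

lemma ev_cong: "well e \<Longrightarrow> (\<And>r. r < 5 \<Longrightarrow> \<rho> r = \<rho>' r) \<Longrightarrow> ev I \<rho> \<tau> e = ev I \<rho>' \<tau> e"
  by (induction e) auto

fun accu :: "memory \<Rightarrow> nat \<Rightarrow> ex \<Rightarrow> arrays \<Rightarrow> nat \<Rightarrow> nat \<Rightarrow> nat \<Rightarrow> nat \<Rightarrow> nat" where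
  "accu I v e \<tau> i1 i2 i3 0 = v"
| "accu I v e \<tau> i1 i2 i3 (Suc w) = ev I (regs i1 i2 i3 w (accu I v e \<tau> i1 i2 i3 w)) \<tau> e"

fun loop :: "nat \<Rightarrow> (nat \<Rightarrow> 'a \<Rightarrow> 'a) \<Rightarrow> 'a \<Rightarrow> 'a" where
  "loop 0 f x = x"
| "loop (Suc k) f x = f k (loop k f x)"

fun stage_sem :: "memory \<Rightarrow> stage \<Rightarrow> arrays \<Rightarrow> arrays" where
  "stage_sem I (Stage T b1 b2 b3 b4 v e) \<tau> =
    loop (cexv I b1) (\<lambda>i1. loop (cexv I b2) (\<lambda>i2. loop (cexv I b3) (\<lambda>i3 \<tau>.
      upd \<tau> T i1 i2 i3 (accu I (cexv I v) e \<tau> i1 i2 i3 (cexv I b4))))) \<tau>"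

fun stage_prog :: "stage \<Rightarrow> prog" where
  "stage_prog (Stage T b1 b2 b3 b4 v e) =
    for_prog 0 b1 (for_prog 1 b2 (for_prog 2 b3
      (Seq (Assign (reg_exp 4) (cx (cex_ex v)))
      (Seq (for_prog 3 b4 (Assign (reg_exp 4) (cx e)))
        (Assign (addr_exp (Suc T) (Mem (reg_exp 0)) (Mem (reg_exp 1)) (Mem (reg_exp 2))) (Mem (reg_exp 4)))))))"

fun stage_ok :: "stage \<Rightarrow> bool" where
  "stage_ok (Stage T b1 b2 b3 b4 v e) \<longleftrightarrow> cex_ok b1 \<and> cex_ok b2 \<and> cex_ok b3 \<and> cex_ok b4 \<and> cex_ok v \<and>
     small e \<and> well e \<and> (edges e \<longrightarrow> b4 = CL 1 0)"

fun stage_cost :: "stage \<Rightarrow> nat" where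
  "stage_cost (Stage T b1 b2 b3 b4 v e) = for_cost 0 b1 + for_cost 1 b2 + for_cost 2 b3
     + (cost (reg_exp 4) + cost (cx (cex_ex v)) + 1) + for_cost 3 b4 + (cost (reg_exp 4) + cost (cx e) + 1)
     + (cost (addr_exp (Suc T) (Mem (reg_exp 0)) (Mem (reg_exp 1)) (Mem (reg_exp 2))) + cost (Mem (reg_exp 4)) + 1)"

fun stage_size :: "memory \<Rightarrow> stage \<Rightarrow> nat" where
  "stage_size I (Stage T b1 b2 b3 b4 v e) = (cexv I b1 + 1) * (cexv I b2 + 1) * (cexv I b3 + 1) * (cexv I b4 + 1)"

lemma prog_expo_for: "prog_expo P \<le> prog_expo (for_prog r b P)"
  by (simp add: for_prog_def)

lemma runs_inner:
  assumes ok: "stage_ok (Stage T b1 b2 b3 b4 v e)" and W: "K ^ N \<le> W" "prog_expo (stage_prog (Stage T b1 b2 b3 b4 v e)) \<le> N"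
    and R: "rel I K \<rho> \<tau> M"
  defines "c1 \<equiv> cost (reg_exp 4) + cost (cx (cex_ex v)) + 1" and "c2 \<equiv> cost (reg_exp 4) + cost (cx e) + 1"
    and "c3 \<equiv> cost (addr_exp (Suc T) (Mem (reg_exp 0)) (Mem (reg_exp 1)) (Mem (reg_exp 2))) + cost (Mem (reg_exp 4)) + 1"
  shows "runs W (Seq (Assign (reg_exp 4) (cx (cex_ex v)))
      (Seq (for_prog 3 b4 (Assign (reg_exp 4) (cx e)))
        (Assign (addr_exp (Suc T) (Mem (reg_exp 0)) (Mem (reg_exp 1)) (Mem (reg_exp 2))) (Mem (reg_exp 4))))) M
    (c1 + ((for_cost 3 b4 + c2) * (cexv I b4 + 1) + c3))
    (\<lambda>M'. \<exists>\<rho>'. rel I K \<rho>' (upd \<tau> T (\<rho> 0) (\<rho> 1) (\<rho> 2) (accu I (cexv I v) e \<tau> (\<rho> 0) (\<rho> 1) (\<rho> 2) (cexv I b4))) M' \<and> (\<forall>r<3. \<rho>' r = \<rho> r))"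
    (is "runs W (Seq ?A (Seq ?F ?S)) M _ _")
proof -
  let ?acc = "accu I (cexv I v) e \<tau> (\<rho> 0) (\<rho> 1) (\<rho> 2)"
  define Q where "Q w \<rho>' \<tau>' \<longleftrightarrow> \<tau>' = \<tau> \<and> (\<forall>r<3. \<rho>' r = \<rho> r) \<and> \<rho>' 4 = ?acc w" for w \<rho>' \<tau>'
  have oks: "cex_ok b4" "cex_ok v" "small e" "well e" and ed: "edges e \<Longrightarrow> b4 = CL 1 0" using ok by auto
  have "prog_expo (Seq ?A (Seq ?F ?S)) \<le> prog_expo (stage_prog (Stage T b1 b2 b3 b4 v e))"
    by (simp only: stage_prog.simps) (meson prog_expo_for le_trans)
  then have NF: "prog_expo ?F \<le> N" and N: "prog_expo ?A \<le> N" "prog_expo ?S \<le> N" using W(2) by auto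
  then have expo: "expo (reg_exp 4) \<le> N" "expo (cx (cex_ex v)) \<le> N" "expo (Mem (reg_exp 4)) \<le> N"
    "expo (addr_exp (Suc T) (Mem (reg_exp 0)) (Mem (reg_exp 1)) (Mem (reg_exp 2))) \<le> N" by auto
  have expo_e: "expo (cx e) \<le> N" using le_trans[OF prog_expo_for NF] by simp
  show ?thesis
  proof (rule runs_seq)
    show "runs W ?A M c1 (\<lambda>M'. \<exists>\<rho>'. rel I K \<rho>' \<tau> M' \<and> Q 0 \<rho>' \<tau>)"
      unfolding c1_def
    proof (rule runs_assign)
      show "fits W (reg_exp 4) M" "fits W (cx (cex_ex v)) M" using rel_fits[OF R W(1)] expo by auto
      show "\<exists>\<rho>'. rel I K \<rho>' \<tau> (M(val (reg_exp 4) M := val (cx (cex_ex v)) M)) \<and> Q 0 \<rho>' \<tau>"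
        using rel_set_reg[OF R cex_le[OF R oks(2)], of 4]
        by (intro exI[of _ "\<rho>(4 := cexv I v)"]) (simp add: val_reg_exp[OF R] val_cex[OF R oks(2)] Q_def)
    qed
    fix M1 assume "\<exists>\<rho>'. rel I K \<rho>' \<tau> M1 \<and> Q 0 \<rho>' \<tau>"
    then obtain \<rho>1 where 1: "rel I K \<rho>1 \<tau> M1" "Q 0 \<rho>1 \<tau>" by blast
    show "runs W (Seq ?F ?S) M1 ((for_cost 3 b4 + c2) * (cexv I b4 + 1) + c3)
      (\<lambda>M'. \<exists>\<rho>'. rel I K \<rho>' (upd \<tau> T (\<rho> 0) (\<rho> 1) (\<rho> 2) (?acc (cexv I b4))) M' \<and> (\<forall>r<3. \<rho>' r = \<rho> r))"
    proof (rule runs_seq)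
      show "runs W ?F M1 ((for_cost 3 b4 + c2) * (cexv I b4 + 1)) (\<lambda>M'. \<exists>\<rho>' \<tau>'. rel I K \<rho>' \<tau>' M' \<and> Q (cexv I b4) \<rho>' \<tau>')"
      proof (rule runs_for[where N = N and Inv = Q, OF W(1) NF oks(1) 1(1)])
        show "Q 0 (\<rho>1(3 := 0)) \<tau>" using 1(2) by (simp add: Q_def)
        fix i \<rho>2 \<tau>2 M2 assume i: "i < cexv I b4" and 2: "rel I K \<rho>2 \<tau>2 M2" "\<rho>2 3 = i" "Q i \<rho>2 \<tau>2"
        have tau: "\<tau>2 = \<tau>" and low: "\<And>r. r < 3 \<Longrightarrow> \<rho>2 r = \<rho> r" and acc: "\<rho>2 4 = ?acc i"
          using 2(3) by (simp_all add: Q_def)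
        have low': "\<rho>2 0 = \<rho> 0" "\<rho>2 1 = \<rho> 1" "\<rho>2 2 = \<rho> 2" by (simp_all add: low)
        have lt: "edges e \<Longrightarrow> \<rho>2 3 < I 1" using i 2(2) ed by auto
        have ev: "ev I \<rho>2 \<tau> e = ?acc (Suc i)"
        proof -
          have "\<rho>2 r = regs (\<rho> 0) (\<rho> 1) (\<rho> 2) i (?acc i) r" if "r < 5" for r
          proof -
            have "r = 0 \<or> r = 1 \<or> r = 2 \<or> r = 3 \<or> r = 4" using that by linarith
            then show ?thesis by (elim disjE) (simp_all add: regs_def low' acc 2(2) flip: One_nat_def)
          qed
          then show ?thesis unfolding accu.simps by (rule ev_cong[OF oks(4)])
        qed
        have v: "val (cx e) M2 = ?acc (Suc i)" using val_cx[OF 2(1) oks(4) lt] ev tau by simp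
        have le: "?acc (Suc i) \<le> K" using small_le[OF 2(1) oks(3,4) lt] ev tau by simp
        show "runs W (Assign (reg_exp 4) (cx e)) M2 c2
          (\<lambda>M'. \<exists>\<rho>' \<tau>'. rel I K \<rho>' \<tau>' M' \<and> \<rho>' 3 = i \<and> Q (Suc i) (\<rho>'(3 := Suc i)) \<tau>')"
          unfolding c2_def
        proof (rule runs_assign)
          show "fits W (reg_exp 4) M2" "fits W (cx e) M2" using rel_fits[OF 2(1) W(1)] expo expo_e by auto
          show "\<exists>\<rho>' \<tau>'. rel I K \<rho>' \<tau>' (M2(val (reg_exp 4) M2 := val (cx e) M2)) \<and> \<rho>' 3 = i \<and> Q (Suc i) (\<rho>'(3 := Suc i)) \<tau>'"
            using rel_set_reg[OF 2(1) le, of 4] 2(2) low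
            by (intro exI[of _ "\<rho>2(4 := ?acc (Suc i))"] exI[of _ \<tau>2])
              (simp add: val_reg_exp[OF 2(1)] v Q_def tau del: accu.simps)
        qed
      qed
      fix M3 assume "\<exists>\<rho>' \<tau>'. rel I K \<rho>' \<tau>' M3 \<and> Q (cexv I b4) \<rho>' \<tau>'"
      then obtain \<rho>3 where 3: "rel I K \<rho>3 \<tau> M3" "Q (cexv I b4) \<rho>3 \<tau>" by (auto simp: Q_def)
      then have low: "\<rho>3 0 = \<rho> 0" "\<rho>3 1 = \<rho> 1" "\<rho>3 2 = \<rho> 2" "\<rho>3 4 = ?acc (cexv I b4)" by (auto simp: Q_def)
      have le: "?acc (cexv I b4) \<le> K" using rel_bounds(2)[OF 3(1), of 4] low by simp
      show "runs W ?S M3 c3 (\<lambda>M'. \<exists>\<rho>'. rel I K \<rho>' (upd \<tau> T (\<rho> 0) (\<rho> 1) (\<rho> 2) (?acc (cexv I b4))) M' \<and> (\<forall>r<3. \<rho>' r = \<rho> r))"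
        unfolding c3_def
      proof (rule runs_assign)
        let ?a = "addr_exp (Suc T) (Mem (reg_exp 0)) (Mem (reg_exp 1)) (Mem (reg_exp 2))"
        show "fits W ?a M3" by (rule rel_fits[OF 3(1) W(1) expo(4)])
        show "fits W (Mem (reg_exp 4)) M3" by (rule rel_fits[OF 3(1) W(1) expo(3)])
        have "val ?a M3 = addr (I 1) (Suc T) (\<rho> 0) (\<rho> 1) (\<rho> 2)" "val (Mem (reg_exp 4)) M3 = ?acc (cexv I b4)"
          using low by (simp_all add: val_addr_exp rel_one[OF 3(1)] val_reg_exp[OF 3(1)] rel_reg[OF 3(1)])
        then show "\<exists>\<rho>'. rel I K \<rho>' (upd \<tau> T (\<rho> 0) (\<rho> 1) (\<rho> 2) (?acc (cexv I b4))) (M3(val ?a M3 := val (Mem (reg_exp 4)) M3)) \<and> (\<forall>r<3. \<rho>' r = \<rho> r)"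
          using rel_set_arr[OF 3(1) le, of T "\<rho> 0" "\<rho> 1" "\<rho> 2"] 3(2) by (intro exI[of _ \<rho>3]) (simp add: Q_def)
      qed
    qed
  qed
qed

lemma prog_expo_for_le: "prog_expo (for_prog r b P) \<le> N \<Longrightarrow> prog_expo P \<le> N"
  using prog_expo_for le_trans by blast

text \<open>Wrapping a loop adds its overhead to the constant and multiplies the size by
  \<open>B + 1\<close>, so a loop nest costs a constant times a product of bounds.\<close>

lemma nested_cost:
  fixes c t x B y :: nat
  assumes "t \<le> x * y" "1 \<le> y"
  shows "(c + t) * (B + 1) \<le> (c + x) * ((B + 1) * y)"
proof -
  have "c + t \<le> (c + x) * y" unfolding distrib_right using assms by (intro add_mono) simp_all
  then have "(c + t) * (B + 1) \<le> ((c + x) * y) * (B + 1)" by (rule mult_le_mono1)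
  then show ?thesis by (simp add: algebra_simps)
qed

lemma runs_stage:
  assumes ok: "stage_ok st" and W: "K ^ N \<le> W" "prog_expo (stage_prog st) \<le> N" and R: "rel I K \<rho> \<tau> M"
  shows "runs W (stage_prog st) M (stage_cost st * stage_size I st) (\<lambda>M'. \<exists>\<rho>'. rel I K \<rho>' (stage_sem I st \<tau>) M')"
proof (cases st)
  case (Stage T b1 b2 b3 b4 v e)
  note W' = W(2)[unfolded Stage]
  have b: "cex_ok b1" "cex_ok b2" "cex_ok b3" using ok Stage by auto
  define c1 where "c1 = cost (reg_exp 4) + cost (cx (cex_ex v)) + 1"
  define c2 where "c2 = cost (reg_exp 4) + cost (cx e) + 1"
  define c3 where "c3 = cost (addr_exp (Suc T) (Mem (reg_exp 0)) (Mem (reg_exp 1)) (Mem (reg_exp 2))) + cost (Mem (reg_exp 4)) + 1"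
  define B1 where "B1 = cexv I b1"
  define B2 where "B2 = cexv I b2"
  define B3 where "B3 = cexv I b3"
  define B4 where "B4 = cexv I b4"
  define f3 where "f3 i1 i2 i3 \<tau> = upd \<tau> T i1 i2 i3 (accu I (cexv I v) e \<tau> i1 i2 i3 B4)" for i1 i2 i3 \<tau>
  define f2 where "f2 i1 i2 = loop B3 (f3 i1 i2)" for i1 i2
  define f1 where "f1 i1 = loop B2 (f2 i1)" for i1
  have sem: "stage_sem I st \<tau> = loop B1 f1 \<tau>"
    unfolding Stage stage_sem.simps f1_def f2_def f3_def B1_def B2_def B3_def B4_def by simp
  define t3 where "t3 = c1 + ((for_cost 3 b4 + c2) * (B4 + 1) + c3)"
  define t2 where "t2 = (for_cost 2 b3 + t3) * (B3 + 1)"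
  define t1 where "t1 = (for_cost 1 b2 + t2) * (B2 + 1)"
  define P3 where "P3 = Seq (Assign (reg_exp 4) (cx (cex_ex v)))
      (Seq (for_prog 3 b4 (Assign (reg_exp 4) (cx e)))
        (Assign (addr_exp (Suc T) (Mem (reg_exp 0)) (Mem (reg_exp 1)) (Mem (reg_exp 2))) (Mem (reg_exp 4))))"
  have prog: "stage_prog st = for_prog 0 b1 (for_prog 1 b2 (for_prog 2 b3 P3))" by (simp add: Stage P3_def)
  have expo: "prog_expo (for_prog 0 b1 (for_prog 1 b2 (for_prog 2 b3 P3))) \<le> N"
    using W(2) unfolding prog .
  note expo1 = prog_expo_for_le[OF expo]
  note expo2 = prog_expo_for_le[OF expo1]
  have "runs W (stage_prog st) M ((for_cost 0 b1 + t1) * (B1 + 1))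
      (\<lambda>M'. \<exists>\<rho>' \<tau>'. rel I K \<rho>' \<tau>' M' \<and> \<tau>' = loop B1 f1 \<tau>)"
    unfolding prog B1_def
  proof (rule runs_for[where N = N and Inv = "\<lambda>i \<rho>' \<tau>'. \<tau>' = loop i f1 \<tau>", OF W(1) expo b(1) R])
    fix i1 \<rho>1 \<tau>1 M1 assume 1: "rel I K \<rho>1 \<tau>1 M1" "\<rho>1 0 = i1" "\<tau>1 = loop i1 f1 \<tau>"
    have "runs W (for_prog 1 b2 (for_prog 2 b3 P3)) M1 t1
      (\<lambda>M'. \<exists>\<rho>' \<tau>'. rel I K \<rho>' \<tau>' M' \<and> (\<rho>' 0 = i1 \<and> \<tau>' = loop B2 (f2 i1) \<tau>1))"
      unfolding t1_def B2_def
    proof (rule runs_for[where N = N and Inv = "\<lambda>i \<rho>' \<tau>'. \<rho>' 0 = i1 \<and> \<tau>' = loop i (f2 i1) \<tau>1", OF W(1) expo1 b(2) 1(1)])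
      fix i2 \<rho>2 \<tau>2 M2 assume 2: "rel I K \<rho>2 \<tau>2 M2" "\<rho>2 1 = i2" "\<rho>2 0 = i1 \<and> \<tau>2 = loop i2 (f2 i1) \<tau>1"
      have "runs W (for_prog 2 b3 P3) M2 t2
        (\<lambda>M'. \<exists>\<rho>' \<tau>'. rel I K \<rho>' \<tau>' M' \<and> (\<rho>' 0 = i1 \<and> \<rho>' 1 = i2 \<and> \<tau>' = loop B3 (f3 i1 i2) \<tau>2))"
        unfolding t2_def B3_def
      proof (rule runs_for[where N = N and Inv = "\<lambda>i \<rho>' \<tau>'. \<rho>' 0 = i1 \<and> \<rho>' 1 = i2 \<and> \<tau>' = loop i (f3 i1 i2) \<tau>2",
            OF W(1) expo2 b(3) 2(1)])
        fix i3 \<rho>3 \<tau>3 M3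
        assume 3: "rel I K \<rho>3 \<tau>3 M3" "\<rho>3 2 = i3" "\<rho>3 0 = i1 \<and> \<rho>3 1 = i2 \<and> \<tau>3 = loop i3 (f3 i1 i2) \<tau>2"
        from runs_inner[OF ok[unfolded Stage] W(1) W' 3(1)]
        have "runs W P3 M3 t3 (\<lambda>M'. \<exists>\<rho>'. rel I K \<rho>' (f3 i1 i2 i3 \<tau>3) M' \<and> (\<forall>r<3. \<rho>' r = \<rho>3 r))"
          using 3(2,3) unfolding P3_def t3_def c1_def c2_def c3_def f3_def B4_def by simp
        then show "runs W P3 M3 t3 (\<lambda>M'. \<exists>\<rho>' \<tau>'. rel I K \<rho>' \<tau>' M' \<and> \<rho>' 2 = i3 \<and>
            ((\<rho>'(2 := Suc i3)) 0 = i1 \<and> (\<rho>'(2 := Suc i3)) 1 = i2 \<and> \<tau>' = loop (Suc i3) (f3 i1 i2) \<tau>2))"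
        proof (rule runs_mono)
          fix M' assume "\<exists>\<rho>'. rel I K \<rho>' (f3 i1 i2 i3 \<tau>3) M' \<and> (\<forall>r<3. \<rho>' r = \<rho>3 r)"
          then obtain \<rho>' where r: "rel I K \<rho>' (f3 i1 i2 i3 \<tau>3) M'" "\<forall>r<3. \<rho>' r = \<rho>3 r" by blast
          have "\<rho>' 0 = i1" "\<rho>' 1 = i2" "\<rho>' 2 = i3" using r(2) 3(2,3) by simp_all
          then show "\<exists>\<rho>' \<tau>'. rel I K \<rho>' \<tau>' M' \<and> \<rho>' 2 = i3 \<and>
            ((\<rho>'(2 := Suc i3)) 0 = i1 \<and> (\<rho>'(2 := Suc i3)) 1 = i2 \<and> \<tau>' = loop (Suc i3) (f3 i1 i2) \<tau>2)"
            using r(1) 3(3) by (intro exI[of _ \<rho>'] exI[of _ "f3 i1 i2 i3 \<tau>3"]) simp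
        qed simp
      qed (use 2 in simp)
      then show "runs W (for_prog 2 b3 P3) M2 t2 (\<lambda>M'. \<exists>\<rho>' \<tau>'. rel I K \<rho>' \<tau>' M' \<and> \<rho>' 1 = i2 \<and>
          ((\<rho>'(1 := Suc i2)) 0 = i1 \<and> \<tau>' = loop (Suc i2) (f2 i1) \<tau>1))"
      proof (rule runs_mono)
        fix M' assume "\<exists>\<rho>' \<tau>'. rel I K \<rho>' \<tau>' M' \<and> (\<rho>' 0 = i1 \<and> \<rho>' 1 = i2 \<and> \<tau>' = loop B3 (f3 i1 i2) \<tau>2)"
        then obtain \<rho>' \<tau>' where "rel I K \<rho>' \<tau>' M'" "\<rho>' 0 = i1" "\<rho>' 1 = i2" "\<tau>' = loop B3 (f3 i1 i2) \<tau>2" by blast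
        then show "\<exists>\<rho>' \<tau>'. rel I K \<rho>' \<tau>' M' \<and> \<rho>' 1 = i2 \<and> ((\<rho>'(1 := Suc i2)) 0 = i1 \<and> \<tau>' = loop (Suc i2) (f2 i1) \<tau>1)"
          using 2(3) by (intro exI[of _ \<rho>'] exI[of _ \<tau>']) (simp add: f2_def)
      qed simp
    qed (use 1 in simp)
    then show "runs W (for_prog 1 b2 (for_prog 2 b3 P3)) M1 t1 (\<lambda>M'. \<exists>\<rho>' \<tau>'. rel I K \<rho>' \<tau>' M' \<and> \<rho>' 0 = i1 \<and> \<tau>' = loop (Suc i1) f1 \<tau>)"
      by (rule runs_mono) (use 1(3) in \<open>auto simp: f1_def\<close>)
  qed simp
  then show ?thesis
  proof (rule runs_mono)
    have t3: "t3 \<le> (c1 + (for_cost 3 b4 + c2) + c3) * (B4 + 1)"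
      unfolding t3_def by (simp add: algebra_simps)
    have t2: "t2 \<le> (for_cost 2 b3 + (c1 + (for_cost 3 b4 + c2) + c3)) * ((B3 + 1) * (B4 + 1))"
      unfolding t2_def by (rule nested_cost[OF t3]) simp
    have t1: "t1 \<le> (for_cost 1 b2 + (for_cost 2 b3 + (c1 + (for_cost 3 b4 + c2) + c3))) * ((B2 + 1) * ((B3 + 1) * (B4 + 1)))"
      unfolding t1_def by (rule nested_cost[OF t2]) simp
    have "(for_cost 0 b1 + t1) * (B1 + 1) \<le>
      (for_cost 0 b1 + (for_cost 1 b2 + (for_cost 2 b3 + (c1 + (for_cost 3 b4 + c2) + c3)))) * ((B1 + 1) * ((B2 + 1) * ((B3 + 1) * (B4 + 1))))"
      by (rule nested_cost[OF t1]) simp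
    then show "(for_cost 0 b1 + t1) * (B1 + 1) \<le> stage_cost st * stage_size I st"
      unfolding Stage stage_cost.simps stage_size.simps B1_def B2_def B3_def B4_def c1_def c2_def c3_def
      by (simp only: mult.assoc add.assoc)
  qed (auto simp: sem)
qed

section \<open>Lists of stages and their running time\<close>

fun prog_of :: "stage list \<Rightarrow> nat \<Rightarrow> prog" where
  "prog_of [] j = Assign (Const 0) (Mem (addr_exp (Suc j) (Const 0) (Const 0) (Const 0)))"
| "prog_of (st # sts) j = Seq (stage_prog st) (prog_of sts j)"

definition sem_of :: "memory \<Rightarrow> stage list \<Rightarrow> arrays \<Rightarrow> arrays" where
  "sem_of I sts \<tau> = fold (stage_sem I) sts \<tau>"

text \<open>Degrees of a loop bound in \<open>n\<close> and \<open>m\<close>. Total degrees of at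
  most 3 and 1 over the four loops of a stage are the syntactic form of the time bound.\<close>

fun factor_degree :: "cex \<Rightarrow> nat \<times> nat" where
  "factor_degree (CC c) = (0, 0)"
| "factor_degree (CL c d) = (if c = 0 then (1, 0) else (0, 1))"

fun stage_degree_ok :: "stage \<Rightarrow> bool" where
  "stage_degree_ok (Stage T b1 b2 b3 b4 v e) \<longleftrightarrow>
     fst (factor_degree b1) + fst (factor_degree b2) + fst (factor_degree b3) + fst (factor_degree b4) \<le> 3 \<and>
     snd (factor_degree b1) + snd (factor_degree b2) + snd (factor_degree b3) + snd (factor_degree b4) \<le> 1 \<and>
     (\<forall>b\<in>{b1, b2, b3, b4}. cex_ok b \<and> (case b of CL c d \<Rightarrow> c \<le> 1 | _ \<Rightarrow> True))"

text \<open>The 4 comes from \<open>x + 2 + 1 \<le> 4 * x\<close> for \<open>x \<ge> 1\<close>; four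
  such factors give 256 for a stage.\<close>

lemma factor_le:
  assumes "cex_ok b" "case b of CL c d \<Rightarrow> c \<le> 1 | _ \<Rightarrow> True" "1 \<le> I 0"
  shows "cexv I b + 1 \<le> 4 * (I 0 ^ fst (factor_degree b) * max 1 (I 1) ^ snd (factor_degree b))"
  using assms by (cases b) (auto simp: max_def le_Suc_eq)

lemma stage_size_le:
  assumes "stage_degree_ok st" "1 \<le> I 0"
  shows "stage_size I st \<le> 256 * (I 0 ^ 3 * max 1 (I 1))"
proof (cases st)
  case (Stage T b1 b2 b3 b4 v e)
  let ?n = "I 0" and ?m = "max 1 (I 1)"
  let ?x = "\<lambda>b. ?n ^ fst (factor_degree b) * ?m ^ snd (factor_degree b)"
  have f: "cexv I b + 1 \<le> 4 * ?x b" if "b \<in> {b1, b2, b3, b4}" for b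
    using assms that Stage by (intro factor_le) auto
  have "stage_size I st \<le> ((4 * ?x b1) * (4 * ?x b2)) * (4 * ?x b3) * (4 * ?x b4)"
    unfolding Stage stage_size.simps by (intro mult_le_mono f) simp_all
  also have "\<dots> = 256 * (?n ^ (fst (factor_degree b1) + fst (factor_degree b2) + fst (factor_degree b3) + fst (factor_degree b4)) *
      ?m ^ (snd (factor_degree b1) + snd (factor_degree b2) + snd (factor_degree b3) + snd (factor_degree b4)))"
    by (simp add: power_add mult.assoc mult.left_commute mult.commute)
  also have "\<dots> \<le> 256 * (?n ^ 3 * ?m ^ 1)"
    using assms Stage by (intro mult_le_mono power_increasing) auto
  finally show ?thesis by simp
qed

lemma runs_prog_of:
  assumes "\<forall>st\<in>set sts. stage_ok st \<and> stage_degree_ok st" "1 \<le> I 0"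
    and "K ^ N \<le> W" "prog_expo (prog_of sts j) \<le> N" and "rel I K \<rho> \<tau> M"
  shows "runs W (prog_of sts j) M
     (sum_list (map stage_cost sts) * (256 * (I 0 ^ 3 * max 1 (I 1))) + (cost (Mem (addr_exp (Suc j) (Const 0) (Const 0) (Const 0))) + 2))
     (\<lambda>M'. M' 0 = sem_of I sts \<tau> j 0 0 0)"
  using assms
proof (induction sts arbitrary: \<rho> \<tau> M)
  case Nil
  let ?e = "Mem (addr_exp (Suc j) (Const 0) (Const 0) (Const 0))"
  note R = Nil.prems(5)
  have "runs W (Assign (Const 0) ?e) M (cost (Const 0) + cost ?e + 1) (\<lambda>M'. M' 0 = sem_of I [] \<tau> j 0 0 0)"
  proof (rule runs_assign)
    show "fits W (Const 0) M" by simp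
    show "fits W ?e M" by (rule rel_fits[OF R Nil.prems(3)]) (use Nil.prems(4) in simp)
    show "(M(val (Const 0) M := val ?e M)) 0 = sem_of I [] \<tau> j 0 0 0"
      by (simp add: sem_of_def val_addr_exp rel_one[OF R] rel_arr[OF R])
  qed
  then show ?case by (simp only: prog_of.simps) (rule runs_mono, assumption, simp_all)
next
  case (Cons st sts)
  have st: "stage_ok st" "stage_degree_ok st" using Cons.prems(1) by auto
  have N: "prog_expo (stage_prog st) \<le> N" "prog_expo (prog_of sts j) \<le> N" using Cons.prems(4) by auto
  let ?S = "256 * (I 0 ^ 3 * max 1 (I 1))" and ?c = "cost (Mem (addr_exp (Suc j) (Const 0) (Const 0) (Const 0))) + 2"
  have "runs W (Seq (stage_prog st) (prog_of sts j)) M (stage_cost st * stage_size I st + (sum_list (map stage_cost sts) * ?S + ?c))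
     (\<lambda>M'. M' 0 = sem_of I (st # sts) \<tau> j 0 0 0)"
  proof (rule runs_seq[OF runs_stage[OF st(1) Cons.prems(3) N(1) Cons.prems(5)]])
    fix M' assume "\<exists>\<rho>'. rel I K \<rho>' (stage_sem I st \<tau>) M'"
    then obtain \<rho>' where R: "rel I K \<rho>' (stage_sem I st \<tau>) M'" by blast
    show "runs W (prog_of sts j) M' (sum_list (map stage_cost sts) * ?S + ?c) (\<lambda>M'. M' 0 = sem_of I (st # sts) \<tau> j 0 0 0)"
      using Cons.IH[OF _ Cons.prems(2,3) N(2) R] Cons.prems(1) by (simp add: sem_of_def)
  qed
  moreover have "stage_cost st * stage_size I st \<le> stage_cost st * ?S"
    by (rule mult_le_mono2[OF stage_size_le[where I = I, OF st(2) Cons.prems(2)]])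
  ultimately show ?case
    by (simp only: prog_of.simps) (rule runs_mono, assumption, simp add: distrib_right, assumption)
qed

section \<open>The program\<close>

lemma loop_invariant:
  assumes "P 0 x" "\<And>i y. i < k \<Longrightarrow> P i y \<Longrightarrow> P (Suc i) (f i y)"
  shows "P k (loop k f x)"
  using assms by (induction k) auto

lemma stage_sem_other:
  assumes "j \<noteq> T"
  shows "stage_sem I (Stage T b1 b2 b3 b4 v e) \<tau> j = \<tau> j"
proof -
  have loop: "loop k f \<tau>' j = \<tau>' j" if "\<And>i y. f i y j = y j" for k f and \<tau>' :: arrays
    by (induction k) (simp_all add: that)
  show ?thesis unfolding stage_sem.simps by (intro loop) (use assms in \<open>simp add: upd_def fun_eq_iff\<close>)
qed

text \<open>\<open>G\<close> may be recursive in its first index: the rows before \<open>i1\<close>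
  are complete when an entry of row \<open>i1\<close> is computed.\<close>

lemma stage_sem_target:
  assumes step: "\<And>\<tau>' i1 i2 i3. (\<And>j. j \<noteq> T \<Longrightarrow> \<tau>' j = \<tau> j) \<Longrightarrow> i1 < cexv I b1 \<Longrightarrow> i2 < cexv I b2 \<Longrightarrow> i3 < cexv I b3 \<Longrightarrow>
      (\<And>a b c. a < i1 \<Longrightarrow> b < cexv I b2 \<Longrightarrow> c < cexv I b3 \<Longrightarrow> \<tau>' T a b c = G a b c) \<Longrightarrow>
      accu I (cexv I v) e \<tau>' i1 i2 i3 (cexv I b4) = G i1 i2 i3"
    and bounds: "a < cexv I b1" "b < cexv I b2" "c < cexv I b3"
  shows "stage_sem I (Stage T b1 b2 b3 b4 v e) \<tau> T a b c = G a b c"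
proof -
  let ?B1 = "cexv I b1" and ?B2 = "cexv I b2" and ?B3 = "cexv I b3"
  define f3 where "f3 i1 i2 i3 \<tau> = upd \<tau> T i1 i2 i3 (accu I (cexv I v) e \<tau> i1 i2 i3 (cexv I b4))" for i1 i2 i3 \<tau>
  define f2 where "f2 i1 i2 = loop ?B3 (f3 i1 i2)" for i1 i2
  define f1 where "f1 i1 = loop ?B2 (f2 i1)" for i1
  define P1 where "P1 i \<tau>' \<longleftrightarrow> (\<forall>j. j \<noteq> T \<longrightarrow> \<tau>' j = \<tau> j) \<and> (\<forall>a<i. \<forall>b<?B2. \<forall>c<?B3. \<tau>' T a b c = G a b c)"
    for i and \<tau>' :: arrays
  have "P1 ?B1 (loop ?B1 f1 \<tau>)"
  proof (rule loop_invariant[where P = P1])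
    show "P1 0 \<tau>" by (simp add: P1_def)
    fix i1 \<tau>1 assume 1: "i1 < ?B1" "P1 i1 \<tau>1"
    define P2 where "P2 i \<tau>' \<longleftrightarrow> P1 i1 \<tau>' \<and> (\<forall>b<i. \<forall>c<?B3. \<tau>' T i1 b c = G i1 b c)" for i and \<tau>' :: arrays
    have "P2 ?B2 (loop ?B2 (f2 i1) \<tau>1)"
    proof (rule loop_invariant[where P = P2])
      show "P2 0 \<tau>1" using 1 by (simp add: P2_def)
      fix i2 \<tau>2 assume 2: "i2 < ?B2" "P2 i2 \<tau>2"
      define P3 where "P3 i \<tau>' \<longleftrightarrow> P2 i2 \<tau>' \<and> (\<forall>c<i. \<tau>' T i1 i2 c = G i1 i2 c)" for i and \<tau>' :: arrays
      have "P3 ?B3 (loop ?B3 (f3 i1 i2) \<tau>2)"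
      proof (rule loop_invariant[where P = P3])
        show "P3 0 \<tau>2" using 2 by (simp add: P3_def)
        fix i3 \<tau>3 assume 3: "i3 < ?B3" "P3 i3 \<tau>3"
        then have P: "P1 i1 \<tau>3" by (simp add: P3_def P2_def)
        have "accu I (cexv I v) e \<tau>3 i1 i2 i3 (cexv I b4) = G i1 i2 i3"
          by (rule step) (use P 1(1) 2(1) 3(1) in \<open>simp_all add: P1_def\<close>)
        then have f: "f3 i1 i2 i3 \<tau>3 = upd \<tau>3 T i1 i2 i3 (G i1 i2 i3)" by (simp add: f3_def)
        show "P3 (Suc i3) (f3 i1 i2 i3 \<tau>3)"
          unfolding f using 3(2) by (simp add: P3_def P2_def P1_def upd_def less_Suc_eq)
      qed
      then show "P2 (Suc i2) (f2 i1 i2 \<tau>2)" by (simp add: f2_def P3_def P2_def less_Suc_eq)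
    qed
    then show "P1 (Suc i1) (f1 i1 \<tau>1)" by (simp add: f1_def P2_def P1_def less_Suc_eq)
  qed
  moreover have "stage_sem I (Stage T b1 b2 b3 b4 v e) \<tau> = loop ?B1 f1 \<tau>"
    unfolding stage_sem.simps f1_def f2_def f3_def by simp
  ultimately show ?thesis using bounds by (simp add: P1_def)
qed

fun target :: "stage \<Rightarrow> nat" where
  "target (Stage T b1 b2 b3 b4 v e) = T"

lemma fold_other: "(\<And>st. st \<in> set sts \<Longrightarrow> target st \<noteq> j) \<Longrightarrow> fold (stage_sem I) sts \<tau> j = \<tau> j"
proof (induction sts arbitrary: \<tau>)
  case (Cons st sts)
  have "stage_sem I st \<tau> j = \<tau> j" using Cons.prems[of st] by (cases st) (simp add: stage_sem_other del: stage_sem.simps)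
  then show ?case using Cons.IH[of "stage_sem I st \<tau>"] Cons.prems by simp
qed simp

text \<open>Each stage writes only the array numbered by its place in the list. So stage
  \<open>k\<close> already reads the lower arrays in their final state, and its own array survives
  the later stages.\<close>

lemma sem_of_nth:
  assumes sts: "\<And>i. i < length sts \<Longrightarrow> target (sts ! i) = i" and k: "k < length sts"
    and st: "sts ! k = Stage k b1 b2 b3 b4 v e"
    and step: "\<And>\<tau>' i1 i2 i3. (\<And>j. j < k \<Longrightarrow> \<tau>' j = sem_of I sts \<tau> j) \<Longrightarrow>
      i1 < cexv I b1 \<Longrightarrow> i2 < cexv I b2 \<Longrightarrow> i3 < cexv I b3 \<Longrightarrow>
      (\<And>a b c. a < i1 \<Longrightarrow> b < cexv I b2 \<Longrightarrow> c < cexv I b3 \<Longrightarrow> \<tau>' k a b c = G a b c) \<Longrightarrow>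
      accu I (cexv I v) e \<tau>' i1 i2 i3 (cexv I b4) = G i1 i2 i3"
    and bounds: "a < cexv I b1" "b < cexv I b2" "c < cexv I b3"
  shows "sem_of I sts \<tau> k a b c = G a b c"
proof -
  define \<tau>k where "\<tau>k = fold (stage_sem I) (take k sts) \<tau>"
  have "sts = take k sts @ sts ! k # drop (Suc k) sts" using k by (rule id_take_nth_drop)
  then have F: "sem_of I sts \<tau> = fold (stage_sem I) (drop (Suc k) sts) (stage_sem I (sts ! k) \<tau>k)"
    unfolding sem_of_def \<tau>k_def by (metis comp_apply fold_append fold_simps(2))
  have later: "sem_of I sts \<tau> j = stage_sem I (sts ! k) \<tau>k j" if "j \<le> k" for j
    unfolding F
  proof (rule fold_other)
    fix x assume "x \<in> set (drop (Suc k) sts)"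
    then obtain i where "i < length sts - Suc k" "x = sts ! (Suc k + i)" by (auto simp: in_set_conv_nth)
    then show "target x \<noteq> j" using sts[of "Suc k + i"] that by simp
  qed
  have earlier: "sem_of I sts \<tau> j = \<tau>k j" if "j < k" for j
    using later[of j] that st stage_sem_other[of j k] by simp
  have "stage_sem I (Stage k b1 b2 b3 b4 v e) \<tau>k k a b c = G a b c"
  proof (rule stage_sem_target[OF _ bounds])
    fix \<tau>' i1 i2 i3
    assume a: "\<And>j. j \<noteq> k \<Longrightarrow> \<tau>' j = \<tau>k j" "i1 < cexv I b1" "i2 < cexv I b2" "i3 < cexv I b3"
      "\<And>a b c. a < i1 \<Longrightarrow> b < cexv I b2 \<Longrightarrow> c < cexv I b3 \<Longrightarrow> \<tau>' k a b c = G a b c"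
    have "\<tau>' j = sem_of I sts \<tau> j" if "j < k" for j using a(1)[of j] earlier[OF that] that by simp
    from step[OF this a(2-5)] show "accu I (cexv I v) e \<tau>' i1 i2 i3 (cexv I b4) = G i1 i2 i3" .
  qed
  then show ?thesis using later[of k] st by simp
qed

lemma regs_simps [simp]:
  "regs a b c w x 0 = a" "regs a b c w x (Suc 0) = b" "regs a b c w x 2 = c" "regs a b c w x 3 = w" "regs a b c w x 4 = x"
  by (simp_all add: regs_def)

text \<open>Capping after every addition equals capping the total, so the accumulator never grows
  beyond the cap.\<close>

lemma accu_sum:
  assumes "\<And>x a. x < w \<Longrightarrow> ev I (regs i1 i2 i3 x a) \<tau> f = F x" "\<And>x a. ev I (regs i1 i2 i3 x a) \<tau> cap = c"
  shows "accu I 0 (Mn (Ad (Reg 4) f) cap) \<tau> i1 i2 i3 w = min (\<Sum>x<w. F x) c"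
  using assms(1) by (induction w) (auto simp: assms(2))

text \<open>Only the minimum with some \<open>a \<le> B\<close> has to be right, so \<open>f\<close>
  may overshoot arbitrarily where \<open>F\<close> is at least \<open>B\<close>.\<close>

lemma accu_min:
  assumes "\<And>x a. x < w \<Longrightarrow> a \<le> B \<Longrightarrow> min a (ev I (regs i1 i2 i3 x a) \<tau> f) = min a (F x)"
  shows "accu I B (Mn (Reg 4) f) \<tau> i1 i2 i3 w = min_upto B F w"
  using assms
proof (induction w)
  case (Suc w)
  then show ?case using min_upto_le[of B F w] by simp
qed simp

section \<open>Truth values and capped sums in table expressions\<close>

definition eLt :: "ex \<Rightarrow> ex \<Rightarrow> ex" where "eLt a b = Sb (Cn 1) (Sb (Cn 1) (Sb b a))"
definition eLe :: "ex \<Rightarrow> ex \<Rightarrow> ex" where "eLe a b = Sb (Cn 1) (Sb a b)"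
definition eEq :: "ex \<Rightarrow> ex \<Rightarrow> ex" where "eEq a b = Ml (eLe a b) (eLe b a)"
definition eNot :: "ex \<Rightarrow> ex" where "eNot a = Sb (Cn 1) a"
definition eOr :: "ex \<Rightarrow> ex \<Rightarrow> ex" where "eOr a b = Mn (Ad a b) (Cn 1)"

lemmas e_defs = eLt_def eLe_def eEq_def eNot_def eOr_def

lemma ev_bool [simp]:
  "ev I \<rho> \<tau> (eLt a b) = of_bool (ev I \<rho> \<tau> a < ev I \<rho> \<tau> b)"
  "ev I \<rho> \<tau> (eLe a b) = of_bool (ev I \<rho> \<tau> a \<le> ev I \<rho> \<tau> b)"
  "ev I \<rho> \<tau> (eEq a b) = of_bool (ev I \<rho> \<tau> a = ev I \<rho> \<tau> b)"
  "ev I \<rho> \<tau> (eNot a) = 1 - ev I \<rho> \<tau> a"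
  "ev I \<rho> \<tau> (eOr a b) = min (ev I \<rho> \<tau> a + ev I \<rho> \<tau> b) 1"
  by (auto simp: e_defs)

lemma bool_arith:
  "(1::nat) - of_bool P = of_bool (\<not> P)" "Suc 0 - of_bool P = of_bool (\<not> P)"
  "of_bool P * of_bool Q = (of_bool (P \<and> Q) :: nat)"
  "min (of_bool P + of_bool Q) (1::nat) = of_bool (P \<or> Q)"
  "min (of_bool P + of_bool Q) (Suc 0) = of_bool (P \<or> Q)"
  by auto

lemma sum_bool: "(\<Sum>x<(n::nat). of_bool (P x)) = card {x. x < n \<and> P x}"
proof (induction n)
  case (Suc n)
  have "{x. x < Suc n \<and> P x} = (if P n then insert n {x. x < n \<and> P x} else {x. x < n \<and> P x})"
    by (auto simp: less_Suc_eq)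
  then show ?case using Suc by simp
qed simp

lemma card_below_le: "card {x. x < (n::nat) \<and> P x} \<le> n"
  using card_mono[of "{..<n}" "{x. x < n \<and> P x}"] by auto

lemma min_sum_bool: "min (\<Sum>x<(n::nat). of_bool (P x)) n = card {x. x < n \<and> P x}"
  by (simp add: sum_bool card_below_le min_absorb1)

lemma min_sum_bool_ex: "min (\<Sum>x<(n::nat). of_bool (P x)) 1 = (of_bool (\<exists>x<n. P x) :: nat)"
proof (cases "\<exists>x<n. P x")
  case True
  then have "card {x. x < n \<and> P x} > 0" by (auto simp: card_gt_0_iff)
  then show ?thesis using True by (simp add: sum_bool)
next
  case False
  then have "{x. x < n \<and> P x} = {}" by auto
  then show ?thesis using False by (simp only: sum_bool card.empty) simp
qed

abbreviation "arr1 j a \<equiv> Arr j a (Cn 0) (Cn 0)"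
abbreviation "arr2 j a b \<equiv> Arr j a b (Cn 0)"
abbreviation "row \<equiv> Reg 0"
abbreviation "col \<equiv> Reg 1"
abbreviation "var \<equiv> Reg 3"
abbreviation "sum_up f cap \<equiv> Mn (Ad (Reg 4) f) cap"
abbreviation "size_n \<equiv> CL 0 0"

text \<open>The arrays are: 0 adjacency; 1 reachability from \<open>s\<close> within a number of rounds; 2 distance from \<open>s\<close>;
  3 degree; 4 number of vertices preferable as \<open>z\<close>; 5 the vertex \<open>z\<close>; 6, 7 like 1, 2 for \<open>z\<close>; 8, 9 number of
  neighbours on the next and the previous level; 10 rank in the ordering; 11 rank after moving the earlier
  of \<open>s\<close>, \<open>t\<close> to the front and the other one to the end; 12 number of edges spanning two thresholds;
  13 dynamic program; 14 answer.\<close>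

definition adj_ex :: ex where
  "adj_ex = eOr (Ml (eEq EU row) (eEq EV col)) (Ml (eEq EU col) (eEq EV row))"

text \<open>In row 0 the truncated \<open>row - 1\<close> is 0 again; the factor
  \<open>eLt (Cn 0) row\<close> cancels whatever is read there.\<close>

definition reach_ex :: "nat \<Rightarrow> ex \<Rightarrow> ex" where
  "reach_ex k src = eOr (Ml (eEq row (Cn 0)) (eEq col src))
     (Ml (eLt (Cn 0) row) (Ml (arr2 k (Sb row (Cn 1)) var) (eOr (arr2 0 var col) (eEq var col))))"

definition reach_stage :: "nat \<Rightarrow> ex \<Rightarrow> stage" where
  "reach_stage k src = Stage k size_n size_n (CC 1) size_n (CC 0) (sum_up (reach_ex k src) (Cn 1))"

definition dist_stage :: "nat \<Rightarrow> nat \<Rightarrow> stage" where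
  "dist_stage k j = Stage k size_n (CC 1) (CC 1) size_n (CC 0) (sum_up (eNot (arr2 j var row)) (Cell 0))"

text \<open>The first factor restricts \<open>var\<close> to the component of \<open>s\<close>, as
  vertices outside have distance \<open>n\<close>. Vertex numbers break ties, so that the best
  vertex is unique.\<close>

definition beats_ex :: ex where
  "beats_ex = Ml (eLt (arr1 2 var) (Cell 0))
     (eOr (eLt (arr1 2 row) (arr1 2 var)) (Ml (eEq (arr1 2 row) (arr1 2 var))
       (eOr (eLt (arr1 3 var) (arr1 3 row)) (Ml (eEq (arr1 3 var) (arr1 3 row)) (eLt var row)))))"

text \<open>Summed over \<open>var\<close>, at most one term is nonzero, namely at the unbeaten
  vertex of the component; the sum is therefore its number.\<close>

definition source_ex :: ex where
  "source_ex = Ml var (Ml (eLt (arr1 2 var) (Cell 0)) (eEq (arr1 4 var) (Cn 0)))"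

definition bef_ex :: ex where
  "bef_ex = eOr (eLt (arr1 7 var) (arr1 7 row)) (Ml (eEq (arr1 7 var) (arr1 7 row))
     (eOr (eLt (Ad (arr1 8 var) (arr1 9 row)) (Ad (arr1 8 row) (arr1 9 var)))
       (Ml (eEq (Ad (arr1 8 var) (arr1 9 row)) (Ad (arr1 8 row) (arr1 9 var))) (eLt var row))))"

text \<open>A position as a sum over \<open>var\<close>: the vertex moved to the end collects one
  unit for each \<open>var > 0\<close>, which makes \<open>n - 1\<close>; the one moved to the front
  collects nothing; any other vertex gets the leading 1 from \<open>var = 0\<close>.\<close>

definition position_ex :: ex where
  "position_ex = Ad
     (Ml (eOr (Ml (eEq row (Cell 2)) (eLt (arr1 10 (Cell 3)) (arr1 10 (Cell 2))))
              (Ml (eEq row (Cell 3)) (eLt (arr1 10 (Cell 2)) (arr1 10 (Cell 3)))))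
         (eLt (Cn 0) var))
     (Ml (Ml (eNot (eEq row (Cell 2))) (eNot (eEq row (Cell 3))))
         (Ad (eEq var (Cn 0))
             (Ml (Ml (eNot (eEq var (Cell 2))) (eNot (eEq var (Cell 3)))) (eLt (arr1 10 var) (arr1 10 row)))))"

text \<open>Being at most the larger end position is expressed by a disjunction, since only a
  minimum is available. Distance less than \<open>n\<close> tests membership in the component of
  \<open>z\<close>.\<close>

definition span_ex :: ex where
  "span_ex = Ml (eLt (arr1 7 EU) (Cell 0))
     (Ml (eLt (Mn (arr1 11 EU) (arr1 11 EV)) row) (eOr (eLe col (arr1 11 EU)) (eLe col (arr1 11 EV))))"

text \<open>Index triples are (level, preceding threshold, last threshold); a forbidden combination costs
  \<open>\<beta> + 1\<close>, which the minimum with the initial value \<open>\<beta> + 1\<close> neutralizes.\<close>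

definition dp_ex :: ex where
  "dp_ex = Ad
     (Ml (eEq row (Cn 0)) (Ml (Ad (Cell 4) (Cn 1)) (eNot (Ml (eEq col (Cn 0)) (eEq (Reg 2) (Cn 1))))))
     (Ml (eLt (Cn 0) row)
       (Ad (Ml (Ad (Cell 4) (Cn 1)) (eNot (Ml (eLe var col) (eLe col (Reg 2)))))
           (Ad (Arr 13 (Sb row (Cn 1)) var col) (Sb (arr2 12 col (Reg 2)) (arr2 12 var (Reg 2))))))"

text \<open>\<open>x + (1 - x)\<close> with truncated subtraction is \<open>max 1 x\<close>, so this
  is \<open>L\<close>.\<close>

definition level_ex :: ex where
  "level_ex = Ad (Mn (Cell 5) (Cell 1)) (Sb (Cn 1) (Mn (Cell 5) (Cell 1)))"

definition answer_ex :: ex where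
  "answer_ex = Ml (eNot (eEq (Cell 2) (Cell 3)))
     (eOr (eLe (Cell 0) (arr1 7 (Cell 3))) (eLe (Arr 13 level_ex var (Sb (Cell 0) (Cn 1))) (Cell 4)))"

text \<open>In stage 13 a loop bound cannot express \<open>L\<close> itself, so all levels up to
  \<open>m + 1\<close> are filled, which includes \<open>L \<le> max 1 m\<close>. Its loops over the
  level, two thresholds and the minimized one give \<open>n ^ 3 * m\<close>.\<close>

definition stages :: "stage list" where
  "stages =
    [Stage 0 size_n size_n (CC 1) (CL 1 0) (CC 0) (sum_up adj_ex (Cn 1)),
     reach_stage 1 (Cell 2),
     dist_stage 2 1,
     Stage 3 size_n (CC 1) (CC 1) size_n (CC 0) (sum_up (arr2 0 var row) (Cell 0)),
     Stage 4 size_n (CC 1) (CC 1) size_n (CC 0) (sum_up beats_ex (Cell 0)),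
     Stage 5 (CC 1) (CC 1) (CC 1) size_n (CC 0) (sum_up source_ex (Cell 0)),
     reach_stage 6 (arr1 5 (Cn 0)),
     dist_stage 7 6,
     Stage 8 size_n (CC 1) (CC 1) size_n (CC 0)
       (sum_up (Ml (arr2 0 var row) (eEq (arr1 7 var) (Ad (arr1 7 row) (Cn 1)))) (Cell 0)),
     Stage 9 size_n (CC 1) (CC 1) size_n (CC 0)
       (sum_up (Ml (arr2 0 var row) (eEq (Ad (arr1 7 var) (Cn 1)) (arr1 7 row))) (Cell 0)),
     Stage 10 size_n (CC 1) (CC 1) size_n (CC 0) (sum_up bef_ex (Cell 0)),
     Stage 11 size_n (CC 1) (CC 1) size_n (CC 0) (sum_up position_ex (Cell 0)),
     Stage 12 size_n size_n (CC 1) (CL 1 0) (CC 0) (sum_up span_ex (Cell 1)),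
     Stage 13 (CL 1 2) size_n size_n size_n (CL 4 1) (Mn (Reg 4) dp_ex),
     Stage 14 (CC 1) (CC 1) (CC 1) size_n (CC 0) (sum_up answer_ex (Cn 1))]"

lemmas ex_defs = adj_ex_def reach_ex_def beats_ex_def source_ex_def bef_ex_def position_ex_def span_ex_def
  dp_ex_def level_ex_def answer_ex_def reach_stage_def dist_stage_def

lemma length_stages: "length stages = 15"
  by (simp add: stages_def)

text \<open>These syntactic checks, settled by evaluation, are all that the time bound and the
  preservation of the cell bound ask of the concrete tables.\<close>

lemma stages_checked: "\<forall>st\<in>set stages. stage_ok st \<and> stage_degree_ok st"
  by (simp add: stages_def ex_defs e_defs)

lemma target_stages: "i < length stages \<Longrightarrow> target (stages ! i) = i"
proof -
  have "map target stages = [0..<15]" by (simp add: stages_def reach_stage_def dist_stage_def upt_rec)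
  then show "i < length stages \<Longrightarrow> target (stages ! i) = i" by (metis length_stages nth_map nth_upt add_0)
qed

section \<open>The tables computed for a fixed instance\<close>

locale cut_instance =
  fixes n :: nat and es :: "(nat \<times> nat) list" and s t \<beta> l :: nat
  assumes el: "edge_list n es" and pig: "proper_interval_graph {..<n} (edge_set es)"
    and sn: "s < n" and tn: "t < n" and l_pos: "0 < l"
begin

definition A :: "nat \<Rightarrow> nat \<Rightarrow> bool" where
  "A u v \<longleftrightarrow> {u, v} \<in> edge_set es"

definition I :: memory where
  "I = encode_input n es s t \<beta> l"

definition F :: arrays where
  "F = sem_of I stages (\<lambda>_ _ _ _. 0)"

definition m :: nat where
  "m = length es"

lemma I_header: "I 0 = n" "I (Suc 0) = m" "I 2 = s" "I 3 = t" "I 4 = \<beta>" "I 5 = l"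
  by (simp_all add: I_def encode_input_def Let_def m_def numeral_eq_Suc)

lemma nth_pairs:
  "i < length es \<Longrightarrow> concat (map (\<lambda>(u, v). [u, v]) es) ! (2 * i) = fst (es ! i)"
  "i < length es \<Longrightarrow> concat (map (\<lambda>(u, v). [u, v]) es) ! Suc (2 * i) = snd (es ! i)"
proof (induction es arbitrary: i)
  case (Cons e es)
  { case 1
    then show ?case using Cons.IH(1)[of "i - 1"] by (cases i; cases e) auto }
  { case 2
    then show ?case using Cons.IH(2)[of "i - 1"] by (cases i; cases e) auto }
qed auto

lemma length_pairs: "length (concat (map (\<lambda>(u, v). [u, v]) es)) = 2 * length es"
  by (induction es) auto

lemma I_edges:
  assumes "i < m"
  shows "I (6 + 2 * i) = fst (es ! i)" "I (7 + 2 * i) = snd (es ! i)"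
proof -
  have shift: "I (6 + x) = concat (map (\<lambda>(u, v). [u, v]) es) ! x" if "x < 2 * m" for x
    using that by (simp add: I_def encode_input_def Let_def length_pairs m_def numeral_eq_Suc)
  show "I (6 + 2 * i) = fst (es ! i)" using shift[of "2 * i"] nth_pairs(1) assms by (simp add: m_def)
  have "I (6 + Suc (2 * i)) = snd (es ! i)" using shift[of "Suc (2 * i)"] nth_pairs(2) assms by (simp add: m_def)
  then show "I (7 + 2 * i) = snd (es ! i)" by simp
qed

lemma edge_bounds: "i < m \<Longrightarrow> fst (es ! i) < n \<and> snd (es ! i) < n \<and> fst (es ! i) \<noteq> snd (es ! i)"
  using el nth_mem[of i es] unfolding edge_list_def m_def by fastforce

lemma simple: "simple_graph {..<n} (edge_set es)"
  using pig by (simp add: proper_interval_graph_def)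

sublocale sgraph n A
proof
  show "u < n \<and> v < n" if "A u v" for u v
    using that simple unfolding A_def simple_graph_def by (auto simp: doubleton_eq_iff)
  show "A v u" if "A u v" for u v using that by (simp add: A_def insert_commute)
  show "\<not> A u u" for u using simple unfolding A_def simple_graph_def by (auto simp: doubleton_eq_iff)
qed

lemma A_iff: "A u v \<longleftrightarrow> (\<exists>i<m. fst (es ! i) = u \<and> snd (es ! i) = v \<or> fst (es ! i) = v \<and> snd (es ! i) = u)"
proof -
  have "A u v \<longleftrightarrow> (\<exists>e\<in>set es. {u, v} = {fst e, snd e})"
    unfolding A_def edge_set_def image_iff by (simp only: case_prod_beta)
  also have "\<dots> \<longleftrightarrow> (\<exists>i<m. {u, v} = {fst (es ! i), snd (es ! i)})"
    unfolding set_conv_nth m_def by blast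
  also have "\<dots> \<longleftrightarrow> (\<exists>i<m. {fst (es ! i), snd (es ! i)} = {u, v})" by (simp only: eq_commute)
  finally show ?thesis by (simp add: doubleton_eq_iff)
qed

text \<open>The edges are distinct as sets, so sums over list indices count edges.\<close>

lemma edge_bij: "bij_betw (\<lambda>i. {fst (es ! i), snd (es ! i)}) {..<m} (edge_set es)"
proof -
  have d: "distinct (map (\<lambda>(u, v). {u, v}) es)" using el by (simp add: edge_list_def)
  have "bij_betw (\<lambda>i. map (\<lambda>(u, v). {u, v}) es ! i) {..<length (map (\<lambda>(u, v). {u, v}) es)} (set (map (\<lambda>(u, v). {u, v}) es))"
    by (rule bij_betw_nth[OF d refl refl])
  moreover have "set (map (\<lambda>(u, v). {u, v}) es) = edge_set es" by (simp add: edge_set_def)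
  moreover have "bij_betw (\<lambda>i. map (\<lambda>(u, v). {u, v}) es ! i) {..<m} B = bij_betw (\<lambda>i. {fst (es ! i), snd (es ! i)}) {..<m} B" for B
    by (rule bij_betw_cong) (simp add: m_def case_prod_beta)
  ultimately show ?thesis by (simp add: m_def)
qed

lemma card_edges: "card (edge_set es) = m"
  using bij_betw_same_card[OF edge_bij] by simp

text \<open>Interface for all stages that form capped sums: given final lower arrays and earlier
  rows, it remains to evaluate the summand and the sum.\<close>

lemma sum_stage:
  assumes k: "k < 15" "stages ! k = Stage k b1 b2 b3 b4 (CC 0) (sum_up f cap)"
    and H: "\<And>\<tau>' i1 i2 i3 x a. (\<And>j. j < k \<Longrightarrow> \<tau>' j = F j) \<Longrightarrow> i1 < cexv I b1 \<Longrightarrow> i2 < cexv I b2 \<Longrightarrow> i3 < cexv I b3 \<Longrightarrow>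
      (\<And>a b c. a < i1 \<Longrightarrow> b < cexv I b2 \<Longrightarrow> c < cexv I b3 \<Longrightarrow> \<tau>' k a b c = G a b c) \<Longrightarrow> x < cexv I b4 \<Longrightarrow>
      ev I (regs i1 i2 i3 x a) \<tau>' f = H i1 i2 i3 x"
    and cap: "\<And>\<rho> \<tau>'. ev I \<rho> \<tau>' cap = c"
    and G: "\<And>i1 i2 i3. i1 < cexv I b1 \<Longrightarrow> i2 < cexv I b2 \<Longrightarrow> i3 < cexv I b3 \<Longrightarrow>
      min (\<Sum>x<cexv I b4. H i1 i2 i3 x) c = G i1 i2 i3"
    and bounds: "i1 < cexv I b1" "i2 < cexv I b2" "i3 < cexv I b3"
  shows "F k i1 i2 i3 = G i1 i2 i3"
  unfolding F_def
proof (rule sem_of_nth[OF target_stages _ k(2) _ bounds])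
  show "k < length stages" using k(1) by (simp add: length_stages)
  fix \<tau>' i1 i2 i3
  assume a: "\<And>j. j < k \<Longrightarrow> \<tau>' j = sem_of I stages (\<lambda>_ _ _ _. 0) j"
    "i1 < cexv I b1" "i2 < cexv I b2" "i3 < cexv I b3"
    "\<And>a b c. a < i1 \<Longrightarrow> b < cexv I b2 \<Longrightarrow> c < cexv I b3 \<Longrightarrow> \<tau>' k a b c = G a b c"
  have "accu I 0 (sum_up f cap) \<tau>' i1 i2 i3 (cexv I b4) = min (\<Sum>x<cexv I b4. H i1 i2 i3 x) c"
    by (rule accu_sum) (use H[OF a(1)[folded F_def] a(2-5)] cap in auto)
  then show "accu I (cexv I (CC 0)) (sum_up f cap) \<tau>' i1 i2 i3 (cexv I b4) = G i1 i2 i3"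
    using G[OF a(2-4)] by simp
qed

lemma n_pos: "0 < n" using sn by simp

lemma F_adj:
  assumes "u < n" "v < n"
  shows "F 0 u v 0 = of_bool (A u v)"
proof (rule sum_stage[where G = "\<lambda>u v _. of_bool (A u v)" and c = 1 and
      H = "\<lambda>u v _ i. of_bool (fst (es ! i) = u \<and> snd (es ! i) = v \<or> fst (es ! i) = v \<and> snd (es ! i) = u)"])
  show "stages ! 0 = Stage 0 size_n size_n (CC 1) (CL 1 0) (CC 0) (sum_up adj_ex (Cn 1))" by (simp add: stages_def)
qed (use assms in \<open>simp_all only: min_sum_bool_ex A_iff, simp_all add: I_header I_edges adj_ex_def bool_arith\<close>)

lemma F_reach:
  assumes k: "k < 15" "0 < k" "stages ! k = reach_stage k src"
    and src: "\<And>\<rho> \<tau>'. (\<And>j. j < k \<Longrightarrow> \<tau>' j = F j) \<Longrightarrow> ev I \<rho> \<tau>' src = z"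
    and b: "i < n" "v < n"
  shows "F k i v 0 = of_bool (reach z i v)"
proof (rule sum_stage[where G = "\<lambda>i v _. of_bool (reach z i v)" and c = 1 and
      H = "\<lambda>i v _ u. of_bool (i = 0 \<and> v = z \<or> 0 < i \<and> reach z (i - 1) u \<and> (A u v \<or> u = v))", OF k(1) k(3)[unfolded reach_stage_def]])
  fix \<tau>' :: arrays and i1 i2 i3 x a
  assume a: "\<And>j. j < k \<Longrightarrow> \<tau>' j = F j" "i1 < cexv I size_n" "i2 < cexv I size_n" "x < cexv I size_n"
    "\<And>a b c. a < i1 \<Longrightarrow> b < cexv I size_n \<Longrightarrow> c < cexv I (CC 1) \<Longrightarrow> \<tau>' k a b c = of_bool (reach z a b)"
  have "\<tau>' 0 = F 0" using a(1) k(2) by blast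
  moreover have "ev I (regs i1 i2 i3 x a) \<tau>' src = z" using src a(1) by blast
  \<comment> \<open>The previous round is a finished row of the same table.\<close>
  moreover have "\<tau>' k (i1 - 1) x 0 = of_bool (reach z (i1 - 1) x)" if "0 < i1" using a that by simp
  ultimately show "ev I (regs i1 i2 i3 x a) \<tau>' (reach_ex k src) = of_bool (i1 = 0 \<and> i2 = z \<or> 0 < i1 \<and> reach z (i1 - 1) x \<and> (A x i2 \<or> x = i2))"
    using a(2-4) F_adj[of x i2] by (cases "i1 = 0") (simp_all add: reach_ex_def I_header bool_arith)
next
  fix i1 i2 i3 assume "i1 < cexv I size_n" "i2 < cexv I size_n"
  then have b: "i1 < n" "i2 < n" by (simp_all add: I_header)
  have "(\<exists>u<n. i1 = 0 \<and> i2 = z \<or> 0 < i1 \<and> reach z (i1 - 1) u \<and> (A u i2 \<or> u = i2)) \<longleftrightarrow> reach z i1 i2"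
  proof (cases i1)
    case 0
    then show ?thesis using n_pos by auto
  next
    case (Suc j)
    then show ?thesis using b A_less by auto
  qed
  then show "min (\<Sum>u<cexv I size_n. of_bool (i1 = 0 \<and> i2 = z \<or> 0 < i1 \<and> reach z (i1 - 1) u \<and> (A u i2 \<or> u = i2))) 1 = (of_bool (reach z i1 i2) :: nat)"
    unfolding cexv.simps I_header add_0_right by (subst min_sum_bool_ex) simp
qed (use b in \<open>simp_all add: I_header\<close>)

lemma count_stage:
  assumes k: "k < 15" "stages ! k = Stage k size_n (CC 1) (CC 1) size_n (CC 0) (sum_up f (Cell 0))"
    and H: "\<And>\<tau>' v u i2 i3 a. (\<And>j. j < k \<Longrightarrow> \<tau>' j = F j) \<Longrightarrow> v < n \<Longrightarrow> u < n \<Longrightarrow>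
      ev I (regs v i2 i3 u a) \<tau>' f = of_bool (P v u)"
    and v: "v < n"
  shows "F k v 0 0 = card {u. u < n \<and> P v u}"
proof (rule sum_stage[where G = "\<lambda>v _ _. card {u. u < n \<and> P v u}" and c = n and H = "\<lambda>v _ _ u. of_bool (P v u)", OF k])
  fix i1 i2 i3
  show "min (\<Sum>x<cexv I size_n. of_bool (P i1 x)) n = card {u. u < n \<and> P i1 u}"
    by (simp only: cexv.simps I_header add_0_right min_sum_bool)
qed (use H v in \<open>simp_all add: I_header\<close>)

lemma F_dist:
  assumes k: "k < 15" "stages ! k = dist_stage k j" "j < k"
    and r: "\<And>i v. i < n \<Longrightarrow> v < n \<Longrightarrow> F j i v 0 = of_bool (reach z i v)" and v: "v < n"
  shows "F k v 0 0 = dist z v"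
proof -
  have "F k v 0 0 = card {u. u < n \<and> \<not> reach z u v}"
    by (rule count_stage[OF k(1) k(2)[unfolded dist_stage_def], where P = "\<lambda>v u. \<not> reach z u v"])
      (use k(3) r v in \<open>simp_all add: bool_arith\<close>)
  then show ?thesis by (simp add: dist_def)
qed

lemma F_reach_s: "i < n \<Longrightarrow> v < n \<Longrightarrow> F 1 i v 0 = of_bool (reach s i v)"
  by (rule F_reach[where src = "Cell 2"]) (simp_all add: stages_def I_header)

lemma F_dist_s: "v < n \<Longrightarrow> F 2 v 0 0 = dist s v"
  by (rule F_dist[OF _ _ _ F_reach_s]) (simp_all add: stages_def)

lemma F_degree: "v < n \<Longrightarrow> F 3 v 0 0 = degree v"
proof -
  assume v: "v < n"
  have "F 3 v 0 0 = card {u. u < n \<and> A u v}"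
    by (rule count_stage[where f = "arr2 0 var row" and P = "\<lambda>v u. A u v"]) (use v in \<open>simp_all add: stages_def F_adj\<close>)
  moreover have "{u. u < n \<and> A u v} = {u. A u v}" using A_less by auto
  ultimately show ?thesis by (simp add: degree_def)
qed

definition beats :: "nat \<Rightarrow> nat \<Rightarrow> bool" where
  "beats u v \<longleftrightarrow> dist s v < dist s u \<or> (dist s v = dist s u \<and> (degree u < degree v \<or> (degree u = degree v \<and> u < v)))"

lemma F_beats: "v < n \<Longrightarrow> F 4 v 0 0 = card {u. u < n \<and> u \<in> comp s \<and> beats u v}"
  by (rule count_stage[where f = beats_ex and P = "\<lambda>v u. u \<in> comp s \<and> beats u v"])
    (simp_all add: stages_def beats_ex_def F_dist_s F_degree bool_arith I_header comp_iff_dist[OF sn] beats_def)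

text \<open>A lexicographic optimum: greatest distance, then least degree, then least
  number.\<close>

lemma best_exists: "\<exists>z\<in>comp s. \<forall>v\<in>comp s. v \<noteq> z \<longrightarrow> beats z v"
proof -
  let ?C = "comp s"
  have fin: "finite ?C" by (rule finite_subset[of _ "{..<n}"]) (use comp_less[OF sn] in auto)
  define S where "S = {v \<in> ?C. dist s v = Max (dist s ` ?C)}"
  have "?C \<noteq> {}" using comp_self[of s] by blast
  then have "Max (dist s ` ?C) \<in> dist s ` ?C" using fin by (intro Max_in) simp_all
  then obtain y where "y \<in> ?C" "dist s y = Max (dist s ` ?C)" by (metis imageE)
  then have S: "S \<noteq> {}" "finite S" using fin by (auto simp: S_def)
  define T where "T = {v \<in> S. degree v = Min (degree ` S)}"
  have "Min (degree ` S) \<in> degree ` S" using S by (intro Min_in) auto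
  then obtain x where "x \<in> S" "degree x = Min (degree ` S)" by (metis imageE)
  then have T: "T \<noteq> {}" "finite T" using S(2) by (auto simp: T_def)
  define z where "z = Min T"
  have z: "z \<in> T" unfolding z_def using T by (intro Min_in)
  show ?thesis
  proof (intro bexI ballI impI)
    show "z \<in> ?C" using z by (simp add: T_def S_def)
    fix v assume v: "v \<in> ?C" "v \<noteq> z"
    have zd: "dist s z = Max (dist s ` ?C)" "degree z = Min (degree ` S)" using z by (simp_all add: T_def S_def)
    have "dist s v \<le> dist s z" using fin v zd by simp
    moreover have "degree z \<le> degree v" if "dist s v = dist s z" using that v S zd by (simp add: S_def)
    moreover have "z < v" if "dist s v = dist s z" "degree z = degree v"
    proof -
      have "v \<in> T" using that v zd by (simp add: T_def S_def)
      then have "z \<le> v" unfolding z_def using T by simp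
      then show ?thesis using v by simp
    qed
    ultimately show "beats z v" unfolding beats_def by force
  qed
qed

definition z :: nat where
  "z = (SOME z. z \<in> comp s \<and> (\<forall>v\<in>comp s. v \<noteq> z \<longrightarrow> beats z v))"

lemma z_props: "z \<in> comp s" "\<And>v. v \<in> comp s \<Longrightarrow> v \<noteq> z \<Longrightarrow> beats z v"
proof -
  have "z \<in> comp s \<and> (\<forall>v\<in>comp s. v \<noteq> z \<longrightarrow> beats z v)"
    unfolding z_def by (rule someI_ex) (use best_exists in blast)
  then show "z \<in> comp s" "\<And>v. v \<in> comp s \<Longrightarrow> v \<noteq> z \<Longrightarrow> beats z v" by blast+
qed

lemma zn: "z < n" using comp_less[OF sn z_props(1)] .

lemma unbeaten_iff:
  assumes "v < n"
  shows "v \<in> comp s \<and> card {u. u < n \<and> u \<in> comp s \<and> beats u v} = 0 \<longleftrightarrow> v = z"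
proof
  assume v: "v \<in> comp s \<and> card {u. u < n \<and> u \<in> comp s \<and> beats u v} = 0"
  then have "{u. u < n \<and> u \<in> comp s \<and> beats u v} = {}" by simp
  then have "\<not> beats z v" using zn z_props(1) by blast
  then show "v = z" using z_props(2) v by blast
next
  assume "v = z"
  moreover have "\<not> beats u z" if "u \<in> comp s" for u
    using z_props(2)[OF that] by (cases "u = z") (auto simp: beats_def)
  ultimately show "v \<in> comp s \<and> card {u. u < n \<and> u \<in> comp s \<and> beats u v} = 0"
    using z_props(1) by (metis (no_types, lifting) card.empty Collect_empty_eq)
qed

lemma F_source: "F 5 0 0 0 = z"
proof (rule sum_stage[where G = "\<lambda>_ _ _. z" and c = n and H = "\<lambda>_ _ _ v. if v = z then v else 0"])
  show "stages ! 5 = Stage 5 (CC 1) (CC 1) (CC 1) size_n (CC 0) (sum_up source_ex (Cell 0))" by (simp add: stages_def)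
  fix \<tau>' :: arrays and i1 i2 i3 v a
  assume t: "\<And>j. j < 5 \<Longrightarrow> \<tau>' j = F j" and "v < cexv I size_n"
  then have v: "v < n" by (simp add: I_header)
  have "ev I (regs i1 i2 i3 v a) \<tau>' source_ex = v * of_bool (v \<in> comp s \<and> card {u. u < n \<and> u \<in> comp s \<and> beats u v} = 0)"
    using v by (simp add: source_ex_def t F_dist_s F_beats I_header bool_arith comp_iff_dist[OF sn])
  then show "ev I (regs i1 i2 i3 v a) \<tau>' source_ex = (if v = z then v else 0)"
    using unbeaten_iff[OF v] by simp
qed (use zn in \<open>simp_all add: I_header\<close>)

lemma F_reach_z: "i < n \<Longrightarrow> v < n \<Longrightarrow> F 6 i v 0 = of_bool (reach z i v)"
  by (rule F_reach[where src = "arr1 5 (Cn 0)"]) (simp_all add: stages_def F_source)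

lemma F_dist_z: "v < n \<Longrightarrow> F 7 v 0 0 = dist z v"
  by (rule F_dist[OF _ _ _ F_reach_z]) (simp_all add: stages_def)

lemma F_nexts: "v < n \<Longrightarrow> F 8 v 0 0 = nexts z v"
proof -
  assume v: "v < n"
  have "F 8 v 0 0 = card {u. u < n \<and> A u v \<and> dist z u = dist z v + 1}"
    by (rule count_stage[where f = "Ml (arr2 0 var row) (eEq (arr1 7 var) (Ad (arr1 7 row) (Cn 1)))"
          and P = "\<lambda>v u. A u v \<and> dist z u = dist z v + 1"])
      (use v in \<open>simp_all add: stages_def F_adj F_dist_z bool_arith\<close>)
  moreover have "{u. u < n \<and> A u v \<and> dist z u = dist z v + 1} = {u. A u v \<and> dist z u = dist z v + 1}"
    using A_less by auto
  ultimately show ?thesis by (simp add: nexts_def)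
qed

lemma F_prevs: "v < n \<Longrightarrow> F 9 v 0 0 = prevs z v"
proof -
  assume v: "v < n"
  have "F 9 v 0 0 = card {u. u < n \<and> A u v \<and> dist z u + 1 = dist z v}"
    by (rule count_stage[where f = "Ml (arr2 0 var row) (eEq (Ad (arr1 7 var) (Cn 1)) (arr1 7 row))"
          and P = "\<lambda>v u. A u v \<and> dist z u + 1 = dist z v"])
      (use v in \<open>simp_all add: stages_def F_adj F_dist_z bool_arith\<close>)
  moreover have "{u. u < n \<and> A u v \<and> dist z u + 1 = dist z v} = {u. A u v \<and> dist z u + 1 = dist z v}"
    using A_less by auto
  ultimately show ?thesis by (simp add: prevs_def)
qed

lemma F_rank: "v < n \<Longrightarrow> F 10 v 0 0 = rank z v"
  unfolding rank_def
  by (rule count_stage[where f = bef_ex and P = "\<lambda>v u. bef z u v"])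
    (simp_all add: stages_def bef_ex_def F_dist_z F_nexts F_prevs bool_arith bef_def)

definition pos :: "nat \<Rightarrow> nat" where
  "pos = (if rank z s < rank z t then position (rank z) s t else position (rank z) t s)"

lemma pos_less: "s \<noteq> t \<Longrightarrow> v < n \<Longrightarrow> pos v < n"
  using position_less[of s t v "rank z"] position_less[of t s v "rank z"] sn tn by (simp add: pos_def)

definition is_last :: "nat \<Rightarrow> bool" where
  "is_last v \<longleftrightarrow> v = s \<and> rank z t < rank z s \<or> v = t \<and> rank z s < rank z t"

lemma sum_pos:
  assumes st: "s \<noteq> t" and v: "v < n"
  shows "(\<Sum>u<n. of_bool (is_last v \<and> 0 < u) + of_bool (v \<noteq> s \<and> v \<noteq> t) *
    (of_bool (u = 0) + of_bool (u \<noteq> s \<and> u \<noteq> t \<and> rank z u < rank z v))) = pos v"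
proof -
  have "rank z s \<noteq> rank z t" using rank_inj st sn tn by (auto dest: inj_onD)
  then have less: "rank z s < rank z t \<or> rank z t < rank z s" by linarith
  show ?thesis
  proof (cases "v = s \<or> v = t")
    case True
    have "(\<Sum>u<n. of_bool (0 < u)) = n - 1"
    proof -
      have "{u. u < n \<and> 0 < u} = {1..<n}" by auto
      then show ?thesis by (simp only: sum_bool) simp
    qed
    then show ?thesis using True less st by (auto simp: is_last_def pos_def position_def)
  next
    case False
    have "card {u. u < n \<and> u = 0} = 1"
    proof -
      have "{u. u < n \<and> u = 0} = {0}" using n_pos by auto
      then show ?thesis by simp
    qed
    moreover have "{u. u < n \<and> u \<noteq> t \<and> u \<noteq> s \<and> rank z u < rank z v} = {u. u < n \<and> u \<noteq> s \<and> u \<noteq> t \<and> rank z u < rank z v}"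
      by auto
    ultimately show ?thesis using False
      by (simp add: is_last_def pos_def position_def sum.distrib sum_bool)
  qed
qed

lemma F_pos:
  assumes st: "s \<noteq> t" and v: "v < n"
  shows "F 11 v 0 0 = pos v"
proof (rule sum_stage[where f = position_ex and cap = "Cell 0" and c = n and G = "\<lambda>v _ _. pos v" and
      H = "\<lambda>v _ _ u. of_bool (is_last v \<and> 0 < u) + of_bool (v \<noteq> s \<and> v \<noteq> t) *
        (of_bool (u = 0) + of_bool (u \<noteq> s \<and> u \<noteq> t \<and> rank z u < rank z v))"])
  show "stages ! 11 = Stage 11 size_n (CC 1) (CC 1) size_n (CC 0) (sum_up position_ex (Cell 0))" by (simp add: stages_def)
  fix i1 i2 i3 assume "i1 < cexv I size_n"
  then have i: "i1 < n" by (simp add: I_header)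
  show "min (\<Sum>u<cexv I size_n. of_bool (is_last i1 \<and> 0 < u) + of_bool (i1 \<noteq> s \<and> i1 \<noteq> t) *
      (of_bool (u = 0) + of_bool (u \<noteq> s \<and> u \<noteq> t \<and> rank z u < rank z i1))) n = pos i1"
    unfolding cexv.simps I_header add_0_right using sum_pos[OF st i] pos_less[OF st i] by simp
next
  fix \<tau>' :: arrays and i1 i2 i3 u a
  assume t: "\<And>j. j < 11 \<Longrightarrow> \<tau>' j = F j" and "i1 < cexv I size_n" "u < cexv I size_n"
  then have i: "i1 < n" "u < n" by (simp_all add: I_header)
  show "ev I (regs i1 i2 i3 u a) \<tau>' position_ex = of_bool (is_last i1 \<and> 0 < u) + of_bool (i1 \<noteq> s \<and> i1 \<noteq> t) *
      (of_bool (u = 0) + of_bool (u \<noteq> s \<and> u \<noteq> t \<and> rank z u < rank z i1))"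
    using i sn tn by (simp add: position_ex_def t F_rank I_header bool_arith is_last_def)
qed (use v in \<open>simp_all add: I_header\<close>)

definition lo :: "nat set \<Rightarrow> nat" where "lo e = Min (pos ` e)"
definition hi :: "nat set \<Rightarrow> nat" where "hi e = Max (pos ` e)"

abbreviation "spans \<equiv> span_count (comp_edges z) lo hi"

lemma span_count_eq:
  "card {i. i < m \<and> fst (es ! i) \<in> comp z \<and> min (pos (fst (es ! i))) (pos (snd (es ! i))) < b \<and>
      (c \<le> pos (fst (es ! i)) \<or> c \<le> pos (snd (es ! i)))} = spans b c"
  unfolding span_count_def
proof (rule bij_betw_same_card[of "\<lambda>i. {fst (es ! i), snd (es ! i)}"])
  let ?g = "\<lambda>i. {fst (es ! i), snd (es ! i)}"
  let ?S = "{i. i < m \<and> fst (es ! i) \<in> comp z \<and> min (pos (fst (es ! i))) (pos (snd (es ! i))) < b \<and>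
      (c \<le> pos (fst (es ! i)) \<or> c \<le> pos (snd (es ! i)))}"
  have A_es: "A (fst (es ! i)) (snd (es ! i))" if "i < m" for i using that A_iff by blast
  have mem: "?g i \<in> {e \<in> comp_edges z. lo e < b \<and> c \<le> hi e} \<longleftrightarrow> i \<in> ?S" if "i < m" for i
    using that A_es[OF that] by (simp add: comp_edges_pair lo_def hi_def le_max_iff_disj)
  have "inj_on ?g ?S" using edge_bij unfolding bij_betw_def by (rule inj_on_subset[OF conjunct1]) auto
  moreover have "?g ` ?S = {e \<in> comp_edges z. lo e < b \<and> c \<le> hi e}"
  proof (rule set_eqI, rule iffI)
    fix e assume "e \<in> ?g ` ?S"
    then obtain i where "i \<in> ?S" "e = ?g i" by blast
    then show "e \<in> {e \<in> comp_edges z. lo e < b \<and> c \<le> hi e}" using mem[of i] by simp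
  next
    fix e assume e: "e \<in> {e \<in> comp_edges z. lo e < b \<and> c \<le> hi e}"
    then obtain u v where "e = {u, v}" "A u v" unfolding comp_edges_def by blast
    then have "e \<in> ?g ` {..<m}" using edge_bij by (simp add: bij_betw_def A_def)
    then obtain i where i: "i < m" "e = ?g i" by blast
    then show "e \<in> ?g ` ?S" using mem[OF i(1)] e by blast
  qed
  ultimately show "bij_betw ?g ?S {e \<in> comp_edges z. lo e < b \<and> c \<le> hi e}" by (simp add: bij_betw_def)
qed

lemma F_span:
  assumes st: "s \<noteq> t" and bc: "b < n" "c < n"
  shows "F 12 b c 0 = spans b c"
proof (rule sum_stage[where f = span_ex and cap = "Cell 1" and c = m and G = "\<lambda>b c _. spans b c" and
      H = "\<lambda>b c _ i. of_bool (fst (es ! i) \<in> comp z \<and> min (pos (fst (es ! i))) (pos (snd (es ! i))) < b \<and>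
      (c \<le> pos (fst (es ! i)) \<or> c \<le> pos (snd (es ! i))))"])
  show "stages ! 12 = Stage 12 size_n size_n (CC 1) (CL 1 0) (CC 0) (sum_up span_ex (Cell 1))" by (simp add: stages_def)
  fix i1 i2 i3
  show "min (\<Sum>i<cexv I (CL 1 0). of_bool (fst (es ! i) \<in> comp z \<and> min (pos (fst (es ! i))) (pos (snd (es ! i))) < i1 \<and>
      (i2 \<le> pos (fst (es ! i)) \<or> i2 \<le> pos (snd (es ! i))))) m = spans i1 i2"
    unfolding cexv.simps One_nat_def I_header add_0_right min_sum_bool by (rule span_count_eq)
next
  fix \<tau>' :: arrays and i1 i2 i3 i a
  assume t: "\<And>j. j < 12 \<Longrightarrow> \<tau>' j = F j" and "i < cexv I (CL 1 0)"
  then have i: "i < m" by (simp add: I_header)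
  show "ev I (regs i1 i2 i3 i a) \<tau>' span_ex = of_bool (fst (es ! i) \<in> comp z \<and>
      min (pos (fst (es ! i))) (pos (snd (es ! i))) < i1 \<and> (i2 \<le> pos (fst (es ! i)) \<or> i2 \<le> pos (snd (es ! i))))"
    using edge_bounds[OF i]
    by (simp add: span_ex_def I_edges[OF i] t F_dist_z F_pos[OF st] I_header bool_arith comp_iff_dist[OF zn])
qed (use bc in \<open>simp_all add: I_header\<close>)

lemma min_upto_const: "0 < k \<Longrightarrow> min_upto B (\<lambda>_. x) k = min B x"
  by (induction k rule: nat_induct_non_zero) auto

lemma F_dp:
  assumes st: "s \<noteq> t" and i: "i < m + 2" and bc: "b < n" "c < n"
  shows "F 13 i b c = dp spans (\<beta> + 1) n i b c"
  unfolding F_def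
proof (rule sem_of_nth[OF target_stages, where k = 13 and G = "\<lambda>i b c. dp spans (\<beta> + 1) n i b c"])
  show "stages ! 13 = Stage 13 (CL 1 2) size_n size_n size_n (CL 4 1) (Mn (Reg 4) dp_ex)" by (simp add: stages_def)
  fix \<tau>' :: arrays and i1 i2 i3
  assume a: "\<And>j. j < 13 \<Longrightarrow> \<tau>' j = sem_of I stages (\<lambda>_ _ _ _. 0) j"
    "i1 < cexv I (CL 1 2)" "i2 < cexv I size_n" "i3 < cexv I size_n"
    "\<And>a b c. a < i1 \<Longrightarrow> b < cexv I size_n \<Longrightarrow> c < cexv I size_n \<Longrightarrow> \<tau>' 13 a b c = dp spans (\<beta> + 1) n a b c"
  have t: "\<tau>' 12 = F 12" using a(1)[of 12] by (simp add: F_def)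
  have b: "i2 < n" "i3 < n" using a(3,4) by (simp_all add: I_header)
  \<comment> \<open>One expression serves all levels. At level 0 it does not depend on
    \<open>x\<close>, and a minimum over \<open>n > 0\<close> equal values returns that
    value.\<close>
  define H where "H x = (if i1 = 0 then if i2 = 0 \<and> i3 = 1 then 0 else \<beta> + 1
    else if x \<le> i2 \<and> i2 \<le> i3 then dp spans (\<beta> + 1) n (i1 - 1) x i2 + (spans i2 i3 - spans x i3) else \<beta> + 1)" for x
  have "accu I (\<beta> + 1) (Mn (Reg 4) dp_ex) \<tau>' i1 i2 i3 n = min_upto (\<beta> + 1) H n"
  proof (rule accu_min)
    fix x a' assume x: "x < n" "a' \<le> \<beta> + 1"
    show "min a' (ev I (regs i1 i2 i3 x a') \<tau>' dp_ex) = min a' (H x)"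
    proof (cases "i1 = 0")
      case True
      then show ?thesis using x(2) by (simp add: dp_ex_def H_def I_header bool_arith)
    next
      case False
      then have "\<tau>' 13 (i1 - 1) x i2 = dp spans (\<beta> + 1) n (i1 - 1) x i2" using a(5)[of "i1 - 1" x i2] b x(1) by (simp add: I_header)
      then show ?thesis using False x b F_span[OF st]
        by (simp add: dp_ex_def H_def I_header bool_arith t)
    qed
  qed
  also have "\<dots> = dp spans (\<beta> + 1) n i1 i2 i3"
  proof (cases i1)
    case 0
    then have "H = (\<lambda>_. if i2 = 0 \<and> i3 = 1 then 0 else \<beta> + 1)" by (simp add: H_def fun_eq_iff)
    then show ?thesis using n_pos 0 by (simp add: min_upto_const)
  next
    case (Suc j)
    then have H_eq: "H = (\<lambda>x. if x \<le> i2 \<and> i2 \<le> i3 then dp spans (\<beta> + 1) n j x i2 + (spans i2 i3 - spans x i3) else \<beta> + 1)"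
      by (simp add: H_def fun_eq_iff)
    show ?thesis unfolding Suc dp.simps H_eq ..
  qed
  finally show "accu I (cexv I (CL 4 1)) (Mn (Reg 4) dp_ex) \<tau>' i1 i2 i3 (cexv I size_n) = dp spans (\<beta> + 1) n i1 i2 i3"
    by (simp add: I_header)
qed (use i bc in \<open>simp_all add: I_header length_stages\<close>)

lemma F_answer: "F 14 0 0 0 = of_bool (length_bounded_cut {..<n} (edge_set es) s t \<beta> l)"
proof -
  define L where "L = max 1 (min l m)"
  \<comment> \<open>The conditions independent of \<open>b\<close> are placed under the quantifier
    as well, which is harmless for \<open>n > 0\<close>; the answer then is a single capped
    sum.\<close>
  let ?H = "\<lambda>b. s \<noteq> t \<and> (t \<notin> comp z \<or> dp spans (\<beta> + 1) n L b (n - 1) \<le> \<beta>)"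
  have L: "min l m + (1 - min l m) = L" by (simp add: L_def)
  have Lm: "L < m + 2" by (simp add: L_def)
  have "F 14 0 0 0 = of_bool (\<exists>b<n. ?H b)"
  proof (rule sum_stage[where f = answer_ex and cap = "Cn 1" and c = 1 and G = "\<lambda>_ _ _. of_bool (\<exists>b<n. ?H b)" and
        H = "\<lambda>_ _ _ b. of_bool (?H b)"])
    show "stages ! 14 = Stage 14 (CC 1) (CC 1) (CC 1) size_n (CC 0) (sum_up answer_ex (Cn 1))" by (simp add: stages_def)
    show "min (\<Sum>b<cexv I size_n. of_bool (?H b)) 1 = (of_bool (\<exists>b<n. ?H b) :: nat)" for i1 i2 i3 :: nat
      unfolding cexv.simps I_header add_0_right by (rule min_sum_bool_ex)
    fix \<tau>' :: arrays and i1 i2 i3 b a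
    assume t: "\<And>j. j < 14 \<Longrightarrow> \<tau>' j = F j" and "b < cexv I size_n"
    then have b: "b < n" by (simp add: I_header)
    have lev: "ev I \<rho> \<tau>' level_ex = L" for \<rho> using L by (simp add: level_ex_def I_header)
    have "ev I (regs i1 i2 i3 b a) \<tau>' answer_ex = of_bool (s \<noteq> t \<and> (n \<le> dist z t \<or> F 13 L b (n - 1) \<le> \<beta>))"
      using tn by (simp add: answer_ex_def t F_dist_z I_header bool_arith lev)
    also have "\<dots> = of_bool (?H b)"
      using F_dp[OF _ Lm b, of "n - 1"] n_pos comp_iff_dist[OF zn, of t] by (auto simp: not_less)
    finally show "ev I (regs i1 i2 i3 b a) \<tau>' answer_ex = of_bool (?H b)" .
  qed simp_all
  also have "(\<exists>b<n. ?H b) \<longleftrightarrow> length_bounded_cut {..<n} (edge_set es) s t \<beta> l"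
  proof (cases "s = t")
    case True
    then show ?thesis using no_cut_same[of s "{..<n}"] sn by simp
  next
    case st: False
    have cz: "comp z = comp s" by (rule comp_eq[OF z_props(1)])
    show ?thesis
    proof (cases "t \<in> comp z")
      case False
      have "length_bounded_cut {..<n} (edge_set es) s t \<beta> l"
        by (rule cut_if_unreachable[OF simple A_def sn tn l_pos]) (use False cz in simp)
      then show ?thesis using False st n_pos by blast
    next
      case True
      have "length_bounded_cut {..<n} (edge_set es) s t \<beta> l \<longleftrightarrow>
        (\<exists>x<n. dp (span_count (comp_edges z) (\<lambda>e. Min (pos ` e)) (\<lambda>e. Max (pos ` e))) (\<beta> + 1) n L x (n - 1) \<le> \<beta>)"
      proof (rule cut_iff_dp[OF simple A_def pig sn tn st l_pos _ z_props(1) _ True pos_def])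
        show "L = max 1 (min l (card (edge_set es)))" by (simp add: L_def card_edges)
        fix u assume "u \<in> comp s"
        then show "dist s u < dist s z \<or> dist s u = dist s z \<and> degree z \<le> degree u"
          using z_props(2)[of u] by (cases "u = z") (auto simp: beats_def)
      qed
      moreover have "lo = (\<lambda>e. Min (pos ` e))" "hi = (\<lambda>e. Max (pos ` e))" by (auto simp: lo_def hi_def)
      ultimately show ?thesis using True st by simp
    qed
  qed
  finally show ?thesis .
qed

end

section \<open>Word size, initial memory and the final time bound\<close>

lemma (in cut_instance) m_le: "m \<le> n ^ 2"
proof -
  have "edge_set es \<subseteq> (\<lambda>(u, v). {u, v}) ` ({..<n} \<times> {..<n})"
    using simple unfolding simple_graph_def by auto
  then have "card (edge_set es) \<le> card ((\<lambda>(u, v). {u, v}) ` ({..<n} \<times> {..<n}))" by (intro card_mono) auto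
  also have "\<dots> \<le> n ^ 2" using card_image_le[of "{..<n} \<times> {..<n}" "\<lambda>(u, v). {u, v}"] by (simp add: power2_eq_square)
  finally show ?thesis by (simp add: card_edges)
qed

lemma (in cut_instance) I_le: "I a \<le> n + m + \<beta> + l"
proof -
  let ?xs = "[n, length es, s, t, \<beta>, l] @ concat (map (\<lambda>(u, v). [u, v]) es)"
  have "x \<le> n + m + \<beta> + l" if x: "x \<in> set ?xs" for x
  proof (cases "x \<in> set [n, length es, s, t, \<beta>, l]")
    case True
    then show ?thesis using sn tn by (auto simp: m_def)
  next
    case False
    then obtain u v where "(u, v) \<in> set es" "x = u \<or> x = v" using x by auto
    then have "x < n" using el unfolding edge_list_def by fastforce
    then show ?thesis by simp
  qed
  then show ?thesis using nth_mem[of a ?xs] unfolding I_def encode_input_def Let_def by (cases "a < length ?xs") auto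
qed

lemma (in cut_instance) initial_rel: "rel I (n + m + \<beta> + l + 2) (\<lambda>_. 0) (\<lambda>_ _ _ _. 0) I"
proof -
  have zero: "I x = 0" if "2 * m + 6 \<le> x" for x
    using that by (simp add: I_def encode_input_def Let_def length_pairs m_def)
  have "I (addr m j a b c) = 0" for j a b c by (rule zero) (simp add: addr_def)
  moreover have "I a \<le> n + m + \<beta> + l + 2" for a using I_le[of a] by simp
  ultimately show ?thesis using I_le by (simp add: rel_def I_header)
qed

theorem theorem35:
  shows "\<exists>(P :: prog) (k :: nat) (C :: nat).
    \<forall>(n :: nat) (es :: (nat \<times> nat) list) (s :: nat) (t :: nat) (\<beta> :: nat) (l :: nat).
      edge_list n es \<longrightarrow> proper_interval_graph {..<n} (edge_set es) \<longrightarrow>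
      s < n \<longrightarrow> t < n \<longrightarrow> 0 < \<beta> \<longrightarrow> 0 < l \<longrightarrow>
      decides_within ((n + \<beta> + l + 2) ^ k) P (encode_input n es s t \<beta> l)
        (length_bounded_cut {..<n} (edge_set es) s t \<beta> l)
        (C * (n ^ 3 * max 1 (card (edge_set es))))"
proof (intro exI allI impI)
  fix n :: nat and es :: "(nat \<times> nat) list" and s t \<beta> l :: nat
  assume a: "edge_list n es" "proper_interval_graph {..<n} (edge_set es)" "s < n" "t < n" "0 < \<beta>" "0 < l"
  interpret cut_instance n es s t \<beta> l by unfold_locales (fact a)+
  \<comment> \<open>The 2 is the headroom over the header cells that \<open>rel\<close>
    demands.\<close>
  define K where "K = n + m + \<beta> + l + 2"
  let ?P = "prog_of stages 14" and ?e = "cost (Mem (addr_exp (Suc 14) (Const 0) (Const 0) (Const 0))) + 2"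
  let ?S = "n ^ 3 * max 1 m"
  \<comment> \<open>The word bound mentions only \<open>n\<close>, \<open>\<beta>\<close> and
    \<open>l\<close>; \<open>m \<le> n ^ 2\<close> removes \<open>m\<close> at the price of doubling
    the exponent.\<close>
  have "K \<le> (n + \<beta> + l + 2) ^ 2"
  proof -
    have "n ^ 2 + (n + \<beta> + l + 2) \<le> (n + \<beta> + l + 2) ^ 2" by (simp add: power2_eq_square algebra_simps)
    then show ?thesis using m_le by (simp add: K_def)
  qed
  then have "K ^ prog_expo ?P \<le> ((n + \<beta> + l + 2) ^ 2) ^ prog_expo ?P" by (rule power_mono) simp
  then have W: "K ^ prog_expo ?P \<le> (n + \<beta> + l + 2) ^ (2 * prog_expo ?P)" by (simp only: power_mult)
  have "1 \<le> I 0" using n_pos by (simp add: I_header)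
  from runs_prog_of[OF stages_checked this W order_refl initial_rel[folded K_def]]
  have "runs ((n + \<beta> + l + 2) ^ (2 * prog_expo ?P)) ?P I (sum_list (map stage_cost stages) * (256 * ?S) + ?e)
      (\<lambda>M'. M' 0 = sem_of I stages (\<lambda>_ _ _ _. 0) 14 0 0 0)"
    by (simp only: I_header One_nat_def)
  then have run: "runs ((n + \<beta> + l + 2) ^ (2 * prog_expo ?P)) ?P I (sum_list (map stage_cost stages) * (256 * ?S) + ?e)
      (\<lambda>M'. M' 0 = of_bool (length_bounded_cut {..<n} (edge_set es) s t \<beta> l))"
    using F_answer by (simp only: F_def)
  \<comment> \<open>The additive cost of the output step is absorbed into the factor, because
    \<open>n ^ 3 * max 1 m\<close> is at least 1.\<close>
  have bound: "c * (256 * y) + e \<le> (256 * c + e) * y" if "1 \<le> y" for c e y :: nat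
  proof -
    have "e * 1 \<le> e * y" using that by (rule mult_le_mono2)
    then show ?thesis by (simp add: algebra_simps)
  qed
  have "1 \<le> ?S" using n_pos by (simp add: Suc_le_eq)
  then have time: "sum_list (map stage_cost stages) * (256 * ?S) + ?e
      \<le> (256 * sum_list (map stage_cost stages) + ?e) * (n ^ 3 * max 1 (card (edge_set es)))"
    unfolding card_edges by (rule bound)
  obtain T' M' where run': "exec ((n + \<beta> + l + 2) ^ (2 * prog_expo ?P)) ?P I T' M'"
      "T' \<le> sum_list (map stage_cost stages) * (256 * ?S) + ?e"
      "M' 0 = of_bool (length_bounded_cut {..<n} (edge_set es) s t \<beta> l)"
    using run unfolding runs_def by (elim exE conjE)
  show "decides_within ((n + \<beta> + l + 2) ^ (2 * prog_expo ?P)) ?P (encode_input n es s t \<beta> l)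
        (length_bounded_cut {..<n} (edge_set es) s t \<beta> l)
        ((256 * sum_list (map stage_cost stages) + ?e) * (n ^ 3 * max 1 (card (edge_set es))))"
    unfolding decides_within_def
  proof (intro exI conjI)
    show "exec ((n + \<beta> + l + 2) ^ (2 * prog_expo ?P)) ?P (encode_input n es s t \<beta> l) T' M'"
      using run'(1) unfolding I_def .
    show "T' \<le> (256 * sum_list (map stage_cost stages) + ?e) * (n ^ 3 * max 1 (card (edge_set es)))"
      using run'(2) time by (rule le_trans)
    show "M' 0 = (if length_bounded_cut {..<n} (edge_set es) s t \<beta> l then 1 else 0)"
      using run'(3) by (simp only: of_bool_def)
  qed
qed

end
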